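(* Consider the system for $\omega=\omega(x_1,x_2,t)$ and $\rho=\rho(x_1,x_2,t)$, $(x_1,x_2)\in[0,\infty)^2$, $t\ge0$: $$\partial_t\omega+u_1\,\partial_{x_1}\omega=\frac{\rho}{x_1},\qquad \partial_t\rho+u_1\,\partial_{x_1}\rho=0,$$ $$u_1(x_1,x_2,t)=-x_1\iint_{[0,\infty)^2}\frac{y_1y_2\,\omega(y,t)}{|y|^4}\,dy+x_2\,\omega(x_1,0,t).$$ There exist smooth initial data $(\omega_0,\rho_0)$, compactly supported away from the axis $x_1=0$, such that the solution with $\omega(\cdot,0)=\omega_0$, $\rho(\cdot,0)=\rho_0$ blows up in finite time.
   Context: Here $y=(y_1,y_2)$ and $|y|^2=y_1^2+y_2^2$. Smooth data compactly supported away from the axis $x_1=0$ means $C^\infty$ functions on $[0,\infty)^2$ (smooth up to the boundary $x_2=0$) whose supports are compact subsets of $(0,\infty)\times[0,\infty)$; the supports may meet the boundary $x_2=0$. For such data the system is locally well-posed. "Blows up in finite time" means that the smooth solution cannot be continued for all times: its maximal time of existence $T_\star$ is finite. *)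

theory Defs
  imports "HOL-Analysis.Analysis"
begin

abbreviation quadrant :: "(real \<times> real) set" where
  "quadrant \<equiv> {0..} \<times> {0..}"

text \<open>
  Smoothness relative to a set: at boundary points the derivatives are one-sided. On convex sets
  with nonempty interior (the only ones used below) the derivatives \<open>f'\<close> are uniquely determined,
  so this is the usual notion of being smooth up to the part of the boundary contained in \<open>S\<close>.
\<close>

primrec Ck_on :: "nat \<Rightarrow> 'a::real_normed_vector set \<Rightarrow> ('a \<Rightarrow> real) \<Rightarrow> bool" where
  "Ck_on 0 S f \<longleftrightarrow> continuous_on S f"
| "Ck_on (Suc k) S f \<longleftrightarrow>
     (\<exists>f'. (\<forall>x\<in>S. (f has_derivative f' x) (at x within S)) \<and> (\<forall>v. Ck_on k S (\<lambda>x. f' x v)))"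

definition smooth_on :: "'a::real_normed_vector set \<Rightarrow> ('a \<Rightarrow> real) \<Rightarrow> bool" where
  "smooth_on S f \<longleftrightarrow> (\<forall>k. Ck_on k S f)"

text \<open>The support may meet the boundary \<open>x\<^sub>2 = 0\<close> but not the axis \<open>x\<^sub>1 = 0\<close>.\<close>

definition admissible_data :: "(real \<Rightarrow> real \<Rightarrow> real) \<Rightarrow> bool" where
  "admissible_data f \<longleftrightarrow>
     smooth_on quadrant (\<lambda>(x1, x2). f x1 x2) \<and>
     (let K = closure {(x1, x2) \<in> quadrant. f x1 x2 \<noteq> 0}
      in compact K \<and> K \<subseteq> {0<..} \<times> {0..})"

text \<open>Space-time functions are written \<open>\<omega> x1 x2 t\<close>.\<close>

definition kernel_integrand :: "(real \<Rightarrow> real \<Rightarrow> real \<Rightarrow> real) \<Rightarrow> real \<Rightarrow> real \<times> real \<Rightarrow> real" where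
  "kernel_integrand \<omega> t = (\<lambda>(y1, y2). y1 * y2 * \<omega> y1 y2 t / (y1\<^sup>2 + y2\<^sup>2)\<^sup>2)"

definition velocity ::
    "(real \<Rightarrow> real \<Rightarrow> real \<Rightarrow> real) \<Rightarrow> real \<Rightarrow> real \<Rightarrow> real \<Rightarrow> real" where
  "velocity \<omega> x1 x2 t =
     - x1 * (LINT y:quadrant|lborel. kernel_integrand \<omega> t y) + x2 * \<omega> x1 0 t"

definition partial_x1 ::
    "(real \<Rightarrow> real \<Rightarrow> real \<Rightarrow> real) \<Rightarrow> real \<Rightarrow> real \<Rightarrow> real \<Rightarrow> real" where
  "partial_x1 f x1 x2 t = deriv (\<lambda>s. f s x2 t) x1"

text \<open>The time derivative on \<open>[0, T)\<close>, one-sided at \<open>t = 0\<close>.\<close>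

definition partial_t ::
    "real \<Rightarrow> (real \<Rightarrow> real \<Rightarrow> real \<Rightarrow> real) \<Rightarrow> real \<Rightarrow> real \<Rightarrow> real \<Rightarrow> real" where
  "partial_t T f x1 x2 t = vector_derivative (\<lambda>s. f x1 x2 s) (at t within {0..<T})"

text \<open>
  Smooth solutions on \<open>[0, T)\<close> with data \<open>\<omega>0\<close>, \<open>\<rho>0\<close>. The integral defining the velocity is
  required to converge absolutely, since the Bochner integral of a non-integrable function
  is \<open>0\<close> by convention. The support of the solution is deliberately not constrained, so that
  leaving the class means losing smoothness or losing a continuous velocity field, not merely
  losing a support property. The equations are imposed for \<open>x1 > 0\<close>, where \<open>\<rho> / x1\<close> is meaningful.
\<close>

definition smooth_solution ::
    "real \<Rightarrow> (real \<Rightarrow> real \<Rightarrow> real) \<Rightarrow> (real \<Rightarrow> real \<Rightarrow> real) \<Rightarrow>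
     (real \<Rightarrow> real \<Rightarrow> real \<Rightarrow> real) \<Rightarrow> (real \<Rightarrow> real \<Rightarrow> real \<Rightarrow> real) \<Rightarrow> bool" where
  "smooth_solution T \<omega>0 \<rho>0 \<omega> \<rho> \<longleftrightarrow>
     smooth_on (quadrant \<times> {0..<T}) (\<lambda>((x1, x2), t). \<omega> x1 x2 t) \<and>
     smooth_on (quadrant \<times> {0..<T}) (\<lambda>((x1, x2), t). \<rho> x1 x2 t) \<and>
     (\<forall>t\<in>{0..<T}. set_integrable lborel quadrant (kernel_integrand \<omega> t)) \<and>
     continuous_on (quadrant \<times> {0..<T}) (\<lambda>((x1, x2), t). velocity \<omega> x1 x2 t) \<and>
     (\<forall>x1>0. \<forall>x2\<ge>0. \<forall>t\<in>{0..<T}.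
        partial_t T \<omega> x1 x2 t + velocity \<omega> x1 x2 t * partial_x1 \<omega> x1 x2 t = \<rho> x1 x2 t / x1 \<and>
        partial_t T \<rho> x1 x2 t + velocity \<omega> x1 x2 t * partial_x1 \<rho> x1 x2 t = 0) \<and>
     (\<forall>x1\<ge>0. \<forall>x2\<ge>0. \<omega> x1 x2 0 = \<omega>0 x1 x2 \<and> \<rho> x1 x2 0 = \<rho>0 x1 x2)"

text \<open>
  The solution with maximal time of existence \<open>Tstar\<close>: every smooth solution with the same data
  is a restriction of it. In particular there is no smooth solution on \<open>[0, T)\<close> for \<open>T > Tstar\<close>.
\<close>

definition maximal_smooth_solution ::
    "real \<Rightarrow> (real \<Rightarrow> real \<Rightarrow> real) \<Rightarrow> (real \<Rightarrow> real \<Rightarrow> real) \<Rightarrow>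
     (real \<Rightarrow> real \<Rightarrow> real \<Rightarrow> real) \<Rightarrow> (real \<Rightarrow> real \<Rightarrow> real \<Rightarrow> real) \<Rightarrow> bool" where
  "maximal_smooth_solution Tstar \<omega>0 \<rho>0 \<omega> \<rho> \<longleftrightarrow>
     0 < Tstar \<and> smooth_solution Tstar \<omega>0 \<rho>0 \<omega> \<rho> \<and>
     (\<forall>T \<omega>' \<rho>'. 0 < T \<and> smooth_solution T \<omega>0 \<rho>0 \<omega>' \<rho>' \<longrightarrow>
        T \<le> Tstar \<and>
        (\<forall>x1\<ge>0. \<forall>x2\<ge>0. \<forall>t\<in>{0..<T}. \<omega>' x1 x2 t = \<omega> x1 x2 t \<and> \<rho>' x1 x2 t = \<rho> x1 x2 t))"

text \<open>Since \<open>Tstar\<close> is a real number, the maximal time of existence is finite.\<close>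

definition blows_up_in_finite_time ::
    "(real \<Rightarrow> real \<Rightarrow> real) \<Rightarrow> (real \<Rightarrow> real \<Rightarrow> real) \<Rightarrow> bool" where
  "blows_up_in_finite_time \<omega>0 \<rho>0 \<longleftrightarrow>
     (\<exists>Tstar \<omega> \<rho>. maximal_smooth_solution Tstar \<omega>0 \<rho>0 \<omega> \<rho>)"

end

theory Submission imports Defs begin

text \<open>
  The data are \<open>\<omega>\<^sub>0 = 0\<close> and \<open>\<rho>\<^sub>0 = x\<^sub>1 h(x\<^sub>1) \<chi>(x\<^sub>2) \<ge> 0\<close>, where the bump \<open>h\<close> lives on \<open>[1, width]\<close>, the width is a
  large constant, and \<open>\<chi>(0) = 1\<close>. They make the system collapse to an ordinary differential equation.

  All nonlocality sits in the scalar \<open>c(t) = \<integral>\<integral> y\<^sub>1 y\<^sub>2 \<omega> / |y|\<^sup>4 dy\<close>. Let \<open>m = exp (\<integral> c dt)\<close> be the factor by which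
  the flow on the boundary \<open>x\<^sub>2 = 0\<close> has compressed the \<open>x\<^sub>1\<close> axis, \<open>s = \<integral> m dt\<close> an intrinsic time, and
  \<open>a = m x\<^sub>1\<close>. On \<open>x\<^sub>2 = 0\<close> the velocity is \<open>- c x\<^sub>1\<close>; there \<open>a\<close> is constant along particles, and
  \<open>\<omega>(x\<^sub>1, 0, t) = s h(a)\<close>. Therefore a particle at height \<open>y = x\<^sub>2\<close> obeys \<open>da/ds = y s h(a)\<close>: it follows the
  flow of the one autonomous field \<open>h\<close> for the time \<open>y s\<^sup>2 / 2\<close>, whatever \<open>c\<close> is. So \<open>\<omega>\<close> and \<open>\<rho>\<close> are explicit
  smooth functions of \<open>(a, y, s)\<close>, called \<open>scaled_vorticity\<close> and \<open>scaled_density\<close> below, and \<open>c\<close> becomes a function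
  \<open>strain m s\<close> of two numbers. What remains is \<open>dm/dt = m strain(m, s)\<close>, \<open>ds/dt = m\<close>, that is,
  \<open>dm/ds = strain(m, s)\<close>. The strain is globally Lipschitz in \<open>m\<close>, so this equation has a solution \<open>M\<close> for
  all \<open>s \<ge> 0\<close>, and physical time is \<open>t = \<integral> ds / M(s)\<close>. The solution of the system ends exactly at
  \<open>\<integral>\<^sub>0\<^sup>\<infinity> ds / M(s)\<close>.

  This integral is finite because \<open>M(s) \<ge> s\<^sup>2\<close> for \<open>s \<ge> 1\<close> (\<open>M_ge_square\<close>). Particles in the layer
  \<open>y \<le> a / s\<^sup>2\<close> have moved by at most half of their position, so the vorticity there is still of order \<open>s\<close>. The
  strain integral at position \<open>a\<close> is concentrated on \<open>y \<approx> a / m\<close>, which lies in this layer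
  as long as \<open>m \<ge> s\<^sup>2\<close>; it then contributes at least a constant times \<open>s / a\<close>. Integration over \<open>a\<close> gives
  a multiple of \<open>s log width\<close>, and for a large width this exceeds \<open>2 s\<close>, the derivative of \<open>s\<^sup>2\<close>
  (\<open>strain_lower_bound\<close>). Thus \<open>M\<close> cannot fall below \<open>s\<^sup>2\<close>.

  Maximality needs uniqueness among all smooth solutions (\<open>solution_representation\<close>). An arbitrary smooth
  solution has a continuous \<open>c\<close>, hence its own \<open>m\<close> and \<open>s\<close>. On \<open>x\<^sub>2 = 0\<close> its velocity is linear in \<open>x\<^sub>1\<close>, so
  comparison with the profile along characteristics identifies \<open>\<omega>(x\<^sub>1, 0, t)\<close>; then the velocity is known for
  every \<open>x\<^sub>2\<close>, and the same comparison identifies the whole solution with the profile. Its \<open>m\<close> and \<open>s\<close> then solve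
  the ordinary differential equation above.
\<close>

section \<open>Calculus of functions of class C^k relative to a set\<close>

lemma Ck_on_imp_continuous_on: "Ck_on k S f \<Longrightarrow> continuous_on S f"
  by (cases k) (auto intro: has_derivative_continuous_on)

lemma Ck_on_SucD: "Ck_on (Suc k) S f \<Longrightarrow> Ck_on k S f"
proof (induction k arbitrary: f)
  case 0
  then show ?case by (auto intro: has_derivative_continuous_on)
next
  case (Suc k)
  then show ?case by (subst Ck_on.simps) (metis Ck_on.simps(2))
qed

lemma Ck_on_cong:
  assumes "\<And>x. x \<in> S \<Longrightarrow> f x = g x"
  shows "Ck_on k S f \<longleftrightarrow> Ck_on k S g"
proof (cases k)
  case 0
  then show ?thesis using assms by (auto cong: continuous_on_cong)
next
  case (Suc j)
  have "(f has_derivative D) (at x within S) \<longleftrightarrow> (g has_derivative D) (at x within S)"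
    if "x \<in> S" for x D
    using has_derivative_transform[OF that, of f g D] has_derivative_transform[OF that, of g f D] assms by auto
  then show ?thesis using Suc by auto
qed

named_theorems Ck_intros

lemma Ck_on_const [Ck_intros]: "Ck_on k S (\<lambda>x. c)"
proof (induction k arbitrary: c)
  case (Suc k)
  show ?case using Suc by (auto intro!: exI[of _ "\<lambda>x v. 0"])
qed auto

lemma Ck_on_bounded_linear:
  assumes "bounded_linear L" shows "Ck_on k S L"
proof (cases k)
  case (Suc j)
  have "(L has_derivative L) (at x within S)" for x
    by (rule bounded_linear_imp_has_derivative) fact
  then show ?thesis using Suc by (auto intro!: exI[of _ "\<lambda>x. L"] Ck_on_const)
qed (use assms in \<open>auto intro: linear_continuous_on\<close>)

lemma Ck_on_add [Ck_intros]: "Ck_on k S f \<Longrightarrow> Ck_on k S g \<Longrightarrow> Ck_on k S (\<lambda>x. f x + g x)"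
proof (induction k arbitrary: f g)
  case (Suc k)
  from Suc.prems obtain f' g' where
    "\<forall>x\<in>S. (f has_derivative f' x) (at x within S)" "\<forall>v. Ck_on k S (\<lambda>x. f' x v)"
    "\<forall>x\<in>S. (g has_derivative g' x) (at x within S)" "\<forall>v. Ck_on k S (\<lambda>x. g' x v)"
    by auto
  then show ?case
    by (auto intro!: exI[of _ "\<lambda>x v. f' x v + g' x v"] derivative_intros Suc.IH)
qed (auto intro: continuous_intros)

lemma Ck_on_mult [Ck_intros]: "Ck_on k S f \<Longrightarrow> Ck_on k S g \<Longrightarrow> Ck_on k S (\<lambda>x. f x * g x)"
proof (induction k arbitrary: f g)
  case (Suc k)
  from Suc.prems obtain f' g' where
    d: "\<forall>x\<in>S. (f has_derivative f' x) (at x within S)" "\<forall>v. Ck_on k S (\<lambda>x. f' x v)"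
    "\<forall>x\<in>S. (g has_derivative g' x) (at x within S)" "\<forall>v. Ck_on k S (\<lambda>x. g' x v)"
    by auto
  then show ?case using Suc.prems[THEN Ck_on_SucD]
    by (auto intro!: exI[of _ "\<lambda>x v. f x * g' x v + f' x v * g x"] derivative_intros Suc.IH Ck_on_add)
qed (auto intro: continuous_intros)

lemma Ck_on_minus [Ck_intros]: "Ck_on k S f \<Longrightarrow> Ck_on k S (\<lambda>x. - f x)"
  using Ck_on_mult[OF Ck_on_const[of k S "-1"]] by simp

lemma Ck_on_diff [Ck_intros]: "Ck_on k S f \<Longrightarrow> Ck_on k S g \<Longrightarrow> Ck_on k S (\<lambda>x. f x - g x)"
  using Ck_on_add[OF _ Ck_on_minus] by fastforce

lemma Ck_on_power [Ck_intros]: "Ck_on k S f \<Longrightarrow> Ck_on k S (\<lambda>x. f x ^ n)"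
  by (induction n) (auto intro: Ck_on_const Ck_on_mult)

lemma Ck_on_sum: "(\<And>i. i \<in> I \<Longrightarrow> Ck_on k S (f i)) \<Longrightarrow> Ck_on k S (\<lambda>x. \<Sum>i\<in>I. f i x)"
  by (induction I rule: infinite_finite_induct) (auto intro: Ck_on_const Ck_on_add)

lemma Ck_on_inverse [Ck_intros]:
  "Ck_on k S f \<Longrightarrow> (\<And>x. x \<in> S \<Longrightarrow> f x \<noteq> 0) \<Longrightarrow> Ck_on k S (\<lambda>x. inverse (f x))"
proof (induction k arbitrary: f)
  case (Suc k)
  from Suc.prems obtain f' where
    d: "\<forall>x\<in>S. (f has_derivative f' x) (at x within S)" "\<forall>v. Ck_on k S (\<lambda>x. f' x v)"
    by auto
  then show ?case using Suc.prems(2) Suc.IH[OF Ck_on_SucD[OF Suc.prems(1)] Suc.prems(2)]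
    by (auto intro!: exI[of _ "\<lambda>x v. - (inverse (f x) * f' x v * inverse (f x))"] derivative_intros
        Ck_on_minus Ck_on_mult)
qed (auto intro: continuous_intros)

lemma Ck_on_divide [Ck_intros]:
  "Ck_on k S f \<Longrightarrow> Ck_on k S g \<Longrightarrow> (\<And>x. x \<in> S \<Longrightarrow> g x \<noteq> 0) \<Longrightarrow> Ck_on k S (\<lambda>x. f x / g x)"
  unfolding divide_inverse by (intro Ck_intros)

text \<open>
  The derivative of a composition is expanded over the basis of the intermediate space, so that it becomes a sum
  of products of scalar functions of class \<open>C\<^sup>k\<close>, to which the induction hypothesis and the product rule apply.
\<close>

lemma Ck_on_compose:
  fixes G :: "'a::real_normed_vector \<Rightarrow> 'b::euclidean_space"
  assumes "Ck_on k T f" "\<And>b. b \<in> Basis \<Longrightarrow> Ck_on k S (\<lambda>x. G x \<bullet> b)" "G ` S \<subseteq> T"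
  shows "Ck_on k S (\<lambda>x. f (G x))"
  using assms(1,2)
proof (induction k arbitrary: f)
  case 0
  have "continuous_on S G"
    using 0 by (subst continuous_on_componentwise) auto
  with 0 assms(3) show ?case by (auto intro: continuous_on_compose2)
next
  case (Suc k)
  from Suc.prems(1) obtain f' where f':
    "\<And>x. x \<in> T \<Longrightarrow> (f has_derivative f' x) (at x within T)" "\<And>v. Ck_on k T (\<lambda>x. f' x v)"
    by auto
  have "\<forall>b\<in>Basis. \<exists>G'. (\<forall>x\<in>S. ((\<lambda>x. G x \<bullet> b) has_derivative G' x) (at x within S)) \<and>
          (\<forall>v. Ck_on k S (\<lambda>x. G' x v))"
    using Suc.prems(2) by simp
  then obtain G' where G':
    "\<And>b x. b \<in> Basis \<Longrightarrow> x \<in> S \<Longrightarrow> ((\<lambda>x. G x \<bullet> b) has_derivative G' b x) (at x within S)"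
    "\<And>b v. b \<in> Basis \<Longrightarrow> Ck_on k S (\<lambda>x. G' b x v)"
    by metis
  define D where "D x v = (\<Sum>b\<in>Basis. G' b x v *\<^sub>R b)" for x v
  have D: "(G has_derivative D x) (at x within S)" if "x \<in> S" for x
    using that G' unfolding D_def
    by (subst has_derivative_componentwise_within) (auto simp: inner_sum_left inner_Basis if_distrib
       cong: if_cong)
  have lin: "f' (G x) (D x v) = (\<Sum>b\<in>Basis. G' b x v * f' (G x) b)" if "x \<in> S" for x v
  proof -
    have "bounded_linear (f' (G x))" using f'(1)[of "G x"] that assms(3)
      by (auto intro: has_derivative_bounded_linear)
    then interpret bounded_linear "f' (G x)" .
    show ?thesis unfolding D_def by (simp add: sum scaleR)
  qed
  have "((\<lambda>x. f (G x)) has_derivative (\<lambda>v. f' (G x) (D x v))) (at x within S)" if "x \<in> S" for x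
    by (rule has_derivative_in_compose2[OF f'(1) assms(3) that D[OF that]])
  moreover have "Ck_on k S (\<lambda>x. f' (G x) (D x v))" for v
  proof -
    have "Ck_on k S (\<lambda>x. \<Sum>b\<in>Basis. G' b x v * f' (G x) b)"
      by (intro Ck_on_sum Ck_on_mult G' Suc.IH[OF f'(2)] Ck_on_SucD[OF Suc.prems(2)])
    then show ?thesis using lin by (subst Ck_on_cong) auto
  qed
  ultimately show ?case by (auto intro!: exI[of _ "\<lambda>x v. f' (G x) (D x v)"])
qed

lemma Ck_on_compose_real:
  fixes f :: "real \<Rightarrow> real"
  assumes "Ck_on k T f" "Ck_on k S u" "\<And>x. x \<in> S \<Longrightarrow> u x \<in> T"
  shows "Ck_on k S (\<lambda>x. f (u x))"
  using Ck_on_compose[OF assms(1), of S u] assms(2,3) by auto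

lemma Ck_on_compose_pair:
  fixes f :: "real \<Rightarrow> real \<Rightarrow> real"
  assumes "Ck_on k T (\<lambda>(a, b). f a b)" "Ck_on k S u" "Ck_on k S v" "\<And>x. x \<in> S \<Longrightarrow> (u x, v x) \<in> T"
  shows "Ck_on k S (\<lambda>x. f (u x) (v x))"
proof -
  have "Ck_on k S (\<lambda>x. case (u x, v x) of (a, b) \<Rightarrow> f a b)"
    by (rule Ck_on_compose[OF assms(1)]) (use assms(2-) in \<open>auto simp: Basis_prod_def\<close>)
  then show ?thesis by simp
qed

lemma Ck_on_compose_triple:
  fixes f :: "real \<Rightarrow> real \<Rightarrow> real \<Rightarrow> real"
  assumes "Ck_on k T (\<lambda>((a, b), c). f a b c)" "Ck_on k S u" "Ck_on k S v" "Ck_on k S w"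
    "\<And>x. x \<in> S \<Longrightarrow> ((u x, v x), w x) \<in> T"
  shows "Ck_on k S (\<lambda>x. f (u x) (v x) (w x))"
proof -
  have "Ck_on k S (\<lambda>x. (\<lambda>((a, b), c). f a b c) ((u x, v x), w x))"
    by (rule Ck_on_compose[OF assms(1), of S "\<lambda>x. ((u x, v x), w x)"])
      (use assms(2-) in \<open>auto simp: Basis_prod_def zero_prod_def\<close>)
  then show ?thesis by simp
qed

lemma Ck_on_SucI_real:
  fixes f :: "real \<Rightarrow> real"
  assumes "\<And>x. x \<in> S \<Longrightarrow> (f has_real_derivative f' x) (at x within S)" "Ck_on k S f'"
  shows "Ck_on (Suc k) S f"
  using assms by (auto intro!: exI[of _ "\<lambda>x v. f' x * v"] Ck_intros simp: has_field_derivative_def)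

lemma Ck_on_exp: "Ck_on k S (exp :: real \<Rightarrow> real)"
proof (induction k)
  case (Suc k)
  then show ?case by (intro Ck_on_SucI_real) (auto intro: derivative_eq_intros)
qed (auto intro: continuous_intros)

lemma Ck_on_exp_compose [Ck_intros]: "Ck_on k S f \<Longrightarrow> Ck_on k S (\<lambda>x. exp (f x :: real))"
  by (rule Ck_on_compose_real[OF Ck_on_exp[of _ UNIV]]) auto

lemma Ck_on_fst [Ck_intros]: "Ck_on k S (\<lambda>x. fst x)"
  by (auto intro!: Ck_on_bounded_linear bounded_linear_intros)
lemma Ck_on_snd [Ck_intros]: "Ck_on k S (\<lambda>x. snd x)"
  by (auto intro!: Ck_on_bounded_linear bounded_linear_intros)
lemma Ck_on_fst_fst [Ck_intros]: "Ck_on k S (\<lambda>x. fst (fst x))"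
  by (auto intro!: Ck_on_bounded_linear bounded_linear_intros)
lemma Ck_on_snd_fst [Ck_intros]: "Ck_on k S (\<lambda>x. snd (fst x))"
  by (auto intro!: Ck_on_bounded_linear bounded_linear_intros)
lemma Ck_on_fst_snd [Ck_intros]: "Ck_on k S (\<lambda>x. fst (snd x))"
  by (auto intro!: Ck_on_bounded_linear bounded_linear_intros)
lemma Ck_on_snd_snd [Ck_intros]: "Ck_on k S (\<lambda>x. snd (snd x))"
  by (auto intro!: Ck_on_bounded_linear bounded_linear_intros)
lemma Ck_on_fst_fst_fst [Ck_intros]: "Ck_on k S (\<lambda>x. fst (fst (fst x)))"
  by (auto intro!: Ck_on_bounded_linear bounded_linear_intros)
lemma Ck_on_snd_fst_fst [Ck_intros]: "Ck_on k S (\<lambda>x. snd (fst (fst x)))"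
  by (auto intro!: Ck_on_bounded_linear bounded_linear_intros)

lemma Ck_on_id [Ck_intros]: "Ck_on k S (\<lambda>x. x)"
  by (intro Ck_on_bounded_linear bounded_linear_ident)

text \<open>
  Leibniz's rule may be iterated, because every directional derivative of the integrand is again of class \<open>C\<^sup>k\<close>
  on the same product set.
\<close>

lemma Ck_on_integral:
  fixes F :: "'a::euclidean_space \<times> 'b::euclidean_space \<Rightarrow> real"
  assumes "convex U" "Ck_on k (U \<times> cbox a b) F"
  shows "Ck_on k U (\<lambda>x. integral (cbox a b) (\<lambda>t. F (x, t)))"
  using assms(2)
proof (induction k arbitrary: F)
  case 0
  then show ?case using integral_continuous_on_param[of U a b "\<lambda>x t. F (x, t)"] by simp
next
  case (Suc k)
  then obtain F' where F':
    "\<And>z. z \<in> U \<times> cbox a b \<Longrightarrow> (F has_derivative F' z) (at z within U \<times> cbox a b)"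
    "\<And>v. Ck_on k (U \<times> cbox a b) (\<lambda>z. F' z v)"
    by auto
  have bl: "bounded_linear (\<lambda>v. F' (x, t) (v, 0))" if "x \<in> U" "t \<in> cbox a b" for x t
  proof -
    have "bounded_linear (F' (x, t))" using F'(1)[of "(x, t)"] that by (auto intro: has_derivative_bounded_linear)
    from bounded_linear_compose[OF this bounded_linear_Pair[OF bounded_linear_ident bounded_linear_zero]]
    show ?thesis by simp
  qed
  define fx where "fx x t = Blinfun (\<lambda>v. F' (x, t) (v, 0))" for x t
  have fx: "blinfun_apply (fx x t) v = F' (x, t) (v, 0)" if "x \<in> U" "t \<in> cbox a b" for x t v
    unfolding fx_def by (simp add: bounded_linear_Blinfun_apply[OF bl[OF that]])
  have contF: "continuous_on (U \<times> cbox a b) F" using Suc.prems Ck_on_imp_continuous_on by blast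
  have der: "((\<lambda>x. integral (cbox a b) (\<lambda>t. F (x, t))) has_derivative integral (cbox a b) (fx x))
       (at x within U)" if "x \<in> U" for x
  proof (rule leibniz_rule)
    fix y t assume *: "y \<in> U" "t \<in> cbox a b"
    have "((\<lambda>y. F (y, t)) has_derivative (\<lambda>v. F' (y, t) (v, 0))) (at y within U)"
      by (rule has_derivative_in_compose2[OF F'(1)]) (use * in \<open>auto intro!: derivative_eq_intros\<close>)
    moreover have "blinfun_apply (fx y t) = (\<lambda>v. F' (y, t) (v, 0))"
      using fx[OF *] by (rule ext)
    ultimately show "((\<lambda>y. F (y, t)) has_derivative blinfun_apply (fx y t)) (at y within U)"
      by simp
  next
    fix y assume "y \<in> U"
    then show "(\<lambda>t. F (y, t)) integrable_on cbox a b"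
      by (intro integrable_continuous continuous_on_compose2[OF contF] continuous_intros) auto
  next
    show "continuous_on (U \<times> cbox a b) (\<lambda>(x, t). fx x t)"
    proof (rule continuous_on_blinfun_componentwise)
      fix i :: 'a
      have "continuous_on (U \<times> cbox a b) (\<lambda>z. F' z (i, 0))" using F'(2) Ck_on_imp_continuous_on by blast
      then show "continuous_on (U \<times> cbox a b) (\<lambda>x. blinfun_apply (case x of (x, xa) \<Rightarrow> fx x xa) i)"
        by (rule continuous_on_eq) (auto simp: fx)
    qed
  qed (use that assms in auto)
  have eq: "blinfun_apply (integral (cbox a b) (fx x)) v = integral (cbox a b) (\<lambda>t. F' (x, t) (v, 0))"
    if "x \<in> U" for x v
  proof -
    have "continuous_on (cbox a b) (fx x)"
    proof (rule continuous_on_blinfun_componentwise)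
      fix i :: 'a
      have "continuous_on (U \<times> cbox a b) (\<lambda>z. F' z (i, 0))" using F'(2) Ck_on_imp_continuous_on by blast
      from continuous_on_compose2[OF this, of "cbox a b" "\<lambda>t. (x, t)"]
      have "continuous_on (cbox a b) (\<lambda>t. F' (x, t) (i, 0))"
        using that continuous_on_Pair[OF continuous_on_const[of _ x] continuous_on_id[of "cbox a b"]]
        by (auto simp: image_subset_iff)
      then show "continuous_on (cbox a b) (\<lambda>t. blinfun_apply (fx x t) i)"
        by (rule continuous_on_eq) (auto simp: fx that)
    qed
    then have "fx x integrable_on cbox a b" by (rule integrable_continuous)
    then have "blinfun_apply (integral (cbox a b) (fx x)) v = integral (cbox a b) (\<lambda>t. blinfun_apply (fx x t) v)"
      by (rule blinfun_apply_integral)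
    also have "\<dots> = integral (cbox a b) (\<lambda>t. F' (x, t) (v, 0))"
      by (intro integral_cong) (auto simp: fx that)
    finally show ?thesis .
  qed
  have "Ck_on k U (\<lambda>x. integral (cbox a b) (\<lambda>t. F' (x, t) (v, 0)))" for v
    using Suc.IH[OF F'(2)] by simp
  then have "Ck_on k U (\<lambda>x. blinfun_apply (integral (cbox a b) (fx x)) v)" for v
    by (subst Ck_on_cong[OF eq]) auto
  with der show ?case by (auto intro!: exI[of _ "\<lambda>x. blinfun_apply (integral (cbox a b) (fx x))"])
qed

section \<open>Flat functions and ordinary differential equations\<close>

text \<open>
  The family \<open>exp (- 1 / x) / x\<^sup>n\<close> is closed under differentiation up to linear combinations, which gives the
  smoothness of the standard flat function \<open>flat 0\<close> by a single induction on the order.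
\<close>

definition flat :: "nat \<Rightarrow> real \<Rightarrow> real" where
  "flat n x = (if x \<le> 0 then 0 else exp (- 1 / x) / x ^ n)"

lemma power_div_fact_le_exp:
  fixes u :: real assumes "u \<ge> 0" shows "u ^ k / fact k \<le> exp u"
proof -
  have "(\<lambda>n. u ^ n / fact n) sums exp u" using exp_converges[of u] by (simp add: divide_inverse mult.commute)
  then have "sum (\<lambda>n. u ^ n / fact n) {k} \<le> exp u"
    using sum_le_suminf[of "\<lambda>n. u ^ n / fact n" "{k}"] assms by (auto simp: sums_iff)
  then show ?thesis by simp
qed

lemma abs_flat_le_square: "\<bar>flat n x\<bar> \<le> fact (n + 2) * x\<^sup>2"
proof (cases "x \<le> 0")
  case False
  then have x: "x > 0" by simp
  define c :: real where "c = fact (n + 2)"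
  have "(1 / x) ^ (n + 2) / c \<le> exp (1 / x)" unfolding c_def using x by (intro power_div_fact_le_exp) auto
  moreover have "c > 0" by (simp add: c_def)
  ultimately have "(1 / x) ^ (n + 2) \<le> c * exp (1 / x)"
    using pos_divide_le_eq[of c "(1 / x) ^ (n + 2)"] by (metis mult.commute)
  then have "exp (- (1 / x)) * (1 / x) ^ (n + 2) \<le> exp (- (1 / x)) * (c * exp (1 / x))"
    by (rule mult_left_mono) auto
  also have "\<dots> = c" by (simp add: exp_minus)
  finally have "exp (- (1 / x)) * (1 / x) ^ (n + 2) * x\<^sup>2 \<le> c * x\<^sup>2"
    by (rule mult_right_mono) auto
  moreover have "\<bar>flat n x\<bar> = exp (- (1 / x)) * (1 / x) ^ (n + 2) * x\<^sup>2"
    using x by (simp add: flat_def power_divide power_add power2_eq_square)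
  ultimately show ?thesis by (simp add: c_def)
qed (simp add: flat_def)

lemma has_real_derivative_flat:
  "(flat n has_real_derivative (flat (n + 2) x - n * flat (n + 1) x)) (at x)"
proof -
  consider "x < 0" | "x > 0" | "x = 0" by linarith
  then show ?thesis
  proof cases
    case 1
    have "((\<lambda>_. 0) has_real_derivative 0) (at x)" by simp
    then have "(flat n has_real_derivative 0) (at x)"
      by (rule has_field_derivative_transform_within_open[of _ _ _ "{..<0}"]) (use 1 in \<open>auto simp: flat_def\<close>)
    then show ?thesis using 1 by (simp add: flat_def)
  next
    case 2
    have "((\<lambda>x. exp (- 1 / x) * inverse (x ^ n)) has_real_derivative
         (flat (n + 2) x - n * flat (n + 1) x)) (at x)"
      using 2 by (auto intro!: derivative_eq_intros simp: flat_def divide_simps power_add power2_eq_square)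
        (cases n; simp add: algebra_simps)
    then show ?thesis
      by (rule has_field_derivative_transform_within_open[of _ _ _ "{0<..}"])
        (use 2 in \<open>auto simp: flat_def divide_inverse\<close>)
  next
    case 3
    have "((\<lambda>h. flat n h / h) \<longlongrightarrow> 0) (at 0)"
    proof (rule Lim_null_comparison)
      show "\<forall>\<^sub>F h in at 0. norm (flat n h / h) \<le> fact (n + 2) * \<bar>h\<bar>"
      proof (rule eventually_mono[OF eventually_neq_at_within])
        fix h :: real assume "h \<noteq> 0"
        have "\<bar>flat n h\<bar> \<le> fact (n + 2) * \<bar>h\<bar> * \<bar>h\<bar>"
          using abs_flat_le_square[of n h] by (simp only: power2_eq_square mult.assoc abs_mult_self_eq)
        then show "norm (flat n h / h) \<le> fact (n + 2) * \<bar>h\<bar>"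
          unfolding real_norm_def abs_divide using \<open>h \<noteq> 0\<close> by (intro mult_imp_div_pos_le) simp_all
      qed
      have "((\<lambda>h. fact (n + 2) * \<bar>h\<bar>) \<longlongrightarrow> fact (n + 2) * \<bar>0::real\<bar>) (at 0)"
        by (intro tendsto_intros)
      then show "((\<lambda>h. fact (n + 2) * \<bar>h::real\<bar>) \<longlongrightarrow> 0) (at 0)" by simp
    qed
    then show ?thesis using 3 by (simp add: DERIV_def flat_def)
  qed
qed

lemma Ck_on_flat: "Ck_on k S (flat n)"
proof (induction k arbitrary: n)
  case 0
  have "continuous_on UNIV (flat n)"
    by (rule DERIV_continuous_on) (rule has_field_derivative_at_within[OF has_real_derivative_flat])
  then show ?case using continuous_on_subset by auto
next
  case (Suc k)
  show ?case
    by (rule Ck_on_SucI_real[OF has_field_derivative_at_within[OF has_real_derivative_flat]])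
      (intro Ck_intros Suc)
qed

lemma Ck_on_flat_compose [Ck_intros]: "Ck_on k S f \<Longrightarrow> Ck_on k S (\<lambda>x. flat n (f x))"
  by (rule Ck_on_compose_real[OF Ck_on_flat[of _ UNIV]]) auto

lemma integral_has_real_derivative_halfopen:
  fixes f :: "real \<Rightarrow> real"
  assumes "continuous_on I f" "t \<in> I" "b > t" "{0..b} \<subseteq> I" "I \<subseteq> {0..}"
  shows "((\<lambda>t. integral {0..t} f) has_real_derivative f t) (at t within I)"
proof -
  have "((\<lambda>t. integral {0..t} f) has_real_derivative f t) (at t within {0..b})"
    by (rule integral_has_real_derivative) (use assms in \<open>auto intro: continuous_on_subset\<close>)
  moreover have "at t within I = at t within {0..b}"
    by (rule at_within_nhd[of _ "{..<b}"]) (use assms in auto)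
  ultimately show ?thesis by simp
qed

lemma integral_has_real_derivative_atLeast:
  assumes "continuous_on {0..} f" "t \<ge> 0"
  shows "((\<lambda>t. integral {0..t} f) has_real_derivative f t) (at t within {0..})"
  by (rule integral_has_real_derivative_halfopen[where b="t + 1"]) (use assms in auto)

lemma integral_has_real_derivative_lessThan:
  assumes "continuous_on {0..<T} f" "t \<in> {0..<T}"
  shows "((\<lambda>t. integral {0..t} f) has_real_derivative f t) (at t within {0..<T})"
  by (rule integral_has_real_derivative_halfopen[where b="(t + T) / 2"]) (use assms in auto)

text \<open>
  The quantity \<open>d\<^sup>2 exp (- 2 k t)\<close> is nonincreasing and starts at zero.
\<close>

lemma gronwall_zero:
  fixes d :: "real \<Rightarrow> real"
  assumes der: "\<And>t. t \<in> {0..b} \<Longrightarrow> (d has_real_derivative d' t) (at t within {0..b})"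
    and bound: "\<And>t. t \<in> {0..b} \<Longrightarrow> \<bar>d' t\<bar> \<le> k * \<bar>d t\<bar>"
    and "d 0 = 0" "t \<in> {0..b}"
  shows "d t = 0"
proof -
  define q where "q t = (d t)\<^sup>2 * exp (- 2 * k * t)" for t
  have cont: "continuous_on {0..b} d" using der by (rule DERIV_continuous_on)
  have "q t \<le> q 0"
  proof (rule DERIV_nonpos_imp_decreasing_open[of 0 t])
    show "0 \<le> t" using \<open>t \<in> _\<close> by simp
  next
    show "continuous_on {0..t} q" unfolding q_def
      by (intro continuous_intros continuous_on_subset[OF cont]) (use \<open>t \<in> _\<close> in auto)
  next
    fix x assume x: "0 < x" "x < t"
    then have xb: "x \<in> {0..b}" using \<open>t \<in> _\<close> by auto
    have at: "at x within {0..b} = at x" using x \<open>t \<in> _\<close> by (intro at_within_Icc_at) auto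
    have "(q has_real_derivative ((2 * d x * d' x - 2 * k * (d x)\<^sup>2) * exp (- 2 * k * x))) (at x)"
      unfolding q_def using der[OF xb] unfolding at
      by (auto intro!: derivative_eq_intros simp: algebra_simps)
    moreover have "2 * d x * d' x \<le> 2 * (\<bar>d x\<bar> * \<bar>d' x\<bar>)"
      by (metis abs_ge_self abs_mult mult.assoc mult_left_mono zero_le_numeral)
    moreover have "\<bar>d x\<bar> * \<bar>d' x\<bar> \<le> k * (d x)\<^sup>2"
      using mult_left_mono[OF bound[OF xb], of "\<bar>d x\<bar>"]
      by (simp add: power2_eq_square mult_ac)
    ultimately show "\<exists>y. (q has_real_derivative y) (at x) \<and> y \<le> 0"
      by (intro exI[of _ "(2 * d x * d' x - 2 * k * (d x)\<^sup>2) * exp (- 2 * k * x)"]) (simp add: mult_nonpos_nonneg)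
  qed
  then have "(d t)\<^sup>2 * exp (- 2 * k * t) \<le> 0" using \<open>d 0 = 0\<close> by (simp add: q_def)
  then show ?thesis by (simp add: mult_le_0_iff)
qed

lemma zero_derivative_imp_eq:
  fixes d :: "real \<Rightarrow> real"
  assumes "\<And>t. t \<in> {0..b} \<Longrightarrow> (d has_real_derivative 0) (at t within {0..b})" "t \<in> {0..b}"
  shows "d t = d 0"
  using gronwall_zero[of b "\<lambda>t. d t - d 0" "\<lambda>_. 0" 0 t] assms
  by (force intro!: derivative_eq_intros)

text \<open>
  With the weight \<open>w = \<integral> (2 k + |f(t, 0)|) dt\<close> and \<open>x = exp(w) z\<close>, the Picard operator acts on bounded continuous
  functions \<open>z\<close> on the whole half-line and contracts by \<open>1/2\<close>. So one application of Banach's theorem yields a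
  global solution, and no local solutions have to be glued. The term \<open>|f(t, 0)|\<close> of the weight keeps the image
  bounded.
\<close>

lemma picard_lindelof_global:
  fixes f :: "real \<Rightarrow> real \<Rightarrow> real"
  assumes contf: "continuous_on ({0..} \<times> UNIV) (\<lambda>(t, x). f t x)"
    and contk: "continuous_on {0..} k" and k: "\<And>t. t \<ge> 0 \<Longrightarrow> k t \<ge> 0"
    and lip: "\<And>t x y. t \<ge> 0 \<Longrightarrow> \<bar>f t x - f t y\<bar> \<le> k t * \<bar>x - y\<bar>"
  obtains X where "X 0 = x0" "\<And>t. t \<ge> 0 \<Longrightarrow> (X has_real_derivative f t (X t)) (at t within {0..})"
proof -
  have contfu: "continuous_on {0..} (\<lambda>t. f t (u t))" if "continuous_on {0..} u" for u
    using continuous_on_compose2[OF contf continuous_on_Pair[OF continuous_on_id that]] by auto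
  define w' where "w' t = 2 * k t + \<bar>f t 0\<bar>" for t
  define w where "w t = integral {0..t} w'" for t
  have contw': "continuous_on {0..} w'" unfolding w'_def by (intro continuous_intros contk contfu)
  have w'_ge: "w' t \<ge> 0" if "t \<ge> 0" for t using k[OF that] by (auto simp: w'_def)
  have w_der: "(w has_real_derivative w' t) (at t within {0..})" if "t \<ge> 0" for t
    unfolding w_def using integral_has_real_derivative_atLeast[OF contw' that] .
  have contw: "continuous_on {0..} w" by (rule DERIV_continuous_on[OF w_der]) auto
  have w0: "w 0 = 0" by (simp add: w_def)
  have w_ge: "w t \<ge> 0" for t
    unfolding w_def by (rule Henstock_Kurzweil_Integration.integral_nonneg)
      (auto intro!: integrable_continuous_interval continuous_on_subset[OF contw'] w'_ge)
  have int_w: "((\<lambda>s. w' s * exp (w s)) has_integral (exp (w t) - 1)) {0..t}" if "t \<ge> 0" for t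
  proof -
    have "((\<lambda>s. w' s * exp (w s)) has_integral (exp (w t) - exp (w 0))) {0..t}"
      using that
      by (intro fundamental_theorem_of_calculus)
        (auto intro!: derivative_eq_intros DERIV_subset[OF w_der]
          simp: has_real_derivative_iff_has_vector_derivative[symmetric])
    then show ?thesis by (simp add: w0)
  qed
  define g where "g z s = f s (exp (w s) * apply_bcontfun z s)" for z s
  have contg: "continuous_on {0..} (g z)" for z
    unfolding g_def by (intro contfu continuous_intros contw continuous_on_apply_bcontfun)
  have int_g: "g z integrable_on {0..t}" for z t
    by (rule integrable_continuous_interval) (rule continuous_on_subset[OF contg], auto)
  define P where "P z t = exp (- w (max 0 t)) * (x0 + integral {0..max 0 t} (g z))" for z t
  have int_der: "((\<lambda>t. integral {0..t} (g z)) has_real_derivative g z t) (at t within {0..})" if "t \<ge> 0" for z t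
    by (rule integral_has_real_derivative_atLeast[OF contg that])
  have contI: "continuous_on {0..} (\<lambda>t. integral {0..t} (g z))" for z
    by (rule DERIV_continuous_on[OF int_der]) auto
  have contP: "continuous_on UNIV (P z)" for z
    unfolding P_def by (intro continuous_intros continuous_on_compose2[OF contw] continuous_on_compose2[OF contI]) auto
  have Pbound: "\<exists>B. \<forall>t. norm (P z t) \<le> B" for z
  proof -
    have "bounded (range (apply_bcontfun z))" by (rule bounded_apply_bcontfun)
    then obtain B where B: "\<And>t. \<bar>apply_bcontfun z t\<bar> \<le> B" by (auto simp: bounded_iff)
    have B0: "B \<ge> 0" using B[of 0] by linarith
    have gb: "\<bar>g z s\<bar> \<le> (1 + B) * (w' s * exp (w s))" if "s \<ge> 0" for s
    proof -
      have "\<bar>g z s\<bar> \<le> \<bar>f s 0\<bar> + k s * (exp (w s) * B)"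
      proof -
        have "\<bar>g z s - f s 0\<bar> \<le> k s * \<bar>exp (w s) * apply_bcontfun z s\<bar>"
          unfolding g_def using lip[OF that, of _ 0] by simp
        also have "\<dots> \<le> k s * (exp (w s) * B)"
          by (intro mult_left_mono k that) (simp add: abs_mult B)
        finally show ?thesis by linarith
      qed
      also have "\<dots> \<le> w' s * exp (w s) + B * (w' s * exp (w s))"
      proof (rule add_mono)
        have "\<bar>f s 0\<bar> \<le> w' s" using k[OF that] by (simp add: w'_def)
        also have "w' s * 1 \<le> w' s * exp (w s)" using w_ge w'_ge[OF that] by (intro mult_left_mono) auto
        finally show "\<bar>f s 0\<bar> \<le> w' s * exp (w s)" by simp
        have "k s \<le> w' s" using k[OF that] by (simp add: w'_def)
        then have "k s * (exp (w s) * B) \<le> w' s * (exp (w s) * B)" using B0 by (intro mult_right_mono) auto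
        then show "k s * (exp (w s) * B) \<le> B * (w' s * exp (w s))" by (simp add: mult_ac)
      qed
      finally show ?thesis by (simp add: algebra_simps)
    qed
    have "norm (P z t) \<le> \<bar>x0\<bar> + (1 + B)" for t
    proof -
      define u where "u = max 0 t"
      have u: "u \<ge> 0" by (simp add: u_def)
      have "norm (integral {0..u} (g z)) \<le> integral {0..u} (\<lambda>s. (1 + B) * (w' s * exp (w s)))"
        by (rule integral_norm_bound_integral[OF int_g])
          (use has_integral_mult_right[OF int_w[OF u]] gb in \<open>auto intro: has_integral_integrable\<close>)
      also have "\<dots> = (1 + B) * (exp (w u) - 1)"
        using has_integral_mult_right[OF int_w[OF u]] by (rule integral_unique)
      also have "\<dots> \<le> (1 + B) * exp (w u)" using B0 by (intro mult_left_mono) auto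
      finally have "\<bar>x0 + integral {0..u} (g z)\<bar> \<le> \<bar>x0\<bar> * exp (w u) + (1 + B) * exp (w u)"
        using mult_left_mono[of 1 "exp (w u)" "\<bar>x0\<bar>"] w_ge[of u] by (simp)
      then have "exp (- w u) * \<bar>x0 + integral {0..u} (g z)\<bar> \<le> exp (- w u) * (\<bar>x0\<bar> * exp (w u) + (1 + B) * exp (w u))"
        by (intro mult_left_mono) auto
      also have "\<dots> = \<bar>x0\<bar> + (1 + B)" by (simp add: exp_minus field_simps)
      finally show ?thesis by (simp add: P_def abs_mult u_def)
    qed
    then show ?thesis by blast
  qed
  have Pin: "P z \<in> bcontfun" for z using Pbound[of z] bcontfun_normI[OF contP[of z]] by blast
  have "\<exists>!z. z \<in> UNIV \<and> Bcontfun (P z) = z"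
  proof (rule Banach_fix[where c="1/2"])
    fix z1 z2 :: "real \<Rightarrow>\<^sub>C real"
    show "dist (Bcontfun (P z1)) (Bcontfun (P z2)) \<le> 1 / 2 * dist z1 z2"
    proof (rule dist_bound)
      fix t :: real
      define u where "u = max 0 t"
      have u: "u \<ge> 0" by (simp add: u_def)
      have gd: "norm (g z1 s - g z2 s) \<le> (dist z1 z2 / 2) * (w' s * exp (w s))" if "s \<ge> 0" for s
      proof -
        have "norm (g z1 s - g z2 s) \<le> k s * \<bar>exp (w s) * apply_bcontfun z1 s - exp (w s) * apply_bcontfun z2 s\<bar>"
          unfolding g_def using lip[OF that] by simp
        also have "\<dots> = k s * (exp (w s) * \<bar>apply_bcontfun z1 s - apply_bcontfun z2 s\<bar>)"
          by (simp add: right_diff_distrib[symmetric] abs_mult)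
        also have "\<dots> \<le> k s * (exp (w s) * dist z1 z2)"
          using dist_bounded[of z1 s z2] by (intro mult_left_mono k that) (auto simp: dist_real_def)
        also have "\<dots> \<le> (w' s / 2) * (exp (w s) * dist z1 z2)"
          by (intro mult_right_mono) (auto simp: w'_def)
        finally show ?thesis by (simp add: mult_ac)
      qed
      have "norm (integral {0..u} (\<lambda>s. g z1 s - g z2 s)) \<le> integral {0..u} (\<lambda>s. (dist z1 z2 / 2) * (w' s * exp (w s)))"
        by (rule integral_norm_bound_integral[OF integrable_diff[OF int_g int_g]])
          (use has_integral_mult_right[OF int_w[OF u]] gd in \<open>auto intro: has_integral_integrable\<close>)
      also have "\<dots> = (dist z1 z2 / 2) * (exp (w u) - 1)"
        using has_integral_mult_right[OF int_w[OF u]] by (rule integral_unique)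
      also have "\<dots> \<le> (dist z1 z2 / 2) * exp (w u)" by (intro mult_left_mono) auto
      finally have *: "\<bar>integral {0..u} (g z1) - integral {0..u} (g z2)\<bar> \<le> (dist z1 z2 / 2) * exp (w u)"
        by (simp add: Henstock_Kurzweil_Integration.integral_diff int_g)
      have "dist (P z1 t) (P z2 t) = exp (- w u) * \<bar>integral {0..u} (g z1) - integral {0..u} (g z2)\<bar>"
        unfolding P_def u_def[symmetric] dist_real_def by (simp add: right_diff_distrib[symmetric] abs_mult)
      also have "\<dots> \<le> exp (- w u) * ((dist z1 z2 / 2) * exp (w u))"
        by (intro mult_left_mono *) auto
      also have "\<dots> = 1 / 2 * dist z1 z2" by (simp add: exp_minus field_simps)
      finally show "dist (apply_bcontfun (Bcontfun (P z1)) t) (apply_bcontfun (Bcontfun (P z2)) t) \<le> 1 / 2 * dist z1 z2"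
        by (simp add: Bcontfun_inverse Pin)
    qed
  qed (auto simp: complete_UNIV)
  then obtain z where z: "Bcontfun (P z) = z" by auto
  have zP: "apply_bcontfun z t = P z t" for t using z Bcontfun_inverse[OF Pin, of z] by metis
  define X where "X t = x0 + integral {0..t} (g z)" for t
  have gX: "g z t = f t (X t)" if "t \<ge> 0" for t
    unfolding g_def zP using that by (simp add: P_def X_def exp_minus mult.assoc[symmetric])
  have "(X has_real_derivative f t (X t)) (at t within {0..})" if "t \<ge> 0" for t
    unfolding gX[OF that, symmetric] unfolding X_def
    using int_der[OF that, of z] by (auto intro!: derivative_eq_intros)
  moreover have "X 0 = x0" by (simp add: X_def)
  ultimately show ?thesis using that by blast
qed

section \<open>Smooth dependence of one-dimensional flows on the initial value\<close>

text \<open>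
  Continuity of the partial derivatives gives total differentiability, also at the boundary of the half-line in
  which the second variable, a flow time, lives.
\<close>

lemma Ck_on_SucI_partials:
  fixes f :: "real \<Rightarrow> real \<Rightarrow> real"
  assumes fa: "\<And>a s. s \<ge> 0 \<Longrightarrow> ((\<lambda>a. f a s) has_real_derivative p a s) (at a)"
    and fs: "\<And>a s. s \<ge> 0 \<Longrightarrow> (f a has_real_derivative q a s) (at s within {0..})"
    and p: "Ck_on k (UNIV \<times> {0..}) (\<lambda>(a, s). p a s)"
    and q: "Ck_on k (UNIV \<times> {0..}) (\<lambda>(a, s). q a s)"
  shows "Ck_on (Suc k) (UNIV \<times> {0..}) (\<lambda>(a, s). f a s)"
proof -
  define D where "D z v = (case z of (a, s) \<Rightarrow> case v of (u, w) \<Rightarrow> p a s * u + q a s * w)" for z v :: "real \<times> real"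
  have "((\<lambda>(a, s). f a s) has_derivative D z) (at z within UNIV \<times> {0..})" if "z \<in> UNIV \<times> {0..}" for z
  proof -
    obtain a s where z: "z = (a, s)" by force
    have "continuous_on (UNIV \<times> {0..}) (\<lambda>z. blinfun_mult_right (case z of (a, s) \<Rightarrow> q a s))"
      using Ck_on_imp_continuous_on[OF q]
      by (intro bounded_linear.continuous_on[OF bounded_linear_blinfun_mult_right])
    then have "continuous (at (a, s) within UNIV \<times> {0..}) (\<lambda>(a, s). blinfun_mult_right (q a s))"
      using that by (auto simp: continuous_on_eq_continuous_within z case_prod_unfold)
    from has_derivative_partialsI[OF _ _ this, of f "\<lambda>u. p a s * u"]
    have "((\<lambda>(a, s). f a s) has_derivative (\<lambda>(tx, ty). p a s * tx + q a s * ty)) (at (a, s) within UNIV \<times> {0..})"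
      using that fa[of s a] fs by (auto simp: z has_field_derivative_def)
    moreover have "D (a, s) = (\<lambda>(tx, ty). p a s * tx + q a s * ty)" by (auto simp: D_def fun_eq_iff)
    ultimately show ?thesis by (simp add: z)
  qed
  moreover have "Ck_on k (UNIV \<times> {0..}) (\<lambda>z. D z v)" for v
  proof -
    have "Ck_on k (UNIV \<times> {0..}) (\<lambda>z. (\<lambda>(a, s). p a s) z * fst v + (\<lambda>(a, s). q a s) z * snd v)"
      by (intro Ck_intros p q)
    then show ?thesis by (simp add: D_def case_prod_unfold)
  qed
  ultimately show ?thesis by (auto intro!: exI[of _ D])
qed

lemma DERIV_chain_within:
  fixes f g :: "real \<Rightarrow> real"
  assumes "(f has_real_derivative d) (at (g x) within T)" "(g has_real_derivative e) (at x within S)" "g ` S \<subseteq> T"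
  shows "((\<lambda>x. f (g x)) has_real_derivative d * e) (at x within S)"
  using DERIV_image_chain[OF DERIV_subset[OF assms(1,3)] assms(2)] by (simp add: o_def)

lemma integral_unit_interval_scale:
  fixes h :: "real \<Rightarrow> real"
  assumes h: "continuous_on {0..s} h" and "s \<ge> 0"
  shows "integral {0..s} h = s * integral {0..1} (\<lambda>r. h (s * r))"
proof -
  have "((\<lambda>r. s * h (s * r)) has_integral (integral {0..s * 1} h - integral {0..s * 0} h)) {0..1}"
  proof (rule fundamental_theorem_of_calculus)
    fix r :: real assume r: "r \<in> {0..1}"
    have "((\<lambda>r. integral {0..s * r} h) has_real_derivative h (s * r) * s) (at r within {0..1})"
      by (rule DERIV_chain_within[OF integral_has_real_derivative[OF h]])
        (use r assms in \<open>auto intro!: derivative_eq_intros simp: mult_left_le\<close>)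
    then show "((\<lambda>r. integral {0..s * r} h) has_vector_derivative s * h (s * r)) (at r within {0..1})"
      by (simp add: has_real_derivative_iff_has_vector_derivative mult.commute)
  qed auto
  from integral_unique[OF this] show ?thesis by simp
qed

text \<open>
  In one dimension the difference of two solutions is \<open>(a - b) exp (- \<integral> Q)\<close>, where \<open>Q\<close> is the mean of \<open>H'\<close>
  between the two solutions. This gives continuity in the initial value, and the limit \<open>b \<rightarrow> a\<close> gives the derivative
  \<open>J = exp (- \<integral> H'(\<beta>))\<close>. Since both partial derivatives are smooth expressions in \<open>\<beta>\<close> itself, smoothness follows
  by bootstrapping. The identity \<open>H(\<beta>) = H(a) J\<close> turns the equation of the flow into the transport equation
  \<open>\<partial>\<^sub>s \<beta> + H \<partial>\<^sub>a \<beta> = 0\<close>.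

  The flow runs backwards since a solution of a transport equation at a point is read off from the foot of the
  characteristic through that point.
\<close>

theorem smooth_backward_flow:
  fixes H H' :: "real \<Rightarrow> real"
  assumes H': "\<And>x. (H has_real_derivative H' x) (at x)"
    and CkH: "\<And>k. Ck_on k UNIV H" and CkH': "\<And>k. Ck_on k UNIV H'"
    and K: "\<And>x. \<bar>H' x\<bar> \<le> K"
  obtains \<beta> J where
    "\<And>a. \<beta> a 0 = a"
    "\<And>a s. s \<ge> 0 \<Longrightarrow> (\<beta> a has_real_derivative - H (\<beta> a s)) (at s within {0..})"
    "\<And>a s. s \<ge> 0 \<Longrightarrow> ((\<lambda>a. \<beta> a s) has_real_derivative J a s) (at a)"
    "\<And>a s. J a s > 0"
    "\<And>a s. s \<ge> 0 \<Longrightarrow> H (\<beta> a s) = H a * J a s"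
    "\<And>k. Ck_on k (UNIV \<times> {0..}) (\<lambda>(a, s). \<beta> a s)"
proof -
  have K0: "K \<ge> 0" using K[of 0] by linarith
  have contH: "continuous_on S H" and contH': "continuous_on S H'" for S
    using CkH[of 0] CkH'[of 0] by (auto intro: continuous_on_subset)
  have lip: "\<bar>H x - H y\<bar> \<le> K * \<bar>x - y\<bar>" for x y
    using field_differentiable_bound[of UNIV H H' K x y] H' K by auto
  have "\<exists>X. X 0 = a \<and> (\<forall>t\<ge>0. (X has_real_derivative - H (X t)) (at t within {0..}))" for a
  proof -
    have "continuous_on ({0..} \<times> UNIV) (\<lambda>(t::real, x). - H x)"
      unfolding case_prod_unfold by (intro continuous_intros continuous_on_compose2[OF contH]) auto
    from picard_lindelof_global[OF this, of "\<lambda>_. K" a] K0 lip show ?thesis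
      by (auto simp: abs_minus_commute)
  qed
  then obtain \<beta> where \<beta>0: "\<And>a. \<beta> a 0 = a"
    and \<beta>_der: "\<And>a s. s \<ge> 0 \<Longrightarrow> (\<beta> a has_real_derivative - H (\<beta> a s)) (at s within {0..})"
    by metis
  have cont\<beta>1: "continuous_on {0..} (\<beta> a)" for a
    by (rule DERIV_continuous_on[OF \<beta>_der]) auto
  \<comment> \<open>the mean of \<open>H'\<close> between \<open>y\<close> and \<open>x\<close>, continuous also on the diagonal\<close>
  define Q where "Q x y = integral (cbox 0 1) (\<lambda>\<theta>. H' (y + \<theta> * (x - y)))" for x y
  have Q: "H x - H y = Q x y * (x - y)" for x y
  proof -
    have "((\<lambda>\<theta>. H' (y + \<theta> * (x - y)) * (x - y)) has_integral (H (y + 1 * (x - y)) - H (y + 0 * (x - y)))) {0..1}"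
    proof (rule fundamental_theorem_of_calculus)
      fix \<theta> :: real
      have "((\<lambda>\<theta>. H (y + \<theta> * (x - y))) has_real_derivative H' (y + \<theta> * (x - y)) * (x - y)) (at \<theta>)"
        by (rule DERIV_chain2[OF H']) (auto intro!: derivative_eq_intros)
      then show "((\<lambda>\<theta>. H (y + \<theta> * (x - y))) has_vector_derivative H' (y + \<theta> * (x - y)) * (x - y)) (at \<theta> within {0..1})"
        by (auto simp: has_real_derivative_iff_has_vector_derivative intro: has_vector_derivative_at_within)
    qed auto
    from integral_unique[OF this] show ?thesis by (simp add: Q_def)
  qed
  have Qdiag: "Q x x = H' x" for x by (simp add: Q_def)
  have contQ: "continuous_on UNIV (\<lambda>(x, y). Q x y)"
  proof -
    have "continuous_on (UNIV \<times> cbox 0 1) (\<lambda>(z, \<theta>). H' (snd z + \<theta> * (fst z - snd z)))"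
      unfolding case_prod_unfold by (intro continuous_on_compose2[OF contH'[of UNIV]] continuous_intros) auto
    from integral_continuous_on_param[OF this] show ?thesis by (simp add: Q_def case_prod_unfold)
  qed
  have contQ2: "continuous_on S (\<lambda>z. Q (u z) (v z))" if "continuous_on S u" "continuous_on S v"
    for S and u v :: "'x::topological_space \<Rightarrow> real"
    using continuous_on_compose2[OF contQ continuous_on_Pair[OF that]] by simp
  have Qbound: "\<bar>Q x y\<bar> \<le> K" for x y
  proof -
    have "norm (integral (cbox 0 1) (\<lambda>\<theta>. H' (y + \<theta> * (x - y)))) \<le> integral (cbox 0 (1::real)) (\<lambda>_. K)"
      by (intro integral_norm_bound_integral integrable_continuous continuous_on_compose2[OF contH'[of UNIV]] continuous_intros)
        (auto simp: K)
    then show ?thesis by (simp add: Q_def)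
  qed
  have diff: "\<beta> a s - \<beta> b s = exp (- integral {0..s} (\<lambda>r. Q (\<beta> a r) (\<beta> b r))) * (a - b)" if "s \<ge> 0" for a b s
  proof -
    define V where "V s = integral {0..s} (\<lambda>r. Q (\<beta> a r) (\<beta> b r))" for s
    have V: "(V has_real_derivative Q (\<beta> a s) (\<beta> b s)) (at s within {0..})" if "s \<ge> 0" for s
      unfolding V_def using integral_has_real_derivative_atLeast[OF contQ2[OF cont\<beta>1 cont\<beta>1] that] .
    have "(\<beta> a s - \<beta> b s) * exp (V s) = (\<beta> a 0 - \<beta> b 0) * exp (V 0)"
    proof (rule zero_derivative_imp_eq)
      fix t assume t: "t \<in> {0..s}"
      have "((\<lambda>s. (\<beta> a s - \<beta> b s) * exp (V s)) has_real_derivative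
         (- H (\<beta> a t) + H (\<beta> b t)) * exp (V t) + (\<beta> a t - \<beta> b t) * (exp (V t) * Q (\<beta> a t) (\<beta> b t))) (at t within {0..s})"
        using t by (auto intro!: derivative_eq_intros DERIV_subset[OF V] DERIV_subset[OF \<beta>_der])
      moreover have "(- H (\<beta> a t) + H (\<beta> b t)) * exp (V t) + (\<beta> a t - \<beta> b t) * (exp (V t) * Q (\<beta> a t) (\<beta> b t)) = 0"
        using Q[of "\<beta> a t" "\<beta> b t"] by algebra
      ultimately show "((\<lambda>s. (\<beta> a s - \<beta> b s) * exp (V s)) has_real_derivative 0) (at t within {0..s})" by simp
    qed (use that in auto)
    then show ?thesis unfolding V_def by (simp add: \<beta>0 exp_minus field_simps)
  qed
  have cont\<beta>: "continuous_on (UNIV \<times> {0..}) (\<lambda>(a, s). \<beta> a s)"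
    unfolding continuous_on_def
  proof
    fix z0 :: "real \<times> real" assume z0: "z0 \<in> UNIV \<times> {0..}"
    define a0 s0 where "a0 = fst z0" "s0 = snd z0"
    define g where "g z = exp (K * snd z) * \<bar>fst z - a0\<bar> + \<bar>\<beta> a0 (snd z) - \<beta> a0 s0\<bar>" for z :: "real \<times> real"
    have "continuous_on (UNIV \<times> {0..}) g" unfolding g_def
      by (intro continuous_intros continuous_on_compose2[OF cont\<beta>1]) auto
    then have "(g \<longlongrightarrow> g z0) (at z0 within UNIV \<times> {0..})" using z0 by (auto simp: continuous_on_def)
    moreover have "g z0 = 0" by (simp add: g_def a0_s0_def)
    ultimately have g0: "(g \<longlongrightarrow> 0) (at z0 within UNIV \<times> {0..})" by simp
    have "\<forall>\<^sub>F z in at z0 within UNIV \<times> {0..}. norm ((\<lambda>(a, s). \<beta> a s) z - (\<lambda>(a, s). \<beta> a s) z0) \<le> g z"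
      unfolding eventually_at_filter
    proof (rule always_eventually, intro allI impI)
      fix z :: "real \<times> real" assume "z \<in> UNIV \<times> {0..}"
      then obtain a s where z: "z = (a, s)" "s \<ge> 0" by (cases z) auto
      have "\<bar>integral {0..s} (\<lambda>r. Q (\<beta> a r) (\<beta> a0 r))\<bar> \<le> integral {0..s} (\<lambda>r. K)"
        unfolding real_norm_def[symmetric]
        by (intro integral_norm_bound_integral integrable_continuous_interval contQ2 continuous_on_subset[OF cont\<beta>1])
          (auto simp: Qbound)
      then have "exp (- integral {0..s} (\<lambda>r. Q (\<beta> a r) (\<beta> a0 r))) \<le> exp (K * s)"
        using \<open>s \<ge> 0\<close> by (auto simp: mult.commute)
      then have "\<bar>\<beta> a s - \<beta> a0 s\<bar> \<le> exp (K * s) * \<bar>a - a0\<bar>"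
        unfolding diff[OF \<open>s \<ge> 0\<close>] abs_mult by (intro mult_right_mono) auto
      then show "norm ((\<lambda>(a, s). \<beta> a s) z - (\<lambda>(a, s). \<beta> a s) z0) \<le> g z"
        by (simp add: z g_def a0_s0_def case_prod_unfold)
    qed
    then have "((\<lambda>z. (\<lambda>(a, s). \<beta> a s) z - (\<lambda>(a, s). \<beta> a s) z0) \<longlongrightarrow> 0) (at z0 within UNIV \<times> {0..})"
      using g0 by (rule Lim_null_comparison)
    then show "((\<lambda>(a, s). \<beta> a s) \<longlongrightarrow> (\<lambda>(a, s). \<beta> a s) z0) (at z0 within UNIV \<times> {0..})"
      by (rule LIM_zero_cancel)
  qed
  define J where "J a s = exp (- integral {0..s} (\<lambda>r. H' (\<beta> a r)))" for a s
  have contH\<beta>: "continuous_on {0..} (\<lambda>r. H' (\<beta> a r))" for a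
    by (intro continuous_on_compose2[OF contH'[of UNIV]] cont\<beta>1) auto
  have J_der: "((\<lambda>a. \<beta> a s) has_real_derivative J a0 s) (at a0)" if "s \<ge> 0" for a0 s
    unfolding CARAT_DERIV
  proof (intro exI conjI allI)
    define G where "G a = exp (- integral (cbox 0 s) (\<lambda>r. Q (\<beta> a r) (\<beta> a0 r)))" for a
    show "\<beta> a s - \<beta> a0 s = G a * (a - a0)" for a unfolding G_def using diff[OF that] by simp
    show "G a0 = J a0 s" by (simp add: G_def J_def Qdiag)
    have "continuous_on (UNIV \<times> cbox 0 s) (\<lambda>(a, r). Q (\<beta> a r) (\<beta> a0 r))"
      unfolding case_prod_unfold
      by (intro contQ2 continuous_on_subset[OF cont\<beta>[unfolded case_prod_unfold]] continuous_on_compose2[OF cont\<beta>1] continuous_intros) auto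
    from integral_continuous_on_param[OF this]
    have "continuous_on UNIV G" unfolding G_def by (intro continuous_intros)
    then show "isCont G a0" by (simp add: continuous_on_eq_continuous_at)
  qed
  have HJ: "H (\<beta> a s) = H a * J a s" if "s \<ge> 0" for a s
  proof -
    define V where "V s = integral {0..s} (\<lambda>r. H' (\<beta> a r))" for s
    have V: "(V has_real_derivative H' (\<beta> a s)) (at s within {0..})" if "s \<ge> 0" for s
      unfolding V_def using integral_has_real_derivative_atLeast[OF contH\<beta> that] .
    have "H (\<beta> a s) * exp (V s) = H (\<beta> a 0) * exp (V 0)"
    proof (rule zero_derivative_imp_eq)
      fix t assume t: "t \<in> {0..s}"
      have "((\<lambda>s. H (\<beta> a s)) has_real_derivative H' (\<beta> a t) * (- H (\<beta> a t))) (at t within {0..s})"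
        by (rule DERIV_chain2[OF H' DERIV_subset[OF \<beta>_der]]) (use t in auto)
      then show "((\<lambda>s. H (\<beta> a s) * exp (V s)) has_real_derivative 0) (at t within {0..s})"
        using t by (auto intro!: derivative_eq_intros DERIV_subset[OF V])
    qed (use that in auto)
    then show ?thesis unfolding J_def V_def by (simp add: \<beta>0 exp_minus field_simps)
  qed
  have "Ck_on k (UNIV \<times> {0..}) (\<lambda>(a, s). \<beta> a s)" for k
  proof (induction k)
    case 0
    then show ?case using cont\<beta> by simp
  next
    case (Suc k)
    show ?case
    proof (rule Ck_on_SucI_partials[OF J_der \<beta>_der])
      have "Ck_on k ((UNIV \<times> {0..}) \<times> cbox 0 1) (\<lambda>z. H' (\<beta> (fst (fst z)) (snd (fst z) * snd z)))"
        by (intro Ck_on_compose_real[OF CkH'] Ck_on_compose_pair[OF Suc.IH] Ck_intros) auto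
      then have "Ck_on k (UNIV \<times> {0..}) (\<lambda>z. integral (cbox 0 1) (\<lambda>r. H' (\<beta> (fst (fst (z, r))) (snd (fst (z, r)) * snd (z, r)))))"
        by (intro Ck_on_integral) (auto intro!: convex_Times convex_real_interval)
      then have "Ck_on k (UNIV \<times> {0..}) (\<lambda>z. exp (- (snd z * integral (cbox 0 1) (\<lambda>r. H' (\<beta> (fst z) (snd z * r))))))"
        by (intro Ck_intros) simp
      then show "Ck_on k (UNIV \<times> {0..}) (\<lambda>(a, s). J a s)"
        by (rule Ck_on_cong[THEN iffD1, rotated])
          (auto simp: J_def integral_unit_interval_scale[OF continuous_on_subset[OF contH\<beta>]])
      have "Ck_on k (UNIV \<times> {0..}) (\<lambda>z. - H (\<beta> (fst z) (snd z)))"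
        by (intro Ck_intros Ck_on_compose_real[OF CkH] Ck_on_compose_pair[OF Suc.IH]) auto
      then show "Ck_on k (UNIV \<times> {0..}) (\<lambda>(a, s). - H (\<beta> a s))" by (simp add: case_prod_unfold)
    qed
  qed
  then show ?thesis using that[of \<beta> J] \<beta>0 \<beta>_der J_der HJ by (auto simp: J_def)
qed

section \<open>The initial data and the profile in scaled coordinates\<close>

lemma flat_nonneg: "0 \<le> flat n x" by (simp add: flat_def)
lemma flat_eq_0: "x \<le> 0 \<Longrightarrow> flat n x = 0" by (simp add: flat_def)
lemma flat_pos: "x > 0 \<Longrightarrow> flat n x > 0" by (simp add: flat_def)
lemma flat_0_le_1: "flat 0 x \<le> 1" by (simp add: flat_def)
lemma flat_0_ge: "x \<ge> 1 \<Longrightarrow> exp (- 1) \<le> flat 0 x" by (simp add: flat_def divide_simps)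

text \<open>
  The bounds \<open>scaled_vorticity_lower_bound\<close> and \<open>integral_strain_kernel_ge\<close> give the strain the lower bound
  \<open>s (exp (- 3) / 8) log ((width - 1) / 4)\<close>. With this width it is \<open>17 s / 8\<close>, just above the growth \<open>2 s\<close> of \<open>s\<^sup>2\<close>.
\<close>

definition width :: real where "width = 1 + 4 * exp (17 * exp 3)"

lemma width_ge: "width \<ge> 5"
  using exp_ge_add_one_self[of "17 * exp 3 :: real"] exp_gt_zero[of "3::real"] unfolding width_def by linarith

definition bump :: "real \<Rightarrow> real" where "bump a = flat 0 (a - 1) * flat 0 (width - a)"

definition bump' :: "real \<Rightarrow> real" where
  "bump' a = flat 2 (a - 1) * flat 0 (width - a) - flat 0 (a - 1) * flat 2 (width - a)"

text \<open>
  Normalised at the boundary, so that the field that moves the particles is exactly the bump.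
\<close>

definition cutoff :: "real \<Rightarrow> real" where "cutoff y = flat 0 (width - y) / flat 0 width"

definition density0 :: "real \<Rightarrow> real \<Rightarrow> real" where "density0 a y = a * bump a * cutoff y"

text \<open>
  A globally smooth function that agrees with \<open>1 / x\<close> for \<open>x \<ge> 1\<close>, hence at every position where the density
  does not vanish. It keeps the profile smooth up to the axis \<open>x\<^sub>1 = 0\<close>.
\<close>

definition recip :: "real \<Rightarrow> real" where "recip x = x / (x\<^sup>2 + flat 0 (1 - x))"

lemma Ck_on_bump: "Ck_on k S bump"
  unfolding bump_def[abs_def] by (intro Ck_intros)

lemma Ck_on_bump': "Ck_on k S bump'"
  unfolding bump'_def[abs_def] by (intro Ck_intros)

lemma has_real_derivative_bump: "(bump has_real_derivative bump' a) (at a)"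
proof -
  have "((\<lambda>a. flat 0 (a - 1)) has_real_derivative flat 2 (a - 1) * 1) (at a)"
    by (rule DERIV_chain2[where f="flat 0"])
      (use has_real_derivative_flat[of 0] in \<open>auto intro!: derivative_eq_intros simp: numeral_2_eq_2\<close>)
  moreover have "((\<lambda>a. flat 0 (width - a)) has_real_derivative flat 2 (width - a) * (- 1)) (at a)"
    by (rule DERIV_chain2[where f="flat 0"])
      (use has_real_derivative_flat[of 0] in \<open>auto intro!: derivative_eq_intros simp: numeral_2_eq_2\<close>)
  ultimately have "((\<lambda>a. flat 0 (a - 1) * flat 0 (width - a)) has_real_derivative bump' a) (at a)"
    by (auto intro!: derivative_eq_intros simp: bump'_def)
  then show ?thesis by (simp add: bump_def[abs_def])
qed

lemma bump_eq_0: "a \<le> 1 \<or> a \<ge> width \<Longrightarrow> bump a = 0"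
  by (auto simp: bump_def flat_eq_0)

lemma bump_nonneg: "0 \<le> bump a" by (simp add: bump_def flat_nonneg)

lemma bump_le_1: "bump a \<le> 1"
  using mult_mono[OF flat_0_le_1 flat_0_le_1, of "a - 1" "width - a"] by (simp add: bump_def flat_nonneg mult.commute)

lemma bump_ge: "2 \<le> a \<Longrightarrow> a \<le> width - 1 \<Longrightarrow> exp (- 2) \<le> bump a"
  using mult_mono[OF flat_0_ge flat_0_ge, of "a - 1" "width - a"]
  by (simp add: bump_def flat_nonneg exp_add[symmetric])

lemma bump'_bounded: obtains K where "\<And>a. \<bar>bump' a\<bar> \<le> K"
proof -
  have "compact (bump' ` {1..width})"
    by (rule compact_continuous_image[OF Ck_on_imp_continuous_on[OF Ck_on_bump'] compact_Icc])
  then have "bounded (bump' ` {1..width})" by (rule compact_imp_bounded)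
  then obtain K where K: "\<And>a. a \<in> {1..width} \<Longrightarrow> \<bar>bump' a\<bar> \<le> K"
    unfolding bounded_iff by force
  have "\<bar>bump' a\<bar> \<le> max K 0" for a
    using K[of a] by (cases "a \<in> {1..width}") (auto simp: bump'_def flat_eq_0)
  then show ?thesis using that by blast
qed

lemma cutoff_nonneg: "0 \<le> cutoff y" by (simp add: cutoff_def flat_nonneg)

lemma cutoff_0: "cutoff 0 = 1" using width_ge flat_pos[of width 0] by (simp add: cutoff_def)

lemma cutoff_eq_0: "y \<ge> width \<Longrightarrow> cutoff y = 0" by (simp add: cutoff_def flat_eq_0)

lemma cutoff_ge: assumes "y \<le> width - 1" shows "exp (- 1) \<le> cutoff y"
proof -
  have "exp (- 1) * flat 0 width \<le> flat 0 (width - y) * 1"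
    using assms by (intro mult_mono flat_0_ge flat_0_le_1) (auto simp: flat_nonneg)
  then show ?thesis using flat_pos[of width 0] width_ge by (simp add: cutoff_def pos_le_divide_eq)
qed

lemma Ck_on_cutoff_compose [Ck_intros]: "Ck_on k S f \<Longrightarrow> Ck_on k S (\<lambda>x. cutoff (f x))"
  using flat_pos[of width 0] width_ge unfolding cutoff_def by (intro Ck_intros) auto

lemma Ck_on_bump_compose [Ck_intros]: "Ck_on k S f \<Longrightarrow> Ck_on k S (\<lambda>x. bump (f x))"
  unfolding bump_def by (intro Ck_intros)

lemma Ck_on_density0_compose [Ck_intros]:
  "Ck_on k S f \<Longrightarrow> Ck_on k S g \<Longrightarrow> Ck_on k S (\<lambda>x. density0 (f x) (g x))"
  unfolding density0_def by (intro Ck_intros)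

lemma recip_denom_pos: "x\<^sup>2 + flat 0 (1 - x) > 0"
  by (cases "x = 0") (auto simp: flat_pos intro!: add_pos_nonneg flat_nonneg)

lemma Ck_on_recip_compose [Ck_intros]: "Ck_on k S f \<Longrightarrow> Ck_on k S (\<lambda>x. recip (f x))"
  using recip_denom_pos unfolding recip_def by (intro Ck_intros) (auto simp: less_le)

lemma recip_eq: "x \<ge> 1 \<Longrightarrow> recip x = 1 / x"
  by (simp add: recip_def flat_eq_0 power2_eq_square)

lemma density0_nonneg: "a \<ge> 0 \<Longrightarrow> density0 a y \<ge> 0"
  by (simp add: density0_def bump_nonneg cutoff_nonneg)

lemma admissible_density0: "admissible_data density0"
proof -
  have "smooth_on quadrant (\<lambda>(x1, x2). density0 x1 x2)"
    unfolding smooth_on_def case_prod_unfold by (intro allI Ck_intros)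
  moreover have sub: "closure {(x1, x2) \<in> quadrant. density0 x1 x2 \<noteq> 0} \<subseteq> {1..width} \<times> {0..width}"
  proof (rule closure_minimal)
    show "{(x1, x2) \<in> quadrant. density0 x1 x2 \<noteq> 0} \<subseteq> {1..width} \<times> {0..width}"
    proof
      fix z assume "z \<in> {(x1, x2) \<in> quadrant. density0 x1 x2 \<noteq> 0}"
      then show "z \<in> {1..width} \<times> {0..width}"
        using bump_eq_0[of "fst z"] cutoff_eq_0[of "snd z"] by (cases z) (force simp: density0_def)
    qed
  qed (auto intro: closed_Times)
  moreover have "compact (closure {(x1, x2) \<in> quadrant. density0 x1 x2 \<noteq> 0})"
    using compact_Int_closed[OF compact_Times[OF compact_Icc compact_Icc] closed_closure,
        of 1 width 0 width "{(x1, x2) \<in> quadrant. density0 x1 x2 \<noteq> 0}"]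
    unfolding inf.absorb2[OF sub] .
  ultimately show ?thesis unfolding admissible_data_def Let_def by force
qed

lemma admissible_zero: "admissible_data (\<lambda>_ _. 0)"
  unfolding admissible_data_def smooth_on_def case_prod_unfold by (auto intro: Ck_on_const)

text \<open>
  The backward flow \<open>\<beta>\<close> of the bump and its derivative \<open>J\<close> in the initial value, as supplied by
  \<open>smooth_backward_flow\<close>.
\<close>

locale boundary_flow =
  fixes \<beta> J :: "real \<Rightarrow> real \<Rightarrow> real"
  assumes \<beta>_0: "\<And>a. \<beta> a 0 = a"
    and \<beta>_der: "\<And>a s. s \<ge> 0 \<Longrightarrow> (\<beta> a has_real_derivative - bump (\<beta> a s)) (at s within {0..})"
    and J_der: "\<And>a s. s \<ge> 0 \<Longrightarrow> ((\<lambda>a. \<beta> a s) has_real_derivative J a s) (at a)"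
    and J_pos: "\<And>a s. J a s > 0"
    and bump_\<beta>: "\<And>a s. s \<ge> 0 \<Longrightarrow> bump (\<beta> a s) = bump a * J a s"
    and Ck_\<beta>: "\<And>k. Ck_on k (UNIV \<times> {0..}) (\<lambda>(a, s). \<beta> a s)"
begin

lemma \<beta>_der_within: "t \<in> {0..s} \<Longrightarrow> (\<beta> a has_real_derivative - bump (\<beta> a t)) (at t within {0..s})"
  using DERIV_subset[OF \<beta>_der[of t a], of "{0..s}"] by auto

lemma \<beta>_mono: assumes "a \<le> b" "s \<ge> 0" shows "\<beta> a s \<le> \<beta> b s"
  using J_der[OF assms(2)] J_pos by (intro DERIV_nonneg_imp_nondecreasing[OF assms(1)]) (meson less_imp_le)

text \<open>
  Zeros of the field are stationary. Together with monotonicity in the initial value this confines the flow of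
  \<open>[1, \<infinity>)\<close> to \<open>[1, \<infinity>)\<close>, where \<open>recip\<close> is the true reciprocal.
\<close>

lemma \<beta>_fixed: assumes "bump a = 0" "s \<ge> 0" shows "\<beta> a s = a"
proof -
  have "\<beta> a s = \<beta> a 0"
    by (rule zero_derivative_imp_eq[of s]) (use assms \<beta>_der_within[of _ s a] bump_\<beta> in auto)
  then show ?thesis by (simp add: \<beta>_0)
qed

lemma \<beta>_ge_1: "a \<ge> 1 \<Longrightarrow> s \<ge> 0 \<Longrightarrow> \<beta> a s \<ge> 1"
  using \<beta>_mono[of 1 a s] \<beta>_fixed[of 1 s] bump_eq_0 by auto

lemma cont_\<beta>: "continuous_on {0..s} (\<beta> a)"
  by (rule DERIV_continuous_on[OF \<beta>_der_within])

lemma \<beta>_der_at: "0 < t \<Longrightarrow> (\<beta> a has_real_derivative - bump (\<beta> a t)) (at t)"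
  using \<beta>_der[of t a] at_within_interior[of t "{0..}"] by auto

lemma \<beta>_le: assumes "s \<ge> 0" shows "\<beta> a s \<le> a"
  using DERIV_nonpos_imp_decreasing_open[of 0 s "\<beta> a"] \<beta>_der_at[of _ a] cont_\<beta>[of s a] assms bump_nonneg
  by (force simp: \<beta>_0)

lemma \<beta>_ge: assumes "s \<ge> 0" shows "\<beta> a s \<ge> a - s"
proof -
  have "\<beta> a 0 + 0 \<le> \<beta> a s + s"
  proof (rule DERIV_nonneg_imp_increasing_open[OF assms])
    fix t assume "0 < t" "t < s"
    then have "((\<lambda>t. \<beta> a t + t) has_real_derivative - bump (\<beta> a t) + 1) (at t)"
      by (intro derivative_intros \<beta>_der_at)
    then show "\<exists>y. ((\<lambda>t. \<beta> a t + t) has_real_derivative y) (at t) \<and> 0 \<le> y"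
      using bump_le_1 by (intro exI[of _ "- bump (\<beta> a t) + 1"]) auto
  qed (intro continuous_intros cont_\<beta>)
  then show ?thesis by (simp add: \<beta>_0)
qed

lemma \<beta>_add: assumes "s \<ge> 0" "t \<ge> 0" shows "\<beta> (\<beta> a s) t = \<beta> a (s + t)"
proof -
  obtain K where K: "\<And>a. \<bar>bump' a\<bar> \<le> K" using bump'_bounded by blast
  have "\<beta> (\<beta> a s) t - \<beta> a (s + t) = 0"
  proof (rule gronwall_zero[of t _ _ K t])
    fix r assume r: "r \<in> {0..t}"
    have "((\<lambda>r. \<beta> a (s + r)) has_real_derivative - bump (\<beta> a (s + r)) * 1) (at r within {0..t})"
      by (rule DERIV_chain_within[OF \<beta>_der]) (use r assms in \<open>auto intro!: derivative_eq_intros\<close>)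
    then show "((\<lambda>t. \<beta> (\<beta> a s) t - \<beta> a (s + t)) has_real_derivative
        - bump (\<beta> (\<beta> a s) r) - - bump (\<beta> a (s + r))) (at r within {0..t})"
      using r by (intro derivative_intros \<beta>_der_within) auto
    show "\<bar>- bump (\<beta> (\<beta> a s) r) - - bump (\<beta> a (s + r))\<bar> \<le> K * \<bar>\<beta> (\<beta> a s) r - \<beta> a (s + r)\<bar>"
      using field_differentiable_bound[of UNIV bump bump' K "\<beta> (\<beta> a s) r" "\<beta> a (s + r)"]
        has_real_derivative_bump K by auto
  qed (use assms in \<open>auto simp: \<beta>_0\<close>)
  then show ?thesis by simp
qed

lemma Ck_on_\<beta>_compose [Ck_intros]:
  "Ck_on k S u \<Longrightarrow> Ck_on k S v \<Longrightarrow> (\<And>x. x \<in> S \<Longrightarrow> v x \<ge> 0) \<Longrightarrow> Ck_on k S (\<lambda>x. \<beta> (u x) (v x))"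
  by (rule Ck_on_compose_pair[OF Ck_\<beta>]) auto

text \<open>
  A particle at height \<open>y\<close> with \<open>da/ds = y s bump(a)\<close> has followed the flow for the time \<open>y s\<^sup>2 / 2\<close>, so its label is
  \<open>\<beta> a (y s\<^sup>2 / 2)\<close>. The vorticity that it has gained is the integral of \<open>\<rho> / x\<^sub>1 dt = \<rho> / a d\<sigma>\<close> over \<open>[0, s]\<close>. The
  density is constant along the particle, and at intrinsic time \<open>\<sigma> = r s\<close> its position was
  \<open>\<beta> a (y s\<^sup>2 (1 - r\<^sup>2) / 2)\<close>. The integration variable \<open>r\<close> runs over a fixed interval so that \<open>Ck_on_integral\<close>
  applies.
\<close>

definition scaled_density :: "real \<Rightarrow> real \<Rightarrow> real \<Rightarrow> real" where
  "scaled_density a y s = density0 (\<beta> a (y * s\<^sup>2 / 2)) y"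

definition dwell :: "real \<Rightarrow> real \<Rightarrow> real \<Rightarrow> real" where
  "dwell a y s = integral {0..1} (\<lambda>r. recip (\<beta> a (y * s\<^sup>2 * (1 - r\<^sup>2) / 2)))"

definition scaled_vorticity :: "real \<Rightarrow> real \<Rightarrow> real \<Rightarrow> real" where
  "scaled_vorticity a y s = s * (scaled_density a y s * dwell a y s)"

lemma Ck_on_scaled_density: "Ck_on k ((UNIV \<times> {0..}) \<times> {0..}) (\<lambda>((a, y), s). scaled_density a y s)"
  unfolding scaled_density_def case_prod_unfold by (intro Ck_intros) auto

lemma Ck_on_dwell: "Ck_on k ((UNIV \<times> {0..}) \<times> {0..}) (\<lambda>((a, y), s). dwell a y s)"
proof -
  have "Ck_on k (((UNIV \<times> {0..}) \<times> {0..}) \<times> cbox 0 1)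
    (\<lambda>p. recip (\<beta> (fst (fst (fst p))) (snd (fst (fst p)) * (snd (fst p))\<^sup>2 * (1 - (snd p)\<^sup>2) / 2)))"
    by (intro Ck_intros) (auto simp: power_le_one)
  from Ck_on_integral[OF _ this] show ?thesis
    by (simp add: dwell_def case_prod_unfold convex_Times convex_real_interval)
qed

lemma Ck_on_scaled_vorticity: "Ck_on k ((UNIV \<times> {0..}) \<times> {0..}) (\<lambda>((a, y), s). scaled_vorticity a y s)"
  using Ck_on_mult[OF Ck_on_snd Ck_on_mult[OF Ck_on_scaled_density[of k] Ck_on_dwell[of k]]]
  by (simp add: scaled_vorticity_def case_prod_unfold)

lemma Ck_on_scaled_vorticity_compose:
  "Ck_on k S u \<Longrightarrow> Ck_on k S v \<Longrightarrow> Ck_on k S w \<Longrightarrow> (\<And>x. x \<in> S \<Longrightarrow> v x \<ge> 0) \<Longrightarrow> (\<And>x. x \<in> S \<Longrightarrow> w x \<ge> 0) \<Longrightarrow>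
   Ck_on k S (\<lambda>x. scaled_vorticity (u x) (v x) (w x))"
  by (rule Ck_on_compose_triple[OF Ck_on_scaled_vorticity]) auto

lemma Ck_on_scaled_density_compose:
  "Ck_on k S u \<Longrightarrow> Ck_on k S v \<Longrightarrow> Ck_on k S w \<Longrightarrow> (\<And>x. x \<in> S \<Longrightarrow> v x \<ge> 0) \<Longrightarrow> (\<And>x. x \<in> S \<Longrightarrow> w x \<ge> 0) \<Longrightarrow>
   Ck_on k S (\<lambda>x. scaled_density (u x) (v x) (w x))"
  by (rule Ck_on_compose_triple[OF Ck_on_scaled_density]) auto

lemma scaled_density_eq_0:
  assumes "y \<ge> 0" "a \<le> 1 \<or> a \<ge> width \<or> y \<ge> width" shows "scaled_density a y s = 0"
  using assms bump_\<beta>[of "y * s\<^sup>2 / 2" a] bump_eq_0[of a] cutoff_eq_0[of y]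
  by (auto simp: scaled_density_def density0_def)

lemma scaled_vorticity_eq_0:
  assumes "y \<ge> 0" "a \<le> 1 \<or> a \<ge> width \<or> y \<ge> width" shows "scaled_vorticity a y s = 0"
  using scaled_density_eq_0[OF assms] by (simp add: scaled_vorticity_def)

lemma scaled_vorticity_nonneg:
  assumes "y \<ge> 0" "s \<ge> 0" shows "scaled_vorticity a y s \<ge> 0"
proof (cases "a \<le> 1")
  case False
  have "scaled_density a y s \<ge> 0" unfolding scaled_density_def using assms False
    by (intro density0_nonneg order_trans[OF _ \<beta>_ge_1]) auto
  moreover have "dwell a y s \<ge> 0" unfolding dwell_def
  proof (rule Henstock_Kurzweil_Integration.integral_nonneg)
    have "continuous_on {0..1} (\<lambda>r. recip (\<beta> a (y * s\<^sup>2 * (1 - r\<^sup>2) / 2)))"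
      using assms by (intro Ck_on_imp_continuous_on[of 0] Ck_intros) (auto simp: power_le_one)
    then show "(\<lambda>r. recip (\<beta> a (y * s\<^sup>2 * (1 - r\<^sup>2) / 2))) integrable_on {0..1}"
      by (rule integrable_continuous_interval)
    fix r :: real assume "r \<in> {0..1}"
    then have "\<beta> a (y * s\<^sup>2 * (1 - r\<^sup>2) / 2) \<ge> 1" using assms False by (intro \<beta>_ge_1) (auto simp: power_le_one)
    then show "0 \<le> recip (\<beta> a (y * s\<^sup>2 * (1 - r\<^sup>2) / 2))" by (simp add: recip_eq)
  qed
  ultimately show ?thesis using assms by (simp add: scaled_vorticity_def)
qed (use assms in \<open>simp add: scaled_vorticity_eq_0\<close>)

lemma scaled_vorticity_boundary: "s \<ge> 0 \<Longrightarrow> scaled_vorticity a 0 s = s * bump a"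
  by (cases "a \<le> 1") (auto simp: scaled_vorticity_def scaled_density_def dwell_def \<beta>_0 recip_eq density0_def cutoff_0 bump_eq_0)

text \<open>
  In the layer \<open>y \<le> a / s\<^sup>2\<close> a particle has been displaced by at most \<open>y s\<^sup>2 / 2 \<le> a / 2\<close>. Hence its label lies in
  \<open>[a / 2, a]\<close>, where the density is bounded below by a multiple of \<open>a\<close>, and it spent all its time at positions
  \<open>\<le> a\<close>.
\<close>

lemma scaled_vorticity_lower_bound:
  assumes s: "s \<ge> 1" and a: "4 \<le> a" "a \<le> width - 1" and y: "0 \<le> y" "y \<le> a / s\<^sup>2"
  shows "scaled_vorticity a y s \<ge> s * exp (- 3) / 2"
proof -
  have s2: "s\<^sup>2 \<ge> 1" using s by (simp add: one_le_power)
  have ys: "y * s\<^sup>2 \<le> a" using y s by (simp add: pos_le_divide_eq)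
  have "a / s\<^sup>2 \<le> a / 1" using a s2 by (intro divide_left_mono) auto
  then have yw: "y \<le> width - 1" using y a by simp
  define b where "b = \<beta> a (y * s\<^sup>2 / 2)"
  have b: "a / 2 \<le> b" "b \<le> a"
    using \<beta>_ge[of "y * s\<^sup>2 / 2" a] \<beta>_le[of "y * s\<^sup>2 / 2" a] y ys by (auto simp: b_def)
  have "a / 2 * exp (- 2) * exp (- 1) \<le> b * bump b * cutoff y"
    using a b yw by (intro mult_mono bump_ge cutoff_ge) (auto simp: bump_nonneg)
  then have 1: "a * exp (- 3) / 2 \<le> scaled_density a y s"
    by (simp add: scaled_density_def density0_def b_def mult.assoc exp_add[symmetric])
  have "integral {0..1::real} (\<lambda>r. 1 / a) \<le> dwell a y s" unfolding dwell_def
  proof (rule integral_le)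
    have "continuous_on {0..1} (\<lambda>r. recip (\<beta> a (y * s\<^sup>2 * (1 - r\<^sup>2) / 2)))"
      using y by (intro Ck_on_imp_continuous_on[of 0] Ck_intros) (auto simp: power_le_one)
    then show "(\<lambda>r. recip (\<beta> a (y * s\<^sup>2 * (1 - r\<^sup>2) / 2))) integrable_on {0..1}"
      by (rule integrable_continuous_interval)
    fix r :: real assume "r \<in> {0..1}"
    then have *: "y * s\<^sup>2 * (1 - r\<^sup>2) / 2 \<ge> 0" using y by (auto simp: power_le_one)
    have "\<beta> a (y * s\<^sup>2 * (1 - r\<^sup>2) / 2) \<ge> 1" using a by (intro \<beta>_ge_1[OF _ *]) auto
    then show "1 / a \<le> recip (\<beta> a (y * s\<^sup>2 * (1 - r\<^sup>2) / 2))"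
      using \<beta>_le[OF *, of a] a by (simp add: recip_eq frac_le)
  qed auto
  then have "(a * exp (- 3) / 2) * (1 / a) \<le> scaled_density a y s * dwell a y s"
    using 1 a by (intro mult_mono order_trans[OF _ 1]) auto
  then have "s * ((a * exp (- 3) / 2) * (1 / a)) \<le> s * (scaled_density a y s * dwell a y s)"
    using s by (intro mult_left_mono) auto
  then show ?thesis using a by (simp add: scaled_vorticity_def)
qed

end

theorem boundary_flow_exists: obtains \<beta> J where "boundary_flow \<beta> J"
proof -
  obtain K where K: "\<And>a. \<bar>bump' a\<bar> \<le> K" using bump'_bounded by blast
  show ?thesis
    by (rule smooth_backward_flow[OF has_real_derivative_bump Ck_on_bump Ck_on_bump' K])
      (rule that, rule boundary_flow.intro, assumption+)
qed

section \<open>The profile solves the transport equations\<close>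

lemma at_within_convex_neq_bot:
  fixes S :: "real set"
  assumes "convex S" "x \<in> S" "y \<in> S" "x \<noteq> y"
  shows "at x within S \<noteq> bot"
  using connected_imp_perfect[OF convex_connected[OF assms(1)] assms(2)] assms trivial_limit_within by blast

lemma DERIV_transfer:
  assumes "(f has_field_derivative d) (at x within S)" "x \<in> S" "\<And>y. y \<in> S \<Longrightarrow> g y = f y"
  shows "(g has_field_derivative d) (at x within S)"
  using has_field_derivative_transform_within[OF assms(1), of 1 g] assms(2,3) by simp

lemma DERIV_along_curve:
  fixes F :: "(real \<times> real) \<times> real \<Rightarrow> real"
  assumes F: "(F has_derivative f') (at ((u t, v), w t) within D)"
    and u: "(u has_real_derivative u') (at t within I)" and w: "(w has_real_derivative w') (at t within I)"
    and sub: "\<And>\<sigma>. \<sigma> \<in> I \<Longrightarrow> ((u \<sigma>, v), w \<sigma>) \<in> D"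
  shows "((\<lambda>\<sigma>. F ((u \<sigma>, v), w \<sigma>)) has_real_derivative f' ((u', 0), w')) (at t within I)"
proof -
  have "((\<lambda>\<sigma>. ((u \<sigma>, v), w \<sigma>)) has_derivative (\<lambda>h. ((u' * h, 0), w' * h))) (at t within I)"
    using u w by (auto intro!: derivative_eq_intros simp: has_field_derivative_def)
  from has_derivative_in_compose[OF this has_derivative_subset[OF F]] sub
  have "((\<lambda>\<sigma>. F ((u \<sigma>, v), w \<sigma>)) has_derivative (\<lambda>h. f' ((u' * h, 0), w' * h))) (at t within I)"
    by auto
  moreover have "f' ((u' * h, 0), w' * h) = f' ((u', 0), w') * h" for h
  proof -
    have "f' (h *\<^sub>R ((u', 0), w')) = h *\<^sub>R f' ((u', 0), w')"
      by (rule linear_scale[OF bounded_linear.linear[OF has_derivative_bounded_linear[OF F]]])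
    then show ?thesis by (simp add: mult.commute)
  qed
  ultimately show ?thesis by (simp add: has_field_derivative_def)
qed

lemma DERIV_times_at_0:
  fixes g :: "real \<Rightarrow> real"
  assumes "continuous_on {0..} g"
  shows "((\<lambda>s. s * g s) has_real_derivative g 0) (at 0 within {0..})"
proof -
  have "(g \<longlongrightarrow> g 0) (at 0 within {0..})" using assms by (auto simp: continuous_on_def)
  then have "((\<lambda>s. (s * g s - 0 * g 0) / (s - 0)) \<longlongrightarrow> g 0) (at 0 within {0..})"
    by (rule Lim_transform_eventually) (auto simp: eventually_at_filter)
  then show ?thesis by (simp add: has_field_derivative_iff)
qed

context boundary_flow begin

abbreviation scaled_domain :: "((real \<times> real) \<times> real) set" where
  "scaled_domain \<equiv> (UNIV \<times> {0..}) \<times> {0..}"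

lemma \<beta>_along_characteristic:
  assumes "y \<ge> 0" "0 \<le> \<sigma>" "\<sigma> \<le> s"
  shows "((\<lambda>\<sigma>. \<beta> a (y * (s\<^sup>2 - \<sigma>\<^sup>2) / 2)) has_real_derivative
     y * \<sigma> * bump (\<beta> a (y * (s\<^sup>2 - \<sigma>\<^sup>2) / 2))) (at \<sigma> within {0..s})"
proof -
  have 1: "((\<lambda>\<sigma>. y * (s\<^sup>2 - \<sigma>\<^sup>2) / 2) has_real_derivative - y * \<sigma>) (at \<sigma> within {0..s})"
    by (auto intro!: derivative_eq_intros)
  have 2: "(\<lambda>\<sigma>. y * (s\<^sup>2 - \<sigma>\<^sup>2) / 2) ` {0..s} \<subseteq> {0..}"
    using assms(1) by (auto intro!: mult_nonneg_nonneg power_mono)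
  have 3: "y * (s\<^sup>2 - \<sigma>\<^sup>2) / 2 \<ge> 0" using 2 assms by auto
  show ?thesis
    using DERIV_chain_within[OF \<beta>_der[OF 3] 1 2, of a] by (simp add: mult.commute mult.left_commute)
qed

text \<open>
  The backward characteristic through \<open>(a, y)\<close> at intrinsic time \<open>s > 0\<close> leaves that point in the direction
  \<open>((y s bump(a), 0), 1)\<close>. The transport derivative of a function is therefore its one-sided derivative along this
  curve, where the profile is explicit.
\<close>

lemma DERIV_along_characteristic:
  assumes y: "y \<ge> 0" and s: "s > 0"
    and f': "((\<lambda>((a, y), s). f a y s) has_derivative f') (at ((a, y), s) within scaled_domain)"
    and g: "(g has_real_derivative d) (at s within {0..s})"
    and fg: "\<And>\<sigma>. \<sigma> \<in> {0..s} \<Longrightarrow> f (\<beta> a (y * (s\<^sup>2 - \<sigma>\<^sup>2) / 2)) y \<sigma> = g \<sigma>"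
  shows "f' ((y * s * bump a, 0), 1) = d"
proof -
  define u where "u \<sigma> = \<beta> a (y * (s\<^sup>2 - \<sigma>\<^sup>2) / 2)" for \<sigma>
  have us: "u s = a" by (simp add: u_def \<beta>_0)
  have "(u has_real_derivative y * s * bump a) (at s within {0..s})"
    using \<beta>_along_characteristic[of y s s a] y s by (simp add: u_def[abs_def] \<beta>_0)
  then have "((\<lambda>\<sigma>. (\<lambda>((a, y), s). f a y s) ((u \<sigma>, y), \<sigma>)) has_real_derivative f' ((y * s * bump a, 0), 1)) (at s within {0..s})"
    by (intro DERIV_along_curve[where D=scaled_domain and w="\<lambda>\<sigma>. \<sigma>"]) (use f' y in \<open>auto simp: us\<close>)
  moreover have "((\<lambda>\<sigma>. (\<lambda>((a, y), s). f a y s) ((u \<sigma>, y), \<sigma>)) has_real_derivative d) (at s within {0..s})"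
    by (rule DERIV_transfer[OF g]) (use fg s in \<open>auto simp: u_def\<close>)
  ultimately show ?thesis
    by (rule has_field_derivative_unique, intro at_within_convex_neq_bot[of _ s 0]) (use s in auto)
qed

text \<open>
  At \<open>s = 0\<close> there is no backward characteristic, but the transport field is then purely temporal.
\<close>

lemma DERIV_initial_time:
  assumes y: "y \<ge> 0"
    and f': "((\<lambda>((a, y), s). f a y s) has_derivative f') (at ((a, y), 0) within scaled_domain)"
    and g: "((\<lambda>s. f a y s) has_real_derivative d) (at 0 within {0..})"
  shows "f' ((0, 0), 1) = d"
proof -
  have "((\<lambda>\<sigma>. (\<lambda>((a, y), s). f a y s) ((a, y), \<sigma>)) has_real_derivative f' ((0, 0), 1)) (at 0 within {0..})"
    by (rule DERIV_along_curve[where D=scaled_domain]) (use y f' in auto)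
  then have "((\<lambda>s. f a y s) has_real_derivative f' ((0, 0), 1)) (at 0 within {0..})" by simp
  from this g show ?thesis
    by (rule has_field_derivative_unique, intro at_within_convex_neq_bot[of _ 0 1]) auto
qed

lemma characteristic_flow_back:
  assumes "y \<ge> 0" "0 \<le> \<tau>" "\<tau> \<le> \<sigma>" "\<sigma> \<le> s"
  shows "\<beta> (\<beta> a (y * (s\<^sup>2 - \<sigma>\<^sup>2) / 2)) (y * (\<sigma>\<^sup>2 - \<tau>\<^sup>2) / 2) = \<beta> a (y * (s\<^sup>2 - \<tau>\<^sup>2) / 2)"
proof -
  have "\<sigma>\<^sup>2 \<le> s\<^sup>2" "\<tau>\<^sup>2 \<le> \<sigma>\<^sup>2" using assms by (auto intro: power_mono)
  then have "y * (s\<^sup>2 - \<sigma>\<^sup>2) / 2 \<ge> 0" "y * (\<sigma>\<^sup>2 - \<tau>\<^sup>2) / 2 \<ge> 0" using assms(1) by auto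
  moreover have "y * (s\<^sup>2 - \<sigma>\<^sup>2) / 2 + y * (\<sigma>\<^sup>2 - \<tau>\<^sup>2) / 2 = y * (s\<^sup>2 - \<tau>\<^sup>2) / 2" by (simp add: field_simps)
  ultimately show ?thesis
    using \<beta>_add[of "y * (s\<^sup>2 - \<sigma>\<^sup>2) / 2" "y * (\<sigma>\<^sup>2 - \<tau>\<^sup>2) / 2" a] by metis
qed

lemma scaled_density_along_characteristic:
  assumes "y \<ge> 0" "0 \<le> \<sigma>" "\<sigma> \<le> s"
  shows "scaled_density (\<beta> a (y * (s\<^sup>2 - \<sigma>\<^sup>2) / 2)) y \<sigma> = scaled_density a y s"
  using characteristic_flow_back[of y 0 \<sigma> s a] assms by (simp add: scaled_density_def)

lemma scaled_density_transport:
  assumes y: "y \<ge> 0" and s: "s \<ge> 0"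
    and f': "((\<lambda>((a, y), s). scaled_density a y s) has_derivative f') (at ((a, y), s) within scaled_domain)"
  shows "f' ((y * s * bump a, 0), 1) = 0"
proof (cases "s = 0")
  case True
  obtain D where D: "((\<lambda>x. density0 x y) has_derivative D) (at (\<beta> a (y * 0\<^sup>2 / 2)))"
  proof -
    have "Ck_on (Suc 0) UNIV (\<lambda>x. density0 x y)" by (intro Ck_intros)
    then show ?thesis using that by (auto simp del: Ck_on.simps(1))
  qed
  have "((\<lambda>\<sigma>. \<beta> a (y * \<sigma>\<^sup>2 / 2)) has_real_derivative - bump (\<beta> a (y * 0\<^sup>2 / 2)) * 0) (at 0 within {0..})"
    by (rule DERIV_chain_within[OF \<beta>_der]) (use y in \<open>auto intro!: derivative_eq_intros\<close>)
  then have "((\<lambda>\<sigma>. \<beta> a (y * \<sigma>\<^sup>2 / 2)) has_derivative (\<lambda>h. 0)) (at 0 within {0..})"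
    by (simp add: has_field_derivative_def lambda_zero)
  from has_derivative_compose[OF this D]
  have "((\<lambda>\<sigma>. scaled_density a y \<sigma>) has_derivative (\<lambda>h. D 0)) (at 0 within {0..})"
    by (simp add: scaled_density_def)
  moreover have "D 0 = 0" using has_derivative_bounded_linear[OF D] linear_simps(3) by blast
  ultimately have "((\<lambda>\<sigma>. scaled_density a y \<sigma>) has_real_derivative 0) (at 0 within {0..})"
    by (simp add: has_field_derivative_def lambda_zero)
  with DERIV_initial_time[OF y, of scaled_density f' a 0] f' True show ?thesis by simp
next
  case False
  show ?thesis
    by (rule DERIV_along_characteristic[OF y _ f', of "\<lambda>_. scaled_density a y s"])
      (use False s y scaled_density_along_characteristic in auto)
qed

lemma cont_recip_\<beta>:
  assumes "continuous_on S v" "\<And>x. x \<in> S \<Longrightarrow> v x \<ge> 0"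
  shows "continuous_on S (\<lambda>x. recip (\<beta> a (v x)))"
proof -
  have "continuous_on {0..} (\<lambda>s. recip (\<beta> a s))"
    by (intro Ck_on_imp_continuous_on[of 0] Ck_intros) auto
  from continuous_on_compose2[OF this assms(1)] assms(2) show ?thesis by auto
qed

text \<open>
  By the group property of the flow, the positions visited before the intrinsic time \<open>\<sigma>\<close> do not depend on the point of the
  characteristic from which one looks back. So the dwell integral becomes an integral with upper limit \<open>\<sigma>\<close>
  of a fixed integrand.
\<close>

lemma scaled_vorticity_along_characteristic:
  assumes y: "y \<ge> 0" and \<sigma>: "0 \<le> \<sigma>" "\<sigma> \<le> s"
  shows "scaled_vorticity (\<beta> a (y * (s\<^sup>2 - \<sigma>\<^sup>2) / 2)) y \<sigma> =
    scaled_density a y s * integral {0..\<sigma>} (\<lambda>\<tau>. recip (\<beta> a (y * (s\<^sup>2 - \<tau>\<^sup>2) / 2)))"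
proof -
  have "\<sigma> * dwell (\<beta> a (y * (s\<^sup>2 - \<sigma>\<^sup>2) / 2)) y \<sigma> =
      \<sigma> * integral {0..1} (\<lambda>r. recip (\<beta> a (y * (s\<^sup>2 - (\<sigma> * r)\<^sup>2) / 2)))"
    unfolding dwell_def
  proof (intro arg_cong[where f="(*) \<sigma>"] integral_cong)
    fix r :: real assume "r \<in> {0..1}"
    then have "\<beta> (\<beta> a (y * (s\<^sup>2 - \<sigma>\<^sup>2) / 2)) (y * (\<sigma>\<^sup>2 - (\<sigma> * r)\<^sup>2) / 2) = \<beta> a (y * (s\<^sup>2 - (\<sigma> * r)\<^sup>2) / 2)"
      using \<sigma> y by (intro characteristic_flow_back) (auto simp: mult_left_le)
    then show "recip (\<beta> (\<beta> a (y * (s\<^sup>2 - \<sigma>\<^sup>2) / 2)) (y * \<sigma>\<^sup>2 * (1 - r\<^sup>2) / 2)) = recip (\<beta> a (y * (s\<^sup>2 - (\<sigma> * r)\<^sup>2) / 2))"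
      by (simp add: algebra_simps power_mult_distrib)
  qed
  also have "\<dots> = integral {0..\<sigma>} (\<lambda>\<tau>. recip (\<beta> a (y * (s\<^sup>2 - \<tau>\<^sup>2) / 2)))"
    by (rule integral_unit_interval_scale[symmetric])
      (use \<sigma> y in \<open>auto intro!: cont_recip_\<beta> continuous_intros mult_nonneg_nonneg power_mono\<close>)
  finally show ?thesis
    using scaled_density_along_characteristic[OF assms, of a] by (simp add: scaled_vorticity_def)
qed

lemma scaled_density_recip: "y \<ge> 0 \<Longrightarrow> scaled_density a y s * recip a = scaled_density a y s / a"
  by (cases "a \<ge> 1") (simp_all add: recip_eq scaled_density_eq_0)

lemma scaled_vorticity_transport:
  assumes y: "y \<ge> 0" and s: "s \<ge> 0"
    and f': "((\<lambda>((a, y), s). scaled_vorticity a y s) has_derivative f') (at ((a, y), s) within scaled_domain)"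
  shows "f' ((y * s * bump a, 0), 1) = scaled_density a y s / a"
proof (cases "s = 0")
  case True
  have "continuous_on {0..} (\<lambda>s. scaled_density a y s * dwell a y s)"
    by (rule Ck_on_imp_continuous_on[of 0], intro Ck_intros
      Ck_on_compose_triple[OF Ck_on_scaled_density] Ck_on_compose_triple[OF Ck_on_dwell]) (use y in auto)
  from DERIV_times_at_0[OF this]
  have "((\<lambda>s. scaled_vorticity a y s) has_real_derivative scaled_density a y 0 * dwell a y 0) (at 0 within {0..})"
    by (simp add: scaled_vorticity_def)
  moreover have "dwell a y 0 = recip a" by (simp add: dwell_def \<beta>_0)
  ultimately show ?thesis using DERIV_initial_time[OF y, of scaled_vorticity f' a] f' True
      scaled_density_recip[OF y, of a 0] by simp
next
  case False
  have g: "((\<lambda>\<sigma>. scaled_density a y s * integral {0..\<sigma>} (\<lambda>\<tau>. recip (\<beta> a (y * (s\<^sup>2 - \<tau>\<^sup>2) / 2)))) has_real_derivative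
     scaled_density a y s * recip (\<beta> a (y * (s\<^sup>2 - s\<^sup>2) / 2))) (at s within {0..s})"
    by (intro DERIV_cmult integral_has_real_derivative)
      (use s y in \<open>auto intro!: cont_recip_\<beta> continuous_intros mult_nonneg_nonneg power_mono\<close>)
  have "f' ((y * s * bump a, 0), 1) = scaled_density a y s * recip (\<beta> a (y * (s\<^sup>2 - s\<^sup>2) / 2))"
    by (rule DERIV_along_characteristic[OF y _ f' g])
      (use False s y scaled_vorticity_along_characteristic in auto)
  then show ?thesis using scaled_density_recip[OF y, of a s] by (simp add: \<beta>_0)
qed

end

section \<open>The strain as a function of compression and intrinsic time\<close>

text \<open>
  The kernel \<open>y\<^sub>1 y\<^sub>2 / |y|\<^sup>4\<close> with its area element, written in the scaled variable \<open>a = m y\<^sub>1\<close>. In this form it is not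
  singular on the support \<open>a \<ge> 1\<close> of the profile and smooth in \<open>m\<close>.
\<close>

definition strain_kernel :: "real \<Rightarrow> real \<Rightarrow> real \<Rightarrow> real" where
  "strain_kernel m a y = m\<^sup>2 * a * y / (a\<^sup>2 + m\<^sup>2 * y\<^sup>2)\<^sup>2"

lemma strain_denom_pos: "a \<ge> 1 \<Longrightarrow> a\<^sup>2 + m\<^sup>2 * y\<^sup>2 \<ge> (1::real)"
  using one_le_power[of a 2] by (simp add: add_increasing2)

lemma strain_kernel_nonneg: "a \<ge> 1 \<Longrightarrow> y \<ge> 0 \<Longrightarrow> strain_kernel m a y \<ge> 0"
  by (simp add: strain_kernel_def)

text \<open>
  With \<open>D = a\<^sup>2 + m\<^sup>2 y\<^sup>2 \<ge> 1\<close> the derivative in \<open>m\<close> is \<open>2 m a y (a\<^sup>2 - m\<^sup>2 y\<^sup>2) / D\<^sup>3\<close>, and each of the two factors of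
  the numerator is at most \<open>D\<close>.
\<close>

lemma strain_kernel_lipschitz:
  assumes "a \<ge> 1" shows "\<bar>strain_kernel m a y - strain_kernel m' a y\<bar> \<le> \<bar>m - m'\<bar>"
proof -
  define D where "D m = a\<^sup>2 + m\<^sup>2 * y\<^sup>2" for m
  have D1: "D m \<ge> 1" for m using strain_denom_pos[OF assms] by (simp add: D_def)
  define d where "d m = 2 * m * a * y * (a\<^sup>2 - m\<^sup>2 * y\<^sup>2) / D m ^ 3" for m
  have der: "((\<lambda>m. strain_kernel m a y) has_real_derivative d m) (at m within UNIV)" for m
  proof -
    have "((\<lambda>m. m\<^sup>2 * a * y / (D m)\<^sup>2) has_real_derivative
        (2 * m * a * y * (D m)\<^sup>2 - m\<^sup>2 * a * y * (2 * D m * (2 * m * y\<^sup>2))) / ((D m)\<^sup>2 * (D m)\<^sup>2)) (at m)"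
      using D1[of m] unfolding D_def by (auto intro!: derivative_eq_intros)
    moreover have "(2 * m * a * y * (D m)\<^sup>2 - m\<^sup>2 * a * y * (2 * D m * (2 * m * y\<^sup>2))) =
        D m * (2 * m * a * y * (a\<^sup>2 - m\<^sup>2 * y\<^sup>2))"
      unfolding D_def by algebra
    moreover have "D m * (2 * m * a * y * (a\<^sup>2 - m\<^sup>2 * y\<^sup>2)) / ((D m)\<^sup>2 * (D m)\<^sup>2) = d m"
      using D1[of m] by (simp add: d_def power2_eq_square power3_eq_cube)
    ultimately show ?thesis by (simp add: strain_kernel_def D_def)
  qed
  have "norm (d m) \<le> 1" for m
  proof -
    have "\<bar>2 * m * a * y\<bar> \<le> D m"
      using sum_squares_bound[of a "m * y"] sum_squares_bound[of a "- (m * y)"]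
      by (auto simp: D_def power_mult_distrib abs_le_iff mult_ac)
    moreover have "\<bar>a\<^sup>2 - m\<^sup>2 * y\<^sup>2\<bar> \<le> D m" by (auto simp: D_def abs_le_iff)
    ultimately have "\<bar>2 * m * a * y\<bar> * \<bar>a\<^sup>2 - m\<^sup>2 * y\<^sup>2\<bar> \<le> D m * D m"
      by (intro mult_mono) (use D1[of m] in auto)
    also have "\<dots> \<le> D m ^ 3" using D1[of m] mult_left_mono[OF D1[of m], of "D m * D m"] by (simp add: power3_eq_cube)
    finally show ?thesis using D1[of m] unfolding d_def by (simp add: abs_mult)
  qed
  then show ?thesis using field_differentiable_bound[OF convex_UNIV der, of 1 m m'] by simp
qed

text \<open>
  An antiderivative in \<open>y\<close> is \<open>- (a / 2) / (a\<^sup>2 + m\<^sup>2 y\<^sup>2)\<close>. The integral over all \<open>y \<ge> 0\<close> is \<open>1 / (2 a)\<close>, and for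
  \<open>m \<ge> s\<^sup>2\<close> at least half of it comes from the layer \<open>y \<le> a / s\<^sup>2\<close>.
\<close>

lemma integral_strain_kernel_ge:
  assumes a: "a \<ge> 1" and m: "m \<ge> s\<^sup>2" and s: "s \<ge> 1"
  shows "integral {0..a / s\<^sup>2} (strain_kernel m a) \<ge> 1 / (4 * a)"
proof -
  have s2: "s\<^sup>2 \<ge> 1" using s by (simp add: one_le_power)
  have m0: "m \<noteq> 0" using m s2 by linarith
  have as: "a / s\<^sup>2 \<ge> 0" using a by simp
  define G where "G y = - (a / 2) / (a\<^sup>2 + m\<^sup>2 * y\<^sup>2)" for y
  have "(strain_kernel m a has_integral (G (a / s\<^sup>2) - G 0)) {0..a / s\<^sup>2}"
  proof (rule fundamental_theorem_of_calculus[OF as])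
    fix y
    define D where "D y = a\<^sup>2 + m\<^sup>2 * y\<^sup>2" for y
    have D: "D y \<noteq> 0" using strain_denom_pos[OF a, of m y] unfolding D_def by linarith
    have D': "(D has_real_derivative 2 * m\<^sup>2 * y) (at y)"
      unfolding D_def by (auto intro!: derivative_eq_intros)
    have "((\<lambda>x. - (a / 2) * inverse (D x)) has_real_derivative m\<^sup>2 * a * y / (D y)\<^sup>2) (at y)"
      by (rule DERIV_cong[OF DERIV_cmult[OF DERIV_inverse_fun[OF D' D]]])
        (use D in \<open>simp add: field_simps power2_eq_square\<close>)
    moreover have "(\<lambda>x. - (a / 2) * inverse (D x)) = G"
      by (rule ext) (simp only: G_def D_def divide_inverse)
    moreover have "m\<^sup>2 * a * y / (D y)\<^sup>2 = strain_kernel m a y" by (simp only: strain_kernel_def D_def)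
    ultimately have "(G has_real_derivative strain_kernel m a y) (at y)" by simp
    then show "(G has_vector_derivative strain_kernel m a y) (at y within {0..a / s\<^sup>2})"
      by (simp add: has_real_derivative_iff_has_vector_derivative has_vector_derivative_at_within)
  qed
  then have eq: "integral {0..a / s\<^sup>2} (strain_kernel m a) = G (a / s\<^sup>2) - G 0" by (rule integral_unique)
  have "s\<^sup>2 * (a / s\<^sup>2) = a" using s by simp
  then have "m * (a / s\<^sup>2) \<ge> a" using mult_right_mono[OF m as] by simp
  then have "(m * (a / s\<^sup>2))\<^sup>2 \<ge> a\<^sup>2" using a by (intro power_mono) auto
  then have "2 * a\<^sup>2 \<le> a\<^sup>2 + m\<^sup>2 * (a / s\<^sup>2)\<^sup>2" unfolding power_mult_distrib by linarith
  then have "(a / 2) / (a\<^sup>2 + m\<^sup>2 * (a / s\<^sup>2)\<^sup>2) \<le> (a / 2) / (2 * a\<^sup>2)"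
    using a by (intro divide_left_mono) (auto intro!: mult_pos_pos add_pos_nonneg)
  then have "G (a / s\<^sup>2) \<ge> - (1 / (4 * a))" using a by (simp add: G_def power2_eq_square)
  moreover have "G 0 = - (2 * (1 / (4 * a)))" using a by (simp add: G_def power2_eq_square)
  ultimately show ?thesis unfolding eq by linarith
qed

context boundary_flow begin

abbreviation scaled_box :: "(real \<times> real) set" where
  "scaled_box \<equiv> cbox (1, 0) (width, width)"

lemma scaled_box_eq: "scaled_box = {1..width} \<times> {0..width}"
  by (simp add: cbox_Pair_eq)

definition strain :: "real \<Rightarrow> real \<Rightarrow> real" where
  "strain m s = integral scaled_box (\<lambda>(a, y). strain_kernel m a y * scaled_vorticity a y s)"

lemma Ck_on_strain_integrand:
  "Ck_on k ((UNIV \<times> {0..}) \<times> scaled_box) (\<lambda>z. strain_kernel (fst (fst z)) (fst (snd z)) (snd (snd z)) *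
     scaled_vorticity (fst (snd z)) (snd (snd z)) (snd (fst z)))"
proof -
  have "(fst (snd z))\<^sup>2 + (fst (fst z))\<^sup>2 * (snd (snd z))\<^sup>2 \<noteq> 0"
    if "z \<in> (UNIV \<times> {0..}) \<times> scaled_box" for z :: "(real \<times> real) \<times> (real \<times> real)"
    using that strain_denom_pos[of "fst (snd z)" "fst (fst z)" "snd (snd z)"] by (auto simp: scaled_box_eq)
  then show ?thesis unfolding strain_kernel_def
    by (intro Ck_intros Ck_on_scaled_vorticity_compose) (auto simp: scaled_box_eq)
qed

lemma Ck_on_strain: "Ck_on k (UNIV \<times> {0..}) (\<lambda>(m, s). strain m s)"
  using Ck_on_integral[OF _ Ck_on_strain_integrand, of k]
  by (simp add: strain_def case_prod_unfold convex_Times)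

lemma cont_strain_integrand:
  assumes "s \<ge> 0" shows "continuous_on scaled_box (\<lambda>(a, y). strain_kernel m a y * scaled_vorticity a y s)"
proof -
  have "continuous_on scaled_box (\<lambda>z. ((m, s), z))" by (intro continuous_intros)
  from continuous_on_compose2[OF Ck_on_imp_continuous_on[OF Ck_on_strain_integrand[of 0]] this]
  show ?thesis using assms by (auto simp: case_prod_unfold)
qed

lemma cont_scaled_vorticity:
  assumes "s \<ge> 0" shows "continuous_on scaled_box (\<lambda>(a, y). scaled_vorticity a y s)"
  unfolding case_prod_unfold using assms
  by (intro Ck_on_imp_continuous_on[of 0] Ck_on_scaled_vorticity_compose Ck_intros) (auto simp: scaled_box_eq)

definition strain_lipschitz :: "real \<Rightarrow> real" where
  "strain_lipschitz s = integral scaled_box (\<lambda>(a, y). scaled_vorticity a y s)"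

lemma cont_strain_lipschitz: "continuous_on {0..} strain_lipschitz"
proof -
  have "Ck_on 0 ({0..} \<times> scaled_box) (\<lambda>z. scaled_vorticity (fst (snd z)) (snd (snd z)) (fst z))"
    by (intro Ck_on_scaled_vorticity_compose Ck_intros) (auto simp: scaled_box_eq)
  from Ck_on_integral[OF _ this] show ?thesis
    by (simp add: strain_lipschitz_def[abs_def] case_prod_unfold)
qed

lemma strain_lipschitz_nonneg: "s \<ge> 0 \<Longrightarrow> strain_lipschitz s \<ge> 0"
  unfolding strain_lipschitz_def using cont_scaled_vorticity[of s]
  by (intro Henstock_Kurzweil_Integration.integral_nonneg integrable_continuous)
    (auto simp: scaled_box_eq intro: scaled_vorticity_nonneg)

lemma strain_is_lipschitz:
  assumes s: "s \<ge> 0" shows "\<bar>strain m s - strain m' s\<bar> \<le> strain_lipschitz s * \<bar>m - m'\<bar>"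
proof -
  have "norm (integral scaled_box (\<lambda>z. (\<lambda>(a, y). strain_kernel m a y * scaled_vorticity a y s) z -
          (\<lambda>(a, y). strain_kernel m' a y * scaled_vorticity a y s) z))
      \<le> integral scaled_box (\<lambda>z. \<bar>m - m'\<bar> * (\<lambda>(a, y). scaled_vorticity a y s) z)"
  proof (rule integral_norm_bound_integral)
    fix z assume "z \<in> scaled_box"
    then obtain a y where z: "z = (a, y)" "a \<ge> 1" "y \<ge> 0" by (auto simp: scaled_box_eq)
    have "\<bar>strain_kernel m a y - strain_kernel m' a y\<bar> * scaled_vorticity a y s \<le> \<bar>m - m'\<bar> * scaled_vorticity a y s"
      by (intro mult_right_mono strain_kernel_lipschitz scaled_vorticity_nonneg z s)
    then show "norm ((\<lambda>(a, y). strain_kernel m a y * scaled_vorticity a y s) z -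
          (\<lambda>(a, y). strain_kernel m' a y * scaled_vorticity a y s) z) \<le> \<bar>m - m'\<bar> * (\<lambda>(a, y). scaled_vorticity a y s) z"
      using scaled_vorticity_nonneg[OF z(3) s, of a] by (simp add: z(1) left_diff_distrib[symmetric] abs_mult)
  qed (intro integrable_diff integrable_continuous cont_strain_integrand s continuous_intros cont_scaled_vorticity)+
  also have "integral scaled_box (\<lambda>z. (\<lambda>(a, y). strain_kernel m a y * scaled_vorticity a y s) z -
          (\<lambda>(a, y). strain_kernel m' a y * scaled_vorticity a y s) z) = strain m s - strain m' s"
    unfolding strain_def
    by (intro Henstock_Kurzweil_Integration.integral_diff integrable_continuous cont_strain_integrand s)
  finally show ?thesis by (simp add: strain_lipschitz_def mult.commute)
qed

lemma strain_nonneg: "s \<ge> 0 \<Longrightarrow> strain m s \<ge> 0"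
  unfolding strain_def
  by (intro Henstock_Kurzweil_Integration.integral_nonneg integrable_continuous cont_strain_integrand)
    (auto simp: scaled_box_eq intro!: mult_nonneg_nonneg scaled_vorticity_nonneg strain_kernel_nonneg)

text \<open>
  The lower bounds for the vorticity and for the kernel in the layer \<open>y \<le> a / s\<^sup>2\<close> leave the integral of a constant
  multiple of \<open>s / a\<close> over \<open>[4, width - 1]\<close>, and the width is such that \<open>log ((width - 1) / 4)\<close> compensates the constant.
\<close>

lemma strain_lower_bound:
  assumes s: "s \<ge> 1" and m: "m \<ge> s\<^sup>2"
  shows "strain m s > 2 * s"
proof -
  have s0: "s \<ge> 0" using s by simp
  define inner where "inner a = integral {0..width} (\<lambda>y. strain_kernel m a y * scaled_vorticity a y s)" for a
  have cont: "continuous_on {0..width} (\<lambda>y. strain_kernel m a y * scaled_vorticity a y s)" if "a \<in> {1..width}" for a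
  proof -
    have "continuous_on {0..width} (\<lambda>y. (a, y))" by (intro continuous_intros)
    from continuous_on_compose2[OF cont_strain_integrand[OF s0, of m] this] that
    show ?thesis by (auto simp: scaled_box_eq image_subset_iff)
  qed
  have "continuous_on ({1..width} \<times> cbox 0 width) (\<lambda>(a, y). strain_kernel m a y * scaled_vorticity a y s)"
    using cont_strain_integrand[OF s0, of m] by (simp add: scaled_box_eq)
  from integral_continuous_on_param[OF this]
  have cont_inner: "continuous_on {1..width} inner" by (simp add: inner_def[abs_def])
  have "strain m s = integral {1..width} inner"
    unfolding strain_def using integral_prod_continuous[OF cont_strain_integrand[OF s0, of m]]
    by (simp add: inner_def[abs_def])
  moreover have inner_nonneg: "inner a \<ge> 0" if "a \<in> {1..width}" for a
    unfolding inner_def using that s0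
    by (intro Henstock_Kurzweil_Integration.integral_nonneg integrable_continuous_interval cont)
      (auto intro!: mult_nonneg_nonneg scaled_vorticity_nonneg strain_kernel_nonneg)
  ultimately have 1: "strain m s \<ge> integral {4..width - 1} inner"
    by (auto intro!: integral_subset_le integrable_continuous_interval continuous_on_subset[OF cont_inner])
  have inner_ge: "inner a \<ge> (s * exp (- 3) / 8) * (1 / a)" if a: "a \<in> {4..width - 1}" for a
  proof -
    have s2: "s\<^sup>2 \<ge> 1" using s by (simp add: one_le_power)
    have "a / s\<^sup>2 \<le> a / 1" using a s2 by (intro divide_left_mono) auto
    then have aw: "a / s\<^sup>2 \<le> width" using a by auto
    have a1: "a \<ge> 1" using a by simp
    have contk: "continuous_on {0..a / s\<^sup>2} (strain_kernel m a)"
    proof -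
      have "a\<^sup>2 + m\<^sup>2 * y\<^sup>2 \<noteq> 0" for y using strain_denom_pos[OF a1, of m y] by linarith
      then show ?thesis unfolding strain_kernel_def by (intro continuous_intros) auto
    qed
    have "(s * exp (- 3) / 2) * (1 / (4 * a)) \<le> (s * exp (- 3) / 2) * integral {0..a / s\<^sup>2} (strain_kernel m a)"
      using a1 m s by (intro mult_left_mono integral_strain_kernel_ge) auto
    also have "\<dots> = integral {0..a / s\<^sup>2} (\<lambda>y. (s * exp (- 3) / 2) * strain_kernel m a y)" by simp
    also have "\<dots> \<le> integral {0..a / s\<^sup>2} (\<lambda>y. strain_kernel m a y * scaled_vorticity a y s)"
    proof (rule integral_le)
      fix y assume y: "y \<in> {0..a / s\<^sup>2}"
      have "s * exp (- 3) / 2 \<le> scaled_vorticity a y s"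
        using a y s by (intro scaled_vorticity_lower_bound) auto
      then have "strain_kernel m a y * (s * exp (- 3) / 2) \<le> strain_kernel m a y * scaled_vorticity a y s"
        using a1 y by (intro mult_left_mono strain_kernel_nonneg) auto
      then show "s * exp (- 3) / 2 * strain_kernel m a y \<le> strain_kernel m a y * scaled_vorticity a y s"
        by (simp add: mult.commute)
    next
      show "(\<lambda>y. s * exp (- 3) / 2 * strain_kernel m a y) integrable_on {0..a / s\<^sup>2}"
        by (intro integrable_continuous_interval continuous_intros contk)
      show "(\<lambda>y. strain_kernel m a y * scaled_vorticity a y s) integrable_on {0..a / s\<^sup>2}"
        using a aw by (intro integrable_continuous_interval continuous_on_subset[OF cont]) auto
    qed
    also have "\<dots> \<le> inner a" unfolding inner_def
      using a aw s0
      by (intro integral_subset_le integrable_continuous_interval continuous_on_subset[OF cont])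
        (auto intro!: mult_nonneg_nonneg scaled_vorticity_nonneg strain_kernel_nonneg)
    finally show ?thesis by simp
  qed
  have w: "4 \<le> width - 1" using width_ge by simp
  have "((\<lambda>a. 1 / a) has_integral (ln (width - 1) - ln 4)) {4..width - 1}"
    using w by (intro fundamental_theorem_of_calculus)
      (auto simp: has_real_derivative_iff_has_vector_derivative[symmetric] intro!: derivative_eq_intros)
  moreover have "ln (width - 1) - ln 4 = 17 * exp 3"
    by (simp add: width_def ln_mult)
  ultimately have "((\<lambda>a. (s * exp (- 3) / 8) * (1 / a)) has_integral (s * exp (- 3) / 8) * (17 * exp 3)) {4..width - 1}"
    by (metis has_integral_mult_right)
  moreover have "inner integrable_on {4..width - 1}"
    by (intro integrable_continuous_interval continuous_on_subset[OF cont_inner]) auto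
  ultimately have "(s * exp (- 3) / 8) * (17 * exp 3) \<le> integral {4..width - 1} inner"
    by (intro has_integral_le[OF _ integrable_integral]) (use inner_ge in auto)
  moreover have "(s * exp (- 3) / 8) * (17 * exp 3) = 17 / 8 * s"
    by (simp add: exp_minus)
  ultimately show ?thesis using 1 s by linarith
qed

end

section \<open>From the profile to the system\<close>

text \<open>
  The partial derivatives of the system are taken in the classical one-variable sense. Where \<open>x\<^sub>1 > 0\<close> they agree with
  values of the derivative relative to the quadrant.
\<close>

lemma Ck_on_partials:
  assumes Ck: "Ck_on (Suc 0) (quadrant \<times> {0..<T}) (\<lambda>((x1, x2), t). f x1 x2 t)"
    and x: "x1 > 0" "x2 \<ge> 0" and t: "t \<in> {0..<T}"
  obtains f' where "((\<lambda>((x1, x2), t). f x1 x2 t) has_derivative f') (at ((x1, x2), t) within quadrant \<times> {0..<T})"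
    "\<And>u. f' ((u, 0), 1) = partial_t T f x1 x2 t + u * partial_x1 f x1 x2 t"
proof -
  have mem: "((x1, x2), t) \<in> quadrant \<times> {0..<T}" using x t by auto
  from Ck[unfolded Ck_on.simps(2)] mem obtain f' where f':
    "((\<lambda>((x1, x2), t). f x1 x2 t) has_derivative f') (at ((x1, x2), t) within quadrant \<times> {0..<T})"
    by blast
  have "((\<lambda>\<sigma>. (\<lambda>((x1, x2), t). f x1 x2 t) ((x1, x2), \<sigma>)) has_real_derivative f' ((0, 0), 1)) (at t within {0..<T})"
    by (rule DERIV_along_curve[where u="\<lambda>_. x1" and w="\<lambda>\<sigma>. \<sigma>" and D="quadrant \<times> {0..<T}"]) (use f' x in auto)
  then have "((\<lambda>\<sigma>. f x1 x2 \<sigma>) has_vector_derivative f' ((0, 0), 1)) (at t within {0..<T})"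
    by (simp add: has_real_derivative_iff_has_vector_derivative)
  moreover have "at t within {0..<T} \<noteq> bot"
    using t by (intro at_within_convex_neq_bot[of _ t "if t = 0 then T / 2 else 0"]) auto
  ultimately have pt: "partial_t T f x1 x2 t = f' ((0, 0), 1)"
    unfolding partial_t_def by (intro vector_derivative_within)
  have "((\<lambda>\<sigma>. (\<lambda>((x1, x2), t). f x1 x2 t) ((\<sigma>, x2), (\<lambda>_. t) \<sigma>)) has_real_derivative f' ((1, 0), 0)) (at x1 within {0<..})"
    by (rule DERIV_along_curve[where u="\<lambda>\<sigma>. \<sigma>" and D="quadrant \<times> {0..<T}"]) (use f' x t in auto)
  then have "((\<lambda>\<sigma>. f \<sigma> x2 t) has_real_derivative f' ((1, 0), 0)) (at x1)"
    using x at_within_open[of x1 "{0<..}"] by simp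
  then have px: "partial_x1 f x1 x2 t = f' ((1, 0), 0)"
    unfolding partial_x1_def by (rule DERIV_imp_deriv)
  have "f' ((u, 0), 1) = f' ((0, 0), 1) + u * f' ((1, 0), 0)" for u
  proof -
    have lin: "linear f'" using f' has_derivative_linear by blast
    have "f' (((0, 0), 1) + u *\<^sub>R ((1, 0), 0)) = f' ((0, 0), 1) + u *\<^sub>R f' ((1, 0), 0)"
      by (simp only: linear_add[OF lin] linear_scale[OF lin])
    then show ?thesis by simp
  qed
  then show ?thesis unfolding pt[symmetric] px[symmetric] by (rule that[OF f'])
qed

lemma DERIV_along_path:
  assumes Ck: "Ck_on (Suc 0) (quadrant \<times> {0..<T}) (\<lambda>((x1, x2), t). f x1 x2 t)"
    and u: "(u has_real_derivative u') (at t within I)" and I: "t \<in> I" "I \<subseteq> {0..<T}"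
    and pos: "\<And>\<sigma>. \<sigma> \<in> I \<Longrightarrow> u \<sigma> > 0" and x2: "x2 \<ge> 0"
  shows "((\<lambda>\<sigma>. f (u \<sigma>) x2 \<sigma>) has_real_derivative
     partial_t T f (u t) x2 t + u' * partial_x1 f (u t) x2 t) (at t within I)"
proof -
  obtain f' where f':
    "((\<lambda>((x1, x2), t). f x1 x2 t) has_derivative f') (at ((u t, x2), t) within quadrant \<times> {0..<T})"
    "\<And>v. f' ((v, 0), 1) = partial_t T f (u t) x2 t + v * partial_x1 f (u t) x2 t"
    using Ck_on_partials[OF Ck pos[OF I(1)] x2, of t] I by blast
  have "((\<lambda>\<sigma>. (\<lambda>((x1, x2), t). f x1 x2 t) ((u \<sigma>, x2), \<sigma>)) has_real_derivative f' ((u', 0), 1)) (at t within I)"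
    by (rule DERIV_along_curve[where u=u and D="quadrant \<times> {0..<T}"])
      (use f'(1) u I pos x2 in \<open>auto intro: less_imp_le\<close>)
  then show ?thesis by (simp add: f'(2))
qed

context boundary_flow begin

text \<open>
  The profile in physical variables, for a given compression factor \<open>m\<close> and intrinsic time \<open>E\<close>.
\<close>

definition sol_omega :: "(real \<Rightarrow> real) \<Rightarrow> (real \<Rightarrow> real) \<Rightarrow> real \<Rightarrow> real \<Rightarrow> real \<Rightarrow> real" where
  "sol_omega m E x1 x2 t = scaled_vorticity (x1 * m t) x2 (E t)"

definition sol_rho :: "(real \<Rightarrow> real) \<Rightarrow> (real \<Rightarrow> real) \<Rightarrow> real \<Rightarrow> real \<Rightarrow> real \<Rightarrow> real" where
  "sol_rho m E x1 x2 t = scaled_density (x1 * m t) x2 (E t)"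

lemma Ck_on_scale_factors:
  fixes m E :: "real \<Rightarrow> real"
  assumes "Ck_on k {0..<T} m" "Ck_on k {0..<T} E"
  shows "Ck_on k (quadrant \<times> {0..<T}) (\<lambda>z. m (snd z))" "Ck_on k (quadrant \<times> {0..<T}) (\<lambda>z. E (snd z))"
  by (rule Ck_on_compose_real[OF assms(1)] Ck_on_compose_real[OF assms(2)]; auto intro: Ck_on_snd)+

lemma Ck_on_sol:
  assumes "Ck_on k {0..<T} m" "Ck_on k {0..<T} E" "\<And>t. t \<in> {0..<T} \<Longrightarrow> E t \<ge> 0"
  shows "Ck_on k (quadrant \<times> {0..<T}) (\<lambda>((x1, x2), t). sol_omega m E x1 x2 t)"
    "Ck_on k (quadrant \<times> {0..<T}) (\<lambda>((x1, x2), t). sol_rho m E x1 x2 t)"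
proof -
  note scale = Ck_on_scale_factors[OF assms(1,2)]
  have 1: "Ck_on k (quadrant \<times> {0..<T}) (\<lambda>z. fst (fst z) * m (snd z))"
    by (rule Ck_on_mult[OF Ck_on_fst_fst scale(1)])
  show "Ck_on k (quadrant \<times> {0..<T}) (\<lambda>((x1, x2), t). sol_omega m E x1 x2 t)"
    unfolding sol_omega_def case_prod_unfold
    by (rule Ck_on_scaled_vorticity_compose[OF 1 Ck_on_snd_fst scale(2)]) (use assms(3) in auto)
  show "Ck_on k (quadrant \<times> {0..<T}) (\<lambda>((x1, x2), t). sol_rho m E x1 x2 t)"
    unfolding sol_rho_def case_prod_unfold
    by (rule Ck_on_scaled_density_compose[OF 1 Ck_on_snd_fst scale(2)]) (use assms(3) in auto)
qed

text \<open>
  The substitution \<open>a = m x\<^sub>1\<close>, \<open>s = E\<close> turns the physical transport field into \<open>m\<close> times the transport field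
  \<open>\<partial>\<^sub>s + y s bump \<partial>\<^sub>a\<close>: the contribution \<open>x\<^sub>1 m'\<close> of the moving scale to \<open>da/dt\<close>
  cancels that of the linear part \<open>- c x\<^sub>1\<close> of the velocity.
\<close>

lemma transport_pullback:
  assumes m: "\<And>t. t \<in> {0..<T} \<Longrightarrow> (m has_real_derivative m t * c t) (at t within {0..<T})"
    and E: "\<And>t. t \<in> {0..<T} \<Longrightarrow> (E has_real_derivative m t) (at t within {0..<T})"
    and E_nonneg: "\<And>t. t \<in> {0..<T} \<Longrightarrow> E t \<ge> 0"
    and Ckf: "Ck_on (Suc 0) scaled_domain (\<lambda>((a, y), s). f a y s)"
    and Ckp: "Ck_on (Suc 0) (quadrant \<times> {0..<T}) (\<lambda>((x1, x2), t). f (x1 * m t) x2 (E t))"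
    and t: "t \<in> {0..<T}" and x: "x1 > 0" "x2 \<ge> 0"
    and u: "u = - x1 * c t + x2 * (E t * bump (x1 * m t))"
    and r: "\<And>f'. ((\<lambda>((a, y), s). f a y s) has_derivative f') (at ((x1 * m t, x2), E t) within scaled_domain) \<Longrightarrow>
        f' ((x2 * E t * bump (x1 * m t), 0), 1) = r"
  shows "partial_t T (\<lambda>x1 x2 t. f (x1 * m t) x2 (E t)) x1 x2 t +
     u * partial_x1 (\<lambda>x1 x2 t. f (x1 * m t) x2 (E t)) x1 x2 t = m t * r"
proof -
  \<comment> \<open>a curve with velocity \<open>u\<close> at time \<open>t\<close> that stays in \<open>x\<^sub>1 > 0\<close>\<close>
  define v where "v \<sigma> = x1 * exp (u / x1 * (\<sigma> - t))" for \<sigma>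
  have vt: "v t = x1" by (simp add: v_def)
  have v: "(v has_real_derivative u) (at t within {0..<T})"
    unfolding v_def using x by (auto intro!: derivative_eq_intros)
  have d1: "((\<lambda>\<sigma>. (\<lambda>x1 x2 t. f (x1 * m t) x2 (E t)) (v \<sigma>) x2 \<sigma>) has_real_derivative
      partial_t T (\<lambda>x1 x2 t. f (x1 * m t) x2 (E t)) (v t) x2 t +
      u * partial_x1 (\<lambda>x1 x2 t. f (x1 * m t) x2 (E t)) (v t) x2 t) (at t within {0..<T})"
    by (rule DERIV_along_path[OF Ckp v]) (use t x in \<open>auto simp: v_def\<close>)
  have d2: "((\<lambda>\<sigma>. f (v \<sigma> * m \<sigma>) x2 (E \<sigma>)) has_real_derivative m t * r) (at t within {0..<T})"
  proof -
    have "((x1 * m t, x2), E t) \<in> scaled_domain" using E_nonneg[OF t] x by auto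
    with Ckf[unfolded Ck_on.simps(2)] obtain f' where
      f': "((\<lambda>((a, y), s). f a y s) has_derivative f') (at ((x1 * m t, x2), E t) within scaled_domain)"
      by blast
    have "((\<lambda>\<sigma>. v \<sigma> * m \<sigma>) has_real_derivative u * m t + x1 * (m t * c t)) (at t within {0..<T})"
      using v m[OF t] by (auto intro!: derivative_eq_intros simp: vt)
    moreover have "u * m t + x1 * (m t * c t) = m t * (x2 * E t * bump (x1 * m t))"
      unfolding u by algebra
    ultimately have "((\<lambda>\<sigma>. (\<lambda>((a, y), s). f a y s) ((v \<sigma> * m \<sigma>, x2), E \<sigma>)) has_real_derivative
        f' ((m t * (x2 * E t * bump (x1 * m t)), 0), m t)) (at t within {0..<T})"
      by (intro DERIV_along_curve[where D=scaled_domain] E[OF t]) (use f' E_nonneg x in \<open>auto simp: vt\<close>)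
    moreover have "f' ((m t * (x2 * E t * bump (x1 * m t)), 0), m t) = m t * r"
    proof -
      have lin: "linear f'" using f' has_derivative_linear by blast
      have "f' (m t *\<^sub>R ((x2 * E t * bump (x1 * m t), 0), 1)) = m t *\<^sub>R f' ((x2 * E t * bump (x1 * m t), 0), 1)"
        by (rule linear_scale[OF lin])
      then show ?thesis using r[OF f'] by simp
    qed
    ultimately show ?thesis by simp
  qed
  have nb: "at t within {0..<T} \<noteq> bot"
    using t by (intro at_within_convex_neq_bot[of _ t "if t = 0 then T / 2 else 0"]) auto
  from has_field_derivative_unique[OF d1 d2 nb] show ?thesis by (simp only: vt)
qed

lemma sol_pde:
  assumes m: "\<And>t. t \<in> {0..<T} \<Longrightarrow> (m has_real_derivative m t * c t) (at t within {0..<T})"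
    and E: "\<And>t. t \<in> {0..<T} \<Longrightarrow> (E has_real_derivative m t) (at t within {0..<T})"
    and E_nonneg: "\<And>t. t \<in> {0..<T} \<Longrightarrow> E t \<ge> 0"
    and m_pos: "\<And>t. t \<in> {0..<T} \<Longrightarrow> m t > 0"
    and Ck: "Ck_on (Suc 0) {0..<T} m" "Ck_on (Suc 0) {0..<T} E"
    and t: "t \<in> {0..<T}" and x: "x1 > 0" "x2 \<ge> 0"
    and u: "u = - x1 * c t + x2 * (E t * bump (x1 * m t))"
  shows "partial_t T (sol_omega m E) x1 x2 t + u * partial_x1 (sol_omega m E) x1 x2 t = sol_rho m E x1 x2 t / x1"
    and "partial_t T (sol_rho m E) x1 x2 t + u * partial_x1 (sol_rho m E) x1 x2 t = 0"
proof -
  have "partial_t T (\<lambda>x1 x2 t. scaled_vorticity (x1 * m t) x2 (E t)) x1 x2 t +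
     u * partial_x1 (\<lambda>x1 x2 t. scaled_vorticity (x1 * m t) x2 (E t)) x1 x2 t =
     m t * (scaled_density (x1 * m t) x2 (E t) / (x1 * m t))"
  proof (rule transport_pullback[where f=scaled_vorticity and c=c and m=m and E=E])
    show "Ck_on (Suc 0) (quadrant \<times> {0..<T}) (\<lambda>((x1, x2), t). scaled_vorticity (x1 * m t) x2 (E t))"
      using Ck_on_sol(1)[OF Ck E_nonneg] by (simp add: sol_omega_def)
    show "f' ((x2 * E t * bump (x1 * m t), 0), 1) = scaled_density (x1 * m t) x2 (E t) / (x1 * m t)"
      if "((\<lambda>((a, y), s). scaled_vorticity a y s) has_derivative f') (at ((x1 * m t, x2), E t) within scaled_domain)" for f'
      using scaled_vorticity_transport[OF x(2) E_nonneg[OF t] that] .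
  qed (fact m E E_nonneg Ck_on_scaled_vorticity t x u)+
  also have "\<dots> = sol_rho m E x1 x2 t / x1" using m_pos[OF t] by (simp add: sol_rho_def)
  finally show "partial_t T (sol_omega m E) x1 x2 t + u * partial_x1 (sol_omega m E) x1 x2 t = sol_rho m E x1 x2 t / x1"
    by (simp add: sol_omega_def[abs_def])
  have "partial_t T (\<lambda>x1 x2 t. scaled_density (x1 * m t) x2 (E t)) x1 x2 t +
     u * partial_x1 (\<lambda>x1 x2 t. scaled_density (x1 * m t) x2 (E t)) x1 x2 t = m t * 0"
  proof (rule transport_pullback[where f=scaled_density and c=c and m=m and E=E])
    show "Ck_on (Suc 0) (quadrant \<times> {0..<T}) (\<lambda>((x1, x2), t). scaled_density (x1 * m t) x2 (E t))"
      using Ck_on_sol(2)[OF Ck E_nonneg] by (simp add: sol_rho_def)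
    show "f' ((x2 * E t * bump (x1 * m t), 0), 1) = 0"
      if "((\<lambda>((a, y), s). scaled_density a y s) has_derivative f') (at ((x1 * m t, x2), E t) within scaled_domain)" for f'
      using scaled_density_transport[OF x(2) E_nonneg[OF t] that] .
  qed (fact m E E_nonneg Ck_on_scaled_density t x u)+
  then show "partial_t T (sol_rho m E) x1 x2 t + u * partial_x1 (sol_rho m E) x1 x2 t = 0"
    by (simp add: sol_rho_def[abs_def])
qed

text \<open>
  The comparison along characteristics takes place in \<open>x\<^sub>1 > 0\<close>, and the kernel vanishes on the axis. The area element
  of the stretch \<open>a = m y\<^sub>1\<close> turns the integral over the quadrant into that over the fixed box of the profile.
\<close>

lemma velocity_integral:
  assumes m: "m > 0" and s: "s \<ge> 0"
    and \<omega>: "\<And>x1 x2. x1 > 0 \<Longrightarrow> x2 \<ge> 0 \<Longrightarrow> \<omega> x1 x2 t = scaled_vorticity (x1 * m) x2 s"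
  shows "set_integrable lborel quadrant (kernel_integrand \<omega> t)"
    and "(LINT y:quadrant|lborel. kernel_integrand \<omega> t y) = strain m s"
proof -
  define B where "B = cbox (1 / m, 0) (width / m, width)"
  have B_eq: "B = {1 / m..width / m} \<times> {0..width}" by (simp add: B_def cbox_Pair_eq)
  define k where "k z = fst z * snd z * scaled_vorticity (fst z * m) (snd z) s / ((fst z)\<^sup>2 + (snd z)\<^sup>2)\<^sup>2" for z
  have pos: "(fst z)\<^sup>2 + (snd z)\<^sup>2 > 0" if "z \<in> B" for z
  proof -
    have "fst z \<ge> 1 / m" using that by (auto simp: B_eq)
    moreover have "1 / m > 0" using m by simp
    ultimately show ?thesis by (intro add_pos_nonneg) auto
  qed
  have contk: "continuous_on B k" unfolding k_def
  proof (rule Ck_on_imp_continuous_on[of 0], intro Ck_intros Ck_on_scaled_vorticity_compose)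
    show "((fst z)\<^sup>2 + (snd z)\<^sup>2)\<^sup>2 \<noteq> 0" if "z \<in> B" for z using pos[OF that] by (intro power_not_zero) linarith
  qed (use s in \<open>auto simp: B_eq\<close>)
  have eq: "indicator quadrant z *\<^sub>R kernel_integrand \<omega> t z = indicator B z *\<^sub>R k z" for z
  proof (cases "z \<in> quadrant")
    case True
    then obtain y1 y2 where z: "z = (y1, y2)" "y1 \<ge> 0" "y2 \<ge> 0" by auto
    have "kernel_integrand \<omega> t z = k z"
      using z \<omega>[of y1 y2] by (cases "y1 = 0") (auto simp: kernel_integrand_def k_def)
    moreover have "k z = 0" if "z \<notin> B"
    proof -
      have "y1 * m \<le> 1 \<or> y1 * m \<ge> width \<or> y2 \<ge> width"
        using that z m by (auto simp: B_eq field_simps)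
      then have "scaled_vorticity (y1 * m) y2 s = 0" using z by (intro scaled_vorticity_eq_0)
      then show ?thesis by (simp add: k_def z)
    qed
    ultimately show ?thesis using True by (auto simp: indicator_def)
  next
    case False
    have "B \<subseteq> quadrant" using m by (auto simp: B_eq intro: order_trans[of 0 "1 / m"])
    with False show ?thesis by (auto simp: indicator_def)
  qed
  have int: "set_integrable lborel B k"
    unfolding set_integrable_def using contk
    by (intro borel_integrable_compact) (auto simp: B_def)
  then show "set_integrable lborel quadrant (kernel_integrand \<omega> t)"
    unfolding set_integrable_def eq .
  \<comment> \<open>the change of variables \<open>a = m y\<^sub>1\<close> as a diagonal stretch\<close>
  define \<mu> where "\<mu> b = (if b = (1, 0) then m else 1)" for b :: "real \<times> real"
  have basis: "(\<Sum>b\<in>Basis. g b) = g (1, 0) + g (0, 1)" for g :: "real \<times> real \<Rightarrow> real \<times> real"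
    by (simp add: Basis_prod_def)
  have basis_prod: "prod \<mu> Basis = m"
    by (simp add: Basis_prod_def \<mu>_def)
  have "((\<lambda>(a, y). strain_kernel m a y * scaled_vorticity a y s) has_integral strain m s) scaled_box"
    unfolding strain_def by (intro integrable_integral integrable_continuous cont_strain_integrand s)
  from has_integral_stretch[OF this, of \<mu>] m
  have "((\<lambda>z. strain_kernel m (m * fst z) (snd z) * scaled_vorticity (m * fst z) (snd z) s) has_integral (1 / m) * strain m s)
      ((\<lambda>z. (1 / m * fst z, snd z)) ` scaled_box)"
    by (simp add: basis basis_prod case_prod_unfold) (simp add: \<mu>_def zero_prod_def inner_prod_def)
  moreover have "(\<lambda>z. (1 / m * fst z, snd z)) ` scaled_box = B"
  proof -
    have "(\<lambda>z. (1 / m * fst z, snd z)) ` ({1..width} \<times> {0..width}) = ((*) (1 / m) ` {1..width}) \<times> {0..width}"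
      by force
    also have "(*) (1 / m) ` {1..width} = {1 / m..width / m}"
      using m width_ge by (subst image_mult_atLeastAtMost) auto
    finally show ?thesis by (simp add: scaled_box_eq B_eq)
  qed
  ultimately have "((\<lambda>z. strain_kernel m (m * fst z) (snd z) * scaled_vorticity (m * fst z) (snd z) s) has_integral (1 / m) * strain m s) B"
    by simp
  then have "((\<lambda>z. m * (strain_kernel m (m * fst z) (snd z) * scaled_vorticity (m * fst z) (snd z) s)) has_integral m * ((1 / m) * strain m s)) B"
    by (rule has_integral_mult_right)
  moreover have "m * (strain_kernel m (m * fst z) (snd z) * scaled_vorticity (m * fst z) (snd z) s) = k z" if "z \<in> B" for z
  proof -
    have "m * strain_kernel m (m * fst z) (snd z) = fst z * snd z / ((fst z)\<^sup>2 + (snd z)\<^sup>2)\<^sup>2"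
    proof -
      have "(m * fst z)\<^sup>2 + m\<^sup>2 * (snd z)\<^sup>2 = m\<^sup>2 * ((fst z)\<^sup>2 + (snd z)\<^sup>2)" by algebra
      then show ?thesis using m pos[OF that]
        by (simp add: strain_kernel_def power_mult_distrib power2_eq_square)
    qed
    then show ?thesis by (simp add: k_def mult_ac flip: mult.assoc)
  qed
  ultimately have "(k has_integral strain m s) B"
    using m has_integral_cong[of B "\<lambda>z. m * (strain_kernel m (m * fst z) (snd z) * scaled_vorticity (m * fst z) (snd z) s)" k]
    by simp
  then show "(LINT y:quadrant|lborel. kernel_integrand \<omega> t y) = strain m s"
    using set_borel_integral_eq_integral(2)[OF int] unfolding set_lebesgue_integral_def eq
    by (simp add: integral_unique)
qed

section \<open>Every smooth solution is given by the profile\<close>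

lemma \<beta>_pos: assumes "a > 0" "s \<ge> 0" shows "\<beta> a s > 0"
proof (cases "a \<ge> 1")
  case True
  then show ?thesis using \<beta>_ge_1[of a s] assms by simp
next
  case False
  then show ?thesis using \<beta>_fixed[of a s] bump_eq_0[of a] assms by simp
qed

text \<open>
  The particle that is at \<open>A / m t1\<close> at time \<open>t1\<close>, followed backwards in time, solves the particle equation with the
  velocity that the profile prescribes.
\<close>

lemma characteristic_derivative:
  assumes m: "\<And>t. t \<in> {0..<T} \<Longrightarrow> (m has_real_derivative m t * c t) (at t within {0..<T})"
    and E: "\<And>t. t \<in> {0..<T} \<Longrightarrow> (E has_real_derivative m t) (at t within {0..<T})"
    and E_mono: "\<And>s t. 0 \<le> s \<Longrightarrow> s \<le> t \<Longrightarrow> t < T \<Longrightarrow> E s \<le> E t" and "E 0 = 0"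
    and m_pos: "\<And>t. t \<in> {0..<T} \<Longrightarrow> m t > 0"
    and t: "t \<in> {0..t1}" "t1 < T" and x2: "x2 \<ge> 0"
    and \<gamma>: "\<And>t. \<gamma> t = \<beta> A (x2 * ((E t1)\<^sup>2 - (E t)\<^sup>2) / 2) / m t"
  shows "(\<gamma> has_real_derivative - \<gamma> t * c t + x2 * (E t * bump (\<gamma> t * m t))) (at t within {0..t1})"
proof -
  have tT: "t \<in> {0..<T}" using t by auto
  have m0: "m t \<noteq> 0" using m_pos[OF tT] by simp
  define b where "b t = \<beta> A (x2 * ((E t1)\<^sup>2 - (E t)\<^sup>2) / 2)" for t
  have E_range: "E ` {0..t1} \<subseteq> {0..E t1}"
    using E_mono[of 0] E_mono[of _ t1] \<open>E 0 = 0\<close> t by auto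
  have "E t \<in> {0..E t1}" using E_range t(1) by blast
  then have Et: "0 \<le> E t" "E t \<le> E t1" by auto
  have sub: "{0..t1} \<subseteq> {0..<T}" using t by auto
  have "(b has_real_derivative x2 * E t * bump (b t) * m t) (at t within {0..t1})"
    unfolding b_def
    by (rule DERIV_chain_within[OF \<beta>_along_characteristic[OF x2 Et] DERIV_subset[OF E[OF tT] sub] E_range])
  from DERIV_quotient[OF this DERIV_subset[OF m[OF tT] sub] m0]
  have "((\<lambda>t. b t / m t) has_real_derivative
      (x2 * E t * bump (b t) * m t * m t - m t * c t * b t) / (m t)\<^sup>2) (at t within {0..t1})"
    by (simp add: numeral_2_eq_2)
  moreover have "(x2 * E t * bump (b t) * m t * m t - m t * c t * b t) / (m t)\<^sup>2 =
      - (b t / m t) * c t + x2 * (E t * bump (b t / m t * m t))"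
    using m0 by (simp add: field_simps power2_eq_square)
  ultimately show ?thesis by (simp add: \<gamma>[abs_def] b_def)
qed

text \<open>
  Both the given solution and the profile are transported with the same velocity along the same characteristics and
  start from the same data, so their difference is constant along characteristics and vanishes. The
  heights \<open>x\<^sub>2\<close> do not interact once the velocity is known; the lemma serves for the boundary \<open>x\<^sub>2 = 0\<close>, where the
  velocity is linear in \<open>x\<^sub>1\<close>, and afterwards for every height.
\<close>

lemma solution_on_slice:
  assumes sol: "smooth_solution T (\<lambda>_ _. 0) density0 \<omega> \<rho>"
    and m: "\<And>t. t \<in> {0..<T} \<Longrightarrow> (m has_real_derivative m t * c t) (at t within {0..<T})"
    and E: "\<And>t. t \<in> {0..<T} \<Longrightarrow> (E has_real_derivative m t) (at t within {0..<T})"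
    and E_mono: "\<And>s t. 0 \<le> s \<Longrightarrow> s \<le> t \<Longrightarrow> t < T \<Longrightarrow> E s \<le> E t" and E0: "E 0 = 0" and m_0: "m 0 = 1"
    and m_pos: "\<And>t. t \<in> {0..<T} \<Longrightarrow> m t > 0"
    and Ck: "Ck_on (Suc 0) {0..<T} m" "Ck_on (Suc 0) {0..<T} E"
    and x2: "x2 \<ge> 0"
    and vel: "\<And>x1 t. x1 > 0 \<Longrightarrow> t \<in> {0..<T} \<Longrightarrow> velocity \<omega> x1 x2 t = - x1 * c t + x2 * (E t * bump (x1 * m t))"
    and x1: "x1 > 0" and t1: "t1 \<in> {0..<T}"
  shows "\<rho> x1 x2 t1 = sol_rho m E x1 x2 t1" "\<omega> x1 x2 t1 = sol_omega m E x1 x2 t1"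
proof -
  have E_nonneg: "E t \<ge> 0" if "t \<in> {0..<T}" for t using E_mono[of 0 t] that E0 by auto
  have Ck\<omega>: "Ck_on (Suc 0) (quadrant \<times> {0..<T}) (\<lambda>((x1, x2), t). \<omega> x1 x2 t)"
    and Ck\<rho>: "Ck_on (Suc 0) (quadrant \<times> {0..<T}) (\<lambda>((x1, x2), t). \<rho> x1 x2 t)"
    using sol unfolding smooth_solution_def smooth_on_def by blast+
  note Cksol = Ck_on_sol[OF Ck E_nonneg]
  have pde: "partial_t T \<omega> x1 x2 t + velocity \<omega> x1 x2 t * partial_x1 \<omega> x1 x2 t = \<rho> x1 x2 t / x1"
      "partial_t T \<rho> x1 x2 t + velocity \<omega> x1 x2 t * partial_x1 \<rho> x1 x2 t = 0"
    if "x1 > 0" "t \<in> {0..<T}" for x1 t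
    using sol that x2 unfolding smooth_solution_def by blast+
  have pde_sol: "partial_t T (sol_omega m E) x1 x2 t + velocity \<omega> x1 x2 t * partial_x1 (sol_omega m E) x1 x2 t =
        sol_rho m E x1 x2 t / x1"
      "partial_t T (sol_rho m E) x1 x2 t + velocity \<omega> x1 x2 t * partial_x1 (sol_rho m E) x1 x2 t = 0"
    if "x1 > 0" "t \<in> {0..<T}" for x1 t
    by (rule sol_pde[where c=c]; fact m E E_nonneg m_pos Ck that x2 vel[OF that])+
  have along: "\<exists>\<gamma>. \<gamma> t1 = x1 \<and> (\<forall>t\<in>{0..t1}. \<gamma> t > 0 \<and>
      (\<gamma> has_real_derivative velocity \<omega> (\<gamma> t) x2 t) (at t within {0..t1}))"
    if x1: "x1 > 0" and t1: "t1 \<in> {0..<T}" for x1 t1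
  proof -
    define \<gamma> where "\<gamma> t = \<beta> (x1 * m t1) (x2 * ((E t1)\<^sup>2 - (E t)\<^sup>2) / 2) / m t" for t
    have pos: "\<gamma> t > 0" if "t \<in> {0..t1}" for t
    proof -
      have "E t \<le> E t1" "0 \<le> E t" using E_mono[of t t1] E_nonneg[of t] that t1 by auto
      then have "x2 * ((E t1)\<^sup>2 - (E t)\<^sup>2) / 2 \<ge> 0" using x2 by (auto intro: power_mono)
      then show ?thesis unfolding \<gamma>_def using x1 m_pos t1 that by (intro divide_pos_pos \<beta>_pos) auto
    qed
    moreover have "(\<gamma> has_real_derivative velocity \<omega> (\<gamma> t) x2 t) (at t within {0..t1})" if "t \<in> {0..t1}" for t
    proof -
      have "velocity \<omega> (\<gamma> t) x2 t = - \<gamma> t * c t + x2 * (E t * bump (\<gamma> t * m t))"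
        using that t1 by (intro vel pos) auto
      then show ?thesis
        using characteristic_derivative[OF m E E_mono E0 m_pos that _ x2 \<gamma>_def] t1 by simp
    qed
    moreover have "\<gamma> t1 = x1" using m_pos[OF t1] by (simp add: \<gamma>_def \<beta>_0)
    ultimately show ?thesis by blast
  qed
  have \<rho>_eq: "\<rho> x1 x2 t1 = sol_rho m E x1 x2 t1" if x1: "x1 > 0" and t1: "t1 \<in> {0..<T}" for x1 t1
  proof -
    obtain \<gamma> where \<gamma>: "\<gamma> t1 = x1" "\<And>t. t \<in> {0..t1} \<Longrightarrow> \<gamma> t > 0"
      "\<And>t. t \<in> {0..t1} \<Longrightarrow> (\<gamma> has_real_derivative velocity \<omega> (\<gamma> t) x2 t) (at t within {0..t1})"
      using along[OF x1 t1] by blast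
    have "\<rho> (\<gamma> t1) x2 t1 - sol_rho m E (\<gamma> t1) x2 t1 = \<rho> (\<gamma> 0) x2 0 - sol_rho m E (\<gamma> 0) x2 0"
    proof (rule zero_derivative_imp_eq)
      fix t assume t: "t \<in> {0..t1}"
      then have tT: "t \<in> {0..<T}" and sub: "{0..t1} \<subseteq> {0..<T}" using t1 by auto
      have "partial_t T (sol_rho m E) (\<gamma> t) x2 t + velocity \<omega> (\<gamma> t) x2 t * partial_x1 (sol_rho m E) (\<gamma> t) x2 t = 0"
        by (rule pde_sol(2)[OF \<gamma>(2)[OF t] tT])
      with DERIV_diff[OF DERIV_along_path[OF Ck\<rho> \<gamma>(3)[OF t] t sub \<gamma>(2) x2]
          DERIV_along_path[OF Cksol(2) \<gamma>(3)[OF t] t sub \<gamma>(2) x2]]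
      show "((\<lambda>t. \<rho> (\<gamma> t) x2 t - sol_rho m E (\<gamma> t) x2 t) has_real_derivative 0) (at t within {0..t1})"
        by (simp add: pde(2)[OF \<gamma>(2)[OF t] tT])
    qed (use t1 in auto)
    also have "\<dots> = 0"
    proof -
      have "\<gamma> 0 \<ge> 0" using \<gamma>(2)[of 0] t1 by auto
      then have "\<rho> (\<gamma> 0) x2 0 = density0 (\<gamma> 0) x2" using sol x2 unfolding smooth_solution_def by blast
      then show ?thesis by (simp add: sol_rho_def m_0 E0 scaled_density_def \<beta>_0)
    qed
    finally show ?thesis using \<gamma>(1) by simp
  qed
  show "\<rho> x1 x2 t1 = sol_rho m E x1 x2 t1" by (rule \<rho>_eq[OF x1 t1])
  obtain \<gamma> where \<gamma>: "\<gamma> t1 = x1" "\<And>t. t \<in> {0..t1} \<Longrightarrow> \<gamma> t > 0"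
    "\<And>t. t \<in> {0..t1} \<Longrightarrow> (\<gamma> has_real_derivative velocity \<omega> (\<gamma> t) x2 t) (at t within {0..t1})"
    using along[OF x1 t1] by blast
  have "\<omega> (\<gamma> t1) x2 t1 - sol_omega m E (\<gamma> t1) x2 t1 = \<omega> (\<gamma> 0) x2 0 - sol_omega m E (\<gamma> 0) x2 0"
  proof (rule zero_derivative_imp_eq)
    fix t assume t: "t \<in> {0..t1}"
    then have tT: "t \<in> {0..<T}" and sub: "{0..t1} \<subseteq> {0..<T}" using t1 by auto
    have "partial_t T (sol_omega m E) (\<gamma> t) x2 t + velocity \<omega> (\<gamma> t) x2 t * partial_x1 (sol_omega m E) (\<gamma> t) x2 t =
        sol_rho m E (\<gamma> t) x2 t / \<gamma> t"
      by (rule pde_sol(1)[OF \<gamma>(2)[OF t] tT])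
    with DERIV_diff[OF DERIV_along_path[OF Ck\<omega> \<gamma>(3)[OF t] t sub \<gamma>(2) x2]
        DERIV_along_path[OF Cksol(1) \<gamma>(3)[OF t] t sub \<gamma>(2) x2]]
    show "((\<lambda>t. \<omega> (\<gamma> t) x2 t - sol_omega m E (\<gamma> t) x2 t) has_real_derivative 0) (at t within {0..t1})"
      by (simp add: pde(1)[OF \<gamma>(2)[OF t] tT] \<rho>_eq[OF \<gamma>(2)[OF t] tT])
  qed (use t1 in auto)
  also have "\<dots> = 0"
  proof -
    have "\<gamma> 0 \<ge> 0" using \<gamma>(2)[of 0] t1 by auto
    then have "\<omega> (\<gamma> 0) x2 0 = 0" using sol x2 unfolding smooth_solution_def by blast
    then show ?thesis by (simp add: sol_omega_def E0 scaled_vorticity_def)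
  qed
  finally show "\<omega> x1 x2 t1 = sol_omega m E x1 x2 t1" using \<gamma>(1) by simp
qed

lemma eq_on_boundary_axis:
  fixes f g :: "real \<Rightarrow> real \<Rightarrow> real \<Rightarrow> real"
  assumes f: "continuous_on (quadrant \<times> {0..<T}) (\<lambda>((x1, x2), t). f x1 x2 t)"
    and g: "continuous_on (quadrant \<times> {0..<T}) (\<lambda>((x1, x2), t). g x1 x2 t)"
    and eq: "\<And>x1. x1 > 0 \<Longrightarrow> f x1 x2 t = g x1 x2 t"
    and x: "x1 \<ge> 0" "x2 \<ge> 0" and t: "t \<in> {0..<T}"
  shows "f x1 x2 t = g x1 x2 t"
proof -
  have path: "continuous_on {0..} (\<lambda>x1. ((x1, x2), t))" "(\<lambda>x1. ((x1, x2), t)) ` {0..} \<subseteq> quadrant \<times> {0..<T}"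
    using x t by (auto intro!: continuous_intros)
  have "continuous_on (closure {0<..}) (\<lambda>x1. f x1 x2 t - g x1 x2 t)"
    using continuous_on_diff[OF continuous_on_compose2[OF f path] continuous_on_compose2[OF g path]]
    by simp
  then have "f x1 x2 t - g x1 x2 t = 0"
    by (rule continuous_constant_on_closure) (use eq x in auto)
  then show ?thesis by simp
qed

text \<open>
  The factor \<open>m\<close> is built from the solution itself, so that the slice \<open>x\<^sub>2 = 0\<close> can be solved first. The vorticity
  found there determines the velocity at every height. Integrating the profile identifies \<open>c\<close> with the
  strain, which closes the equation for \<open>m\<close>.
\<close>

theorem solution_representation:
  assumes sol: "smooth_solution T (\<lambda>_ _. 0) density0 \<omega> \<rho>"
  obtains m E where "m 0 = 1" "E 0 = 0" "\<And>t. t \<in> {0..<T} \<Longrightarrow> m t > 0" "\<And>t. t \<in> {0..<T} \<Longrightarrow> E t \<ge> 0"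
    "\<And>t. t \<in> {0..<T} \<Longrightarrow> (m has_real_derivative m t * strain (m t) (E t)) (at t within {0..<T})"
    "\<And>t. t \<in> {0..<T} \<Longrightarrow> (E has_real_derivative m t) (at t within {0..<T})"
    "\<And>x1 x2 t. x1 \<ge> 0 \<Longrightarrow> x2 \<ge> 0 \<Longrightarrow> t \<in> {0..<T} \<Longrightarrow>
       \<omega> x1 x2 t = sol_omega m E x1 x2 t \<and> \<rho> x1 x2 t = sol_rho m E x1 x2 t"
proof -
  define c where "c t = (LINT y:quadrant|lborel. kernel_integrand \<omega> t y)" for t
  have velc: "velocity \<omega> x1 x2 t = - x1 * c t + x2 * \<omega> x1 0 t" for x1 x2 t by (simp add: velocity_def c_def)
  have contv: "continuous_on (quadrant \<times> {0..<T}) (\<lambda>((x1, x2), t). velocity \<omega> x1 x2 t)"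
    using sol unfolding smooth_solution_def by blast
  have contc: "continuous_on {0..<T} c"
  proof -
    have path: "continuous_on {0..<T} (\<lambda>t. ((1::real, 0::real), t))"
      "(\<lambda>t. ((1, 0), t)) ` {0..<T} \<subseteq> quadrant \<times> {0..<T}"
      by (auto intro!: continuous_intros)
    from continuous_on_minus[OF continuous_on_compose2[OF contv path]] show ?thesis by (simp add: velc)
  qed
  define m where "m t = exp (integral {0..t} c)" for t
  have m_der: "(m has_real_derivative m t * c t) (at t within {0..<T})" if "t \<in> {0..<T}" for t
    unfolding m_def by (rule DERIV_chain2[OF DERIV_exp integral_has_real_derivative_lessThan[OF contc that]])
  have contm: "continuous_on {0..<T} m" by (rule DERIV_continuous_on[OF m_der])
  define E where "E t = integral {0..t} m" for t
  have E_der: "(E has_real_derivative m t) (at t within {0..<T})" if "t \<in> {0..<T}" for t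
    unfolding E_def by (rule integral_has_real_derivative_lessThan[OF contm that])
  have m_pos: "m t > 0" for t by (simp add: m_def)
  have m_0: "m 0 = 1" and E_0: "E 0 = 0" by (simp_all add: m_def E_def)
  have E_mono: "E s \<le> E t" if "0 \<le> s" "s \<le> t" "t < T" for s t
    unfolding E_def using that m_pos
    by (intro integral_subset_le integrable_continuous_interval continuous_on_subset[OF contm])
      (auto intro: less_imp_le)
  have E_nonneg: "E t \<ge> 0" if "t \<in> {0..<T}" for t using E_mono[of 0 t] E_0 that by auto
  have Ck0m: "Ck_on 0 {0..<T} m" using contm by simp
  have Ck0c: "Ck_on 0 {0..<T} c" using contc by simp
  have Ckm: "Ck_on (Suc 0) {0..<T} m" by (rule Ck_on_SucI_real[OF m_der Ck_on_mult[OF Ck0m Ck0c]])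
  have CkE: "Ck_on (Suc 0) {0..<T} E" by (rule Ck_on_SucI_real[OF E_der Ck0m])
  note slice = solution_on_slice[OF sol m_der E_der E_mono E_0 m_0 m_pos Ckm CkE]
  have \<omega>_bdry: "\<omega> x1 0 t = E t * bump (x1 * m t)" if "x1 > 0" "t \<in> {0..<T}" for x1 t
  proof -
    have "\<omega> x1 0 t = sol_omega m E x1 0 t"
      by (rule slice(2)) (use that in \<open>auto simp: velc\<close>)
    then show ?thesis using scaled_vorticity_boundary[OF E_nonneg[OF that(2)]] by (simp add: sol_omega_def)
  qed
  have eq_pos: "\<omega> x1 x2 t = sol_omega m E x1 x2 t" "\<rho> x1 x2 t = sol_rho m E x1 x2 t"
    if "x1 > 0" "x2 \<ge> 0" "t \<in> {0..<T}" for x1 x2 t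
    by (rule slice; use that \<omega>_bdry in \<open>simp add: velc\<close>)+
  have "continuous_on (quadrant \<times> {0..<T}) (\<lambda>((x1, x2), t). \<omega> x1 x2 t)"
    "continuous_on (quadrant \<times> {0..<T}) (\<lambda>((x1, x2), t). \<rho> x1 x2 t)"
    using sol unfolding smooth_solution_def smooth_on_def by (meson Ck_on_imp_continuous_on)+
  note cont = this Ck_on_sol[OF Ckm CkE E_nonneg, THEN Ck_on_imp_continuous_on]
  have eq: "\<omega> x1 x2 t = sol_omega m E x1 x2 t \<and> \<rho> x1 x2 t = sol_rho m E x1 x2 t"
    if "x1 \<ge> 0" "x2 \<ge> 0" "t \<in> {0..<T}" for x1 x2 t
    using eq_on_boundary_axis[OF cont(1,3) eq_pos(1) that] eq_on_boundary_axis[OF cont(2,4) eq_pos(2) that] that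
    by simp
  have c_eq: "c t = strain (m t) (E t)" if "t \<in> {0..<T}" for t
    unfolding c_def
    by (rule velocity_integral(2)[OF m_pos E_nonneg[OF that]]) (use eq_pos(1) that in \<open>simp add: sol_omega_def\<close>)
  show ?thesis
    by (rule that[of m E]) (use m_0 E_0 m_pos E_nonneg m_der E_der c_eq eq in auto)
qed

section \<open>Physical time and blow-up\<close>

lemma Ck_on_strain_compose:
  "Ck_on k S u \<Longrightarrow> Ck_on k S v \<Longrightarrow> (\<And>x. x \<in> S \<Longrightarrow> v x \<ge> 0) \<Longrightarrow> Ck_on k S (\<lambda>x. strain (u x) (v x))"
  by (rule Ck_on_compose_pair[OF Ck_on_strain]) auto

theorem scale_exists:
  obtains M where "M 0 = 1" "\<And>s. s \<ge> 0 \<Longrightarrow> (M has_real_derivative strain (M s) s) (at s within {0..})"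
proof -
  have "continuous_on ({0..} \<times> UNIV) (\<lambda>z. strain (snd z) (fst z))"
    by (rule Ck_on_imp_continuous_on[OF Ck_on_strain_compose[OF Ck_on_snd Ck_on_fst, of _ 0]]) auto
  then have "continuous_on ({0..} \<times> UNIV) (\<lambda>(s, x). strain x s)" by (simp add: case_prod_unfold)
  from picard_lindelof_global[OF this cont_strain_lipschitz strain_lipschitz_nonneg strain_is_lipschitz]
  show ?thesis using that by blast
qed

end

text \<open>
  The compression as a function \<open>M\<close> of the intrinsic time.
\<close>

locale scale_flow = boundary_flow +
  fixes M :: "real \<Rightarrow> real"
  assumes M_0: "M 0 = 1"
    and M_der: "\<And>s. s \<ge> 0 \<Longrightarrow> (M has_real_derivative strain (M s) s) (at s within {0..})"
begin

lemma M_der_at: "s > 0 \<Longrightarrow> (M has_real_derivative strain (M s) s) (at s)"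
  using M_der[of s] at_within_interior[of s "{0..}"] by auto

lemma cont_M: "continuous_on {0..} M"
  by (rule DERIV_continuous_on[OF M_der]) auto

lemma M_ge_1: assumes "s \<ge> 0" shows "M s \<ge> 1"
proof -
  have "M 0 \<le> M s"
  proof (rule DERIV_nonneg_imp_increasing_open[OF assms])
    show "continuous_on {0..s} M" by (rule continuous_on_subset[OF cont_M]) auto
    show "\<exists>y. (M has_real_derivative y) (at x) \<and> 0 \<le> y" if "0 < x" "x < s" for x
      using M_der_at[of x] strain_nonneg[of x "M x"] that by auto
  qed
  then show ?thesis by (simp add: M_0)
qed

text \<open>
  At the last point where \<open>M s \<ge> s\<^sup>2\<close> the strain exceeds \<open>2 s\<close>, so \<open>M s - s\<^sup>2\<close> increases strictly there and the
  inequality persists a little longer.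
\<close>

lemma M_ge_square: assumes "s \<ge> 1" shows "M s \<ge> s\<^sup>2"
proof (rule ccontr)
  assume neg: "\<not> M s \<ge> s\<^sup>2"
  define f where "f x = M x - x\<^sup>2" for x
  have contf: "continuous_on {1..s} f" unfolding f_def
    by (intro continuous_intros continuous_on_subset[OF cont_M]) auto
  define S where "S = {1..s} \<inter> f -` {0..}"
  have "compact S"
    unfolding S_def using continuous_on_closed_vimage[of "{1..s}" f] contf
    by (metis closed_atLeast closed_atLeastAtMost compact_Icc compact_Int_closed inf.left_idem inf_commute)
  moreover have "1 \<in> S" using M_ge_1[of 1] assms by (simp add: S_def f_def)
  ultimately obtain x where x: "x \<in> S" "\<And>y. y \<in> S \<Longrightarrow> y \<le> x"
    using compact_attains_sup[of S] by blast
  have x1: "1 \<le> x" "x \<le> s" and fx: "f x \<ge> 0" using x(1) by (auto simp: S_def)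
  have xs: "x < s" using neg fx x1 by (cases "x = s") (auto simp: f_def)
  have "(f has_real_derivative strain (M x) x - 2 * x) (at x)"
    unfolding f_def using x1 by (auto intro!: derivative_eq_intros M_der_at)
  moreover have "strain (M x) x - 2 * x > 0"
    using strain_lower_bound[of x "M x"] x1 fx by (simp add: f_def)
  ultimately obtain d where d: "d > 0" "\<And>h. 0 < h \<Longrightarrow> h < d \<Longrightarrow> f x < f (x + h)"
    using DERIV_pos_inc_right by blast
  define h where "h = min (d / 2) (s - x)"
  have h: "0 < h" "h < d" "x + h \<le> s" using d(1) xs by (auto simp: h_def min_def)
  then have "x + h \<in> S" using d(2)[of h] fx x1 by (auto simp: S_def)
  then show False using x(2) h(1) by fastforce
qed

text \<open>
  An extension to negative intrinsic times, so that the clock has a two-sided derivative at \<open>0\<close> and the theorem on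
  the derivative of an inverse function applies there.
\<close>

definition M_ext :: "real \<Rightarrow> real" where "M_ext s = M (max 0 s)"

lemma M_ext_ge_1: "M_ext s \<ge> 1" by (simp add: M_ext_def M_ge_1)

lemma cont_M_ext: "continuous_on UNIV M_ext"
  unfolding M_ext_def by (rule continuous_on_compose2[OF cont_M]) (auto intro: continuous_intros)

lemma clock_exists: "\<exists>F. F 0 = 0 \<and> (\<forall>s. (F has_real_derivative 1 / M_ext s) (at s))"
proof -
  have "\<exists>F. \<forall>x. - \<infinity> < ereal x \<longrightarrow> ereal x < \<infinity> \<longrightarrow> (F has_vector_derivative 1 / M_ext x) (at x)"
  proof (rule einterval_antiderivative)
    fix x
    have "M_ext x \<noteq> 0" using M_ext_ge_1[of x] by linarith
    then show "isCont (\<lambda>x. 1 / M_ext x) x"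
      using cont_M_ext by (intro continuous_intros) (auto simp: continuous_on_eq_continuous_at)
  qed auto
  then obtain F where F: "\<And>s. (F has_real_derivative 1 / M_ext s) (at s)"
    by (auto simp: has_real_derivative_iff_has_vector_derivative)
  then have "((\<lambda>s. F s - F 0) has_real_derivative 1 / M_ext s) (at s)" for s
    by (auto intro!: derivative_eq_intros)
  then show ?thesis by (intro exI[of _ "\<lambda>s. F s - F 0"]) auto
qed

text \<open>
  Physical time \<open>\<integral>\<^sub>0\<^sup>s d\<sigma> / M \<sigma>\<close> as a function of intrinsic time.
\<close>

definition clock :: "real \<Rightarrow> real" where
  "clock = (SOME F. F 0 = 0 \<and> (\<forall>s. (F has_real_derivative 1 / M_ext s) (at s)))"

lemma clock_0: "clock 0 = 0" and clock_der: "(clock has_real_derivative 1 / M_ext s) (at s)"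
  using someI_ex[OF clock_exists] unfolding clock_def by blast+

lemma isCont_clock: "isCont clock s" using clock_der by (rule DERIV_isCont)

lemma clock_strict_mono: assumes "s < t" shows "clock s < clock t"
proof (rule DERIV_pos_imp_increasing[OF assms])
  show "\<exists>y. (clock has_real_derivative y) (at x) \<and> 0 < y" for x
    using clock_der[of x] M_ext_ge_1[of x] by (intro exI[of _ "1 / M_ext x"]) auto
qed

lemma clock_less_iff: "clock s < clock t \<longleftrightarrow> s < t"
  using clock_strict_mono by (metis linorder_neqE_linordered_idom order_less_asym)

lemma inj_clock: "inj clock"
  using clock_strict_mono by (intro injI) (metis linorder_neqE_linordered_idom order_less_irrefl)

text \<open>
  The part of the integral up to \<open>s = 1\<close> is at most \<open>1\<close> because \<open>M \<ge> 1\<close>; the rest is at most \<open>\<integral>\<^sub>1\<^sup>\<infinity> ds / s\<^sup>2 = 1\<close>.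
\<close>

lemma clock_le: assumes "s \<ge> 0" shows "clock s \<le> 2"
proof -
  have le1: "clock x \<le> x" if "x \<ge> 0" for x
  proof -
    have "clock x - x \<le> clock 0 - 0"
    proof (rule DERIV_nonpos_imp_nonincreasing[OF that, where f="\<lambda>x. clock x - x"])
      fix y
      have "((\<lambda>x. clock x - x) has_real_derivative 1 / M_ext y - 1) (at y)"
        by (intro derivative_intros clock_der)
      then show "\<exists>d. ((\<lambda>x. clock x - x) has_real_derivative d) (at y) \<and> d \<le> 0"
        using M_ext_ge_1[of y] by (intro exI[of _ "1 / M_ext y - 1"]) auto
    qed
    then show ?thesis by (simp add: clock_0)
  qed
  show ?thesis
  proof (cases "s \<le> 1")
    case True then show ?thesis using le1[OF assms] by simp
  next
    case False
    have "clock s + 1 / s \<le> clock 1 + 1 / 1"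
    proof (rule DERIV_nonpos_imp_nonincreasing[where f="\<lambda>x. clock x + 1 / x"])
      fix y :: real assume y: "1 \<le> y"
      have "((\<lambda>x. clock x + 1 / x) has_real_derivative 1 / M_ext y - 1 / y\<^sup>2) (at y)"
        using y by (auto intro!: derivative_eq_intros clock_der simp: power2_eq_square)
      moreover have "1 / M_ext y \<le> 1 / y\<^sup>2"
        by (rule frac_le) (use M_ge_square[OF y] y in \<open>auto simp: M_ext_def max_def\<close>)
      ultimately show "\<exists>d. ((\<lambda>x. clock x + 1 / x) has_real_derivative d) (at y) \<and> d \<le> 0"
        by (intro exI[of _ "1 / M_ext y - 1 / y\<^sup>2"]) auto
    qed (use False in auto)
    moreover have "1 / s > 0" using False by simp
    ultimately show ?thesis using le1[of 1] by linarith
  qed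
qed

definition blowup_time :: real where "blowup_time = Sup (clock ` {0..})"

lemma clock_less_blowup_time: assumes "s \<ge> 0" shows "clock s < blowup_time"
proof -
  have "bdd_above (clock ` {0..})" using clock_le by (auto intro!: bdd_aboveI[of _ 2])
  then have "clock (s + 1) \<le> blowup_time"
    unfolding blowup_time_def using assms by (intro cSup_upper) auto
  then show ?thesis using clock_strict_mono[of s "s + 1"] by simp
qed

lemma blowup_time_pos: "blowup_time > 0"
  using clock_less_blowup_time[of 0] by (simp add: clock_0)

lemma clock_surj: assumes "clock (- 1) \<le> t" "t < blowup_time" shows "t \<in> range clock"
proof -
  obtain s where s: "s \<ge> 0" "t < clock s"
    using less_cSupD[of "clock ` {0..}" t] assms(2) unfolding blowup_time_def by auto
  have "\<exists>x. - 1 \<le> x \<and> x \<le> s \<and> clock x = t"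
    using s assms isCont_clock by (intro IVT) auto
  then show ?thesis by auto
qed

definition intrinsic_time :: "real \<Rightarrow> real" where "intrinsic_time = inv clock"

definition compression :: "real \<Rightarrow> real" where "compression t = M (intrinsic_time t)"

lemma clock_m1_less: "clock (- 1) < 0" using clock_strict_mono[of "-1" 0] by (simp add: clock_0)

lemma clock_intrinsic_time: "clock (- 1) \<le> t \<Longrightarrow> t < blowup_time \<Longrightarrow> clock (intrinsic_time t) = t"
  unfolding intrinsic_time_def using clock_surj f_inv_into_f by metis

lemma intrinsic_time_clock: "intrinsic_time (clock s) = s"
  unfolding intrinsic_time_def using inj_clock by (rule inv_f_f)

lemma intrinsic_time_nonneg: assumes "t \<in> {0..<blowup_time}" shows "intrinsic_time t \<ge> 0"
proof -
  have "clock 0 \<le> clock (intrinsic_time t)" using clock_intrinsic_time[of t] clock_m1_less assms by (simp add: clock_0)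
  then show ?thesis using clock_less_iff[of "intrinsic_time t" 0] by linarith
qed

lemma intrinsic_time_der: assumes t: "t \<in> {0..<blowup_time}"
  shows "(intrinsic_time has_real_derivative compression t) (at t within {0..<blowup_time})"
proof -
  have ct: "clock (intrinsic_time t) = t" using clock_intrinsic_time[of t] clock_m1_less t by simp
  have "isCont intrinsic_time (clock (intrinsic_time t))"
    by (rule isCont_inverse_function[of 1]) (auto simp: intrinsic_time_clock isCont_clock)
  then have cont: "isCont intrinsic_time t" by (simp add: ct)
  have "M_ext (intrinsic_time t) \<noteq> 0" using M_ext_ge_1[of "intrinsic_time t"] by linarith
  then have "(intrinsic_time has_real_derivative inverse (1 / M_ext (intrinsic_time t))) (at t)"
    by (intro DERIV_inverse_function[OF clock_der _ _ _ _ cont, of "clock (- 1)" blowup_time])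
      (use t clock_m1_less clock_intrinsic_time in auto)
  moreover have "M_ext (intrinsic_time t) = compression t" using intrinsic_time_nonneg[OF t] by (simp add: M_ext_def compression_def)
  ultimately show ?thesis by (simp add: has_field_derivative_at_within)
qed

lemma compression_der: assumes t: "t \<in> {0..<blowup_time}"
  shows "(compression has_real_derivative compression t * strain (compression t) (intrinsic_time t)) (at t within {0..<blowup_time})"
proof -
  have "((\<lambda>t. M (intrinsic_time t)) has_real_derivative strain (M (intrinsic_time t)) (intrinsic_time t) * compression t) (at t within {0..<blowup_time})"
    by (rule DERIV_chain_within[OF M_der[OF intrinsic_time_nonneg[OF t]] intrinsic_time_der[OF t]]) (use intrinsic_time_nonneg in auto)
  then show ?thesis by (simp add: compression_def[abs_def] mult.commute)
qed

lemma compression_pos: assumes t: "t \<in> {0..<blowup_time}" shows "compression t > 0"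
  using M_ge_1[OF intrinsic_time_nonneg[OF t]] by (simp add: compression_def)

lemma intrinsic_time_0: "intrinsic_time 0 = 0" using intrinsic_time_clock[of 0] by (simp add: clock_0)

lemma compression_0: "compression 0 = 1" by (simp add: compression_def intrinsic_time_0 M_0)

text \<open>
  Bootstrapping in the differential equation.
\<close>

lemma Ck_on_compression_intrinsic_time: "Ck_on k {0..<blowup_time} compression \<and> Ck_on k {0..<blowup_time} intrinsic_time"
proof (induction k)
  case 0
  show ?case using DERIV_continuous_on[OF compression_der] DERIV_continuous_on[OF intrinsic_time_der] by simp
next
  case (Suc k)
  have "Ck_on k {0..<blowup_time} (\<lambda>t. compression t * strain (compression t) (intrinsic_time t))"
    using Suc intrinsic_time_nonneg by (intro Ck_on_mult Ck_on_strain_compose) auto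
  then show ?case using Suc
    by (auto intro: Ck_on_SucI_real[OF compression_der] Ck_on_SucI_real[OF intrinsic_time_der] simp del: Ck_on.simps)
qed

theorem smooth_solution_up_to_blowup_time:
  "smooth_solution blowup_time (\<lambda>_ _. 0) density0 (sol_omega compression intrinsic_time) (sol_rho compression intrinsic_time)"
proof -
  note Ckm = conjunct1[OF Ck_on_compression_intrinsic_time] and CkE = conjunct2[OF Ck_on_compression_intrinsic_time]
  have integral: "set_integrable lborel quadrant (kernel_integrand (sol_omega compression intrinsic_time) t)"
    "(LINT y:quadrant|lborel. kernel_integrand (sol_omega compression intrinsic_time) t y) = strain (compression t) (intrinsic_time t)"
    if "t \<in> {0..<blowup_time}" for t
    by (rule velocity_integral[OF compression_pos[OF that] intrinsic_time_nonneg[OF that]]; simp add: sol_omega_def)+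
  have vel: "velocity (sol_omega compression intrinsic_time) x1 x2 t = - x1 * strain (compression t) (intrinsic_time t) + x2 * (intrinsic_time t * bump (x1 * compression t))"
    if "t \<in> {0..<blowup_time}" for x1 x2 t
    unfolding velocity_def integral(2)[OF that]
    by (simp add: sol_omega_def scaled_vorticity_boundary[OF intrinsic_time_nonneg[OF that]])
  have "continuous_on (quadrant \<times> {0..<blowup_time}) (\<lambda>((x1, x2), t). velocity (sol_omega compression intrinsic_time) x1 x2 t)"
  proof (rule continuous_on_eq)
    note scale = Ck_on_scale_factors[OF Ckm CkE]
    show "continuous_on (quadrant \<times> {0..<blowup_time}) (\<lambda>z. - fst (fst z) * strain (compression (snd z)) (intrinsic_time (snd z)) +
        snd (fst z) * (intrinsic_time (snd z) * bump (fst (fst z) * compression (snd z))))"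
      by (rule Ck_on_imp_continuous_on[of 0], intro Ck_on_add Ck_on_mult Ck_on_minus Ck_on_fst_fst Ck_on_snd_fst
          Ck_on_bump_compose Ck_on_strain_compose scale) (auto simp: intrinsic_time_nonneg)
  qed (auto simp: vel)
  moreover have "sol_omega compression intrinsic_time x1 x2 0 = 0" "sol_rho compression intrinsic_time x1 x2 0 = density0 x1 x2" for x1 x2
    by (simp_all add: sol_omega_def sol_rho_def intrinsic_time_0 compression_0 scaled_vorticity_def scaled_density_def \<beta>_0)
  ultimately show ?thesis
    unfolding smooth_solution_def smooth_on_def
    using Ck_on_sol[OF Ckm CkE intrinsic_time_nonneg] integral(1)
      sol_pde[OF compression_der intrinsic_time_der intrinsic_time_nonneg compression_pos Ckm CkE _ _ _ vel] by auto
qed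

text \<open>
  For an arbitrary solution, \<open>m\<close> and \<open>M \<circ> E\<close> have the derivatives \<open>m strain(m, E)\<close> and \<open>m strain(M \<circ> E, E)\<close>. As the
  strain is Lipschitz in its first argument, Gronwall's argument gives \<open>m = M \<circ> E\<close>. Then \<open>E' = M \<circ> E\<close> says that the clock reads \<open>t\<close> at the intrinsic time \<open>E t\<close>. As the clock never
  reaches \<open>blowup_time\<close>, neither does the solution.
\<close>

theorem smooth_solution_unique:
  assumes sol: "smooth_solution T (\<lambda>_ _. 0) density0 \<omega> \<rho>"
  shows "T \<le> blowup_time"
    and "\<And>x1 x2 t. x1 \<ge> 0 \<Longrightarrow> x2 \<ge> 0 \<Longrightarrow> t \<in> {0..<T} \<Longrightarrow>
      \<omega> x1 x2 t = sol_omega compression intrinsic_time x1 x2 t \<and> \<rho> x1 x2 t = sol_rho compression intrinsic_time x1 x2 t"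
proof -
  obtain m E where m_0: "m 0 = 1" and E_0: "E 0 = 0" and m_pos: "\<And>t. t \<in> {0..<T} \<Longrightarrow> m t > 0"
    and E_nonneg: "\<And>t. t \<in> {0..<T} \<Longrightarrow> E t \<ge> 0"
    and m_der: "\<And>t. t \<in> {0..<T} \<Longrightarrow> (m has_real_derivative m t * strain (m t) (E t)) (at t within {0..<T})"
    and E_der: "\<And>t. t \<in> {0..<T} \<Longrightarrow> (E has_real_derivative m t) (at t within {0..<T})"
    and eq: "\<And>x1 x2 t. x1 \<ge> 0 \<Longrightarrow> x2 \<ge> 0 \<Longrightarrow> t \<in> {0..<T} \<Longrightarrow>
       \<omega> x1 x2 t = sol_omega m E x1 x2 t \<and> \<rho> x1 x2 t = sol_rho m E x1 x2 t"
    using solution_representation[OF sol] by blast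
  have mM: "m t1 = M (E t1)" if t1: "t1 \<in> {0..<T}" for t1
  proof -
    have sub: "{0..t1} \<subseteq> {0..<T}" using t1 by auto
    have "continuous_on {0..t1} (\<lambda>t. m t * strain_lipschitz (E t))"
      by (intro continuous_intros continuous_on_compose2[OF cont_strain_lipschitz]
          continuous_on_subset[OF DERIV_continuous_on[OF m_der] sub] continuous_on_subset[OF DERIV_continuous_on[OF E_der] sub])
        (use E_nonneg sub in auto)
    then have "bounded ((\<lambda>t. m t * strain_lipschitz (E t)) ` {0..t1})"
      by (intro compact_imp_bounded compact_continuous_image) auto
    then obtain k where k: "\<And>t. t \<in> {0..t1} \<Longrightarrow> \<bar>m t * strain_lipschitz (E t)\<bar> \<le> k"
      unfolding bounded_iff by force
    have "m t1 - M (E t1) = 0"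
    proof (rule gronwall_zero[where d="\<lambda>t. m t - M (E t)" and b=t1 and k=k])
      fix t assume t: "t \<in> {0..t1}"
      then have tT: "t \<in> {0..<T}" using sub by auto
      have "E ` {0..t1} \<subseteq> {0..}" using E_nonneg sub by auto
      then show "((\<lambda>t. m t - M (E t)) has_real_derivative m t * strain (m t) (E t) - strain (M (E t)) (E t) * m t) (at t within {0..t1})"
        by (intro DERIV_diff DERIV_subset[OF m_der[OF tT] sub]
            DERIV_chain_within[OF M_der[OF E_nonneg[OF tT]] DERIV_subset[OF E_der[OF tT] sub]])
      have "\<bar>m t * strain (m t) (E t) - strain (M (E t)) (E t) * m t\<bar> = m t * \<bar>strain (m t) (E t) - strain (M (E t)) (E t)\<bar>"
        using m_pos[OF tT] by (simp add: abs_mult mult.commute flip: right_diff_distrib)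
      also have "\<dots> \<le> m t * (strain_lipschitz (E t) * \<bar>m t - M (E t)\<bar>)"
        using m_pos[OF tT] by (intro mult_left_mono strain_is_lipschitz E_nonneg tT) auto
      also have "\<dots> = (m t * strain_lipschitz (E t)) * \<bar>m t - M (E t)\<bar>" by simp
      also have "\<dots> \<le> k * \<bar>m t - M (E t)\<bar>"
        using k[OF t] by (intro mult_right_mono) auto
      finally show "\<bar>m t * strain (m t) (E t) - strain (M (E t)) (E t) * m t\<bar> \<le> k * \<bar>m t - M (E t)\<bar>" .
    qed (use t1 in \<open>auto simp: m_0 E_0 M_0\<close>)
    then show ?thesis by simp
  qed
  have clockE: "clock (E t1) = t1" if t1: "t1 \<in> {0..<T}" for t1
  proof -
    have sub: "{0..t1} \<subseteq> {0..<T}" using t1 by auto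
    have "clock (E t1) - t1 = clock (E 0) - 0"
    proof (rule zero_derivative_imp_eq)
      fix t assume t: "t \<in> {0..t1}"
      then have tT: "t \<in> {0..<T}" using sub by auto
      have "1 / M_ext (E t) * m t - 1 = 0"
        using mM[OF tT] E_nonneg[OF tT] m_pos[OF tT] by (simp add: M_ext_def)
      moreover have "((\<lambda>t. clock (E t) - t) has_real_derivative 1 / M_ext (E t) * m t - 1) (at t within {0..t1})"
        by (intro DERIV_diff DERIV_chain2[OF clock_der DERIV_subset[OF E_der[OF tT] sub]] DERIV_ident)
      ultimately show "((\<lambda>t. clock (E t) - t) has_real_derivative 0) (at t within {0..t1})" by simp
    qed (use t1 in auto)
    then show ?thesis by (simp add: E_0 clock_0)
  qed
  show "T \<le> blowup_time"
  proof (rule ccontr)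
    assume "\<not> T \<le> blowup_time"
    then have t: "blowup_time \<in> {0..<T}" using blowup_time_pos by auto
    show False using clock_less_blowup_time[OF E_nonneg[OF t]] clockE[OF t] by simp
  qed
  fix x1 x2 t assume *: "x1 \<ge> (0::real)" "x2 \<ge> (0::real)" "t \<in> {0..<T}"
  have "E t = intrinsic_time t" using clockE[OF *(3)] intrinsic_time_clock[of "E t"] by simp
  moreover have "m t = compression t" using mM[OF *(3)] by (simp add: compression_def calculation)
  ultimately show "\<omega> x1 x2 t = sol_omega compression intrinsic_time x1 x2 t \<and> \<rho> x1 x2 t = sol_rho compression intrinsic_time x1 x2 t"
    using eq[OF *] by (simp add: sol_omega_def sol_rho_def)
qed

theorem blows_up: "blows_up_in_finite_time (\<lambda>_ _. 0) density0"
  unfolding blows_up_in_finite_time_def maximal_smooth_solution_def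
  using blowup_time_pos smooth_solution_up_to_blowup_time smooth_solution_unique by blast

end

theorem theorem1p2:
  "\<exists>\<omega>0 \<rho>0 :: real \<Rightarrow> real \<Rightarrow> real.
     admissible_data \<omega>0 \<and> admissible_data \<rho>0 \<and> blows_up_in_finite_time \<omega>0 \<rho>0"
proof -
  obtain \<beta> J where "boundary_flow \<beta> J" using boundary_flow_exists by blast
  then interpret boundary_flow \<beta> J .
  obtain M where "M 0 = 1" "\<And>s. s \<ge> 0 \<Longrightarrow> (M has_real_derivative strain (M s) s) (at s within {0..})"
    using scale_exists by blast
  then interpret scale_flow \<beta> J M by unfold_locales
  show ?thesis using admissible_zero admissible_density0 blows_up by blast
qed

end
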